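(* Let $M$ be the union of an increasing sequence of open subsets $M_j$ in a Stein manifold $X$ of dimension $n$, each of which is biholomorphic to $\mathbb{B}^n$. If $M=X\setminus P$ for some closed complete pluripolar set $P$ in $X$, then the corank of $F_M$ is at least one. In particular, $M$ cannot be hyperbolic.
   Context: $\mathbb{B}^n$ is the unit ball in $\mathbb{C}^n$. A subset $P\subset X$ is complete pluripolar if $P=\{\varphi=-\infty\}$ for some plurisubharmonic function $\varphi$ on $X$ that is not identically $-\infty$ on any connected component of $X$. Hyperbolic means Kobayashi hyperbolic. $F_M$ is the infinitesimal Kobayashi metric of $M$; its corank is the complex dimension of $\{v\in T_pM:F_M(p,v)=0\}$ (with $T_pM$ the holomorphic tangent space), which is independent of $p$ in this setting.
   Formalization: The closed complete pluripolar set P is assumed non-empty; with P empty the claim fails, e.g. for X = M = M_j = the unit ball, where F_M has corank 0 and M is hyperbolic. *)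

theory Defs
  imports "HOL-Complex_Analysis.Complex_Analysis" "HOL-Library.Function_Algebras"
begin

section \<open>Several complex variables\<close>

definition mv_holomorphic_on ::
    "((complex, 'n::finite) vec \<Rightarrow> complex) \<Rightarrow> (complex, 'n) vec set \<Rightarrow> bool" where
  "mv_holomorphic_on f S \<longleftrightarrow>
     (\<forall>z\<in>S. \<exists>D. (f has_derivative D) (at z) \<and> Vector_Spaces.linear (*s) (*) D)"

text \<open>An extended-real-valued integrand of arbitrary sign is integrated as the integral of
  its positive part minus that of its negative part (\<open>e2ennreal\<close> truncates negative values
  to 0).  For an upper semicontinuous function with values below infinity the former is finite.\<close>

definition circle_mean :: "(real \<Rightarrow> ereal) \<Rightarrow> ereal" where
  "circle_mean g = ereal (1 / (2 * pi)) *
     (enn2ereal (\<integral>\<^sup>+\<theta>\<in>{0..2 * pi}. e2ennreal (g \<theta>) \<partial>lborel)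
      - enn2ereal (\<integral>\<^sup>+\<theta>\<in>{0..2 * pi}. e2ennreal (- g \<theta>) \<partial>lborel))"

text \<open>Values lie in \<open>[-\<infinity>, \<infinity>)\<close>; the function that is constantly \<open>-\<infinity>\<close> counts as
  plurisubharmonic.\<close>

definition mv_psh_on :: "((complex, 'n::finite) vec \<Rightarrow> ereal) \<Rightarrow> (complex, 'n) vec set \<Rightarrow> bool" where
  "mv_psh_on u S \<longleftrightarrow>
     (\<forall>z\<in>S. u z \<noteq> \<infinity>) \<and>
     (\<forall>c. open {z \<in> S. u z < c}) \<and>
     (\<forall>a v. {a + \<zeta> *s v |\<zeta>. cmod \<zeta> \<le> 1} \<subseteq> S \<longrightarrow> u a \<le> circle_mean (\<lambda>\<theta>. u (a + cis \<theta> *s v)))"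


section \<open>Complex manifolds\<close>

text \<open>A chart is a pair of its domain and its coordinate map; the values of the coordinate map
  outside the domain are irrelevant.\<close>

type_synonym ('a, 'n) chart = "'a set \<times> ('a \<Rightarrow> (complex, 'n) vec)"

definition complex_chart :: "'a topology \<Rightarrow> ('a, 'n::finite) chart \<Rightarrow> bool" where
  "complex_chart X = (\<lambda>(U, \<phi>). openin X U \<and> open (\<phi> ` U) \<and>
     homeomorphic_map (subtopology X U) (top_of_set (\<phi> ` U)) \<phi>)"

definition transition_map :: "('a, 'n::finite) chart \<Rightarrow> ('a, 'n) chart
    \<Rightarrow> (complex, 'n) vec \<Rightarrow> (complex, 'n) vec" where
  "transition_map c d = snd d \<circ> inv_into (fst c) (snd c)"

text \<open>The atlas need not be maximal.\<close>

definition complex_manifold :: "'a topology \<Rightarrow> ('a, 'n::finite) chart set \<Rightarrow> bool" where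
  "complex_manifold X A \<longleftrightarrow>
     Hausdorff_space X \<and> second_countable X \<and>
     (\<forall>c\<in>A. complex_chart X c) \<and> topspace X = (\<Union>c\<in>A. fst c) \<and>
     (\<forall>c\<in>A. \<forall>d\<in>A. \<forall>i.
        mv_holomorphic_on (\<lambda>z. transition_map c d z $ i) (snd c ` (fst c \<inter> fst d)))"

text \<open>In the following definitions \<open>W\<close> is an open subset of the manifold.\<close>

definition mfd_holomorphic_on ::
    "('a, 'n::finite) chart set \<Rightarrow> 'a set \<Rightarrow> ('a \<Rightarrow> complex) \<Rightarrow> bool" where
  "mfd_holomorphic_on A W f \<longleftrightarrow>
     (\<forall>(U, \<phi>)\<in>A. mv_holomorphic_on (f \<circ> inv_into U \<phi>) (\<phi> ` (U \<inter> W)))"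

definition mfd_psh_on :: "('a, 'n::finite) chart set \<Rightarrow> 'a set \<Rightarrow> ('a \<Rightarrow> ereal) \<Rightarrow> bool" where
  "mfd_psh_on A W u \<longleftrightarrow> (\<forall>(U, \<phi>)\<in>A. mv_psh_on (u \<circ> inv_into U \<phi>) (\<phi> ` (U \<inter> W)))"

definition complete_pluripolar ::
    "'a topology \<Rightarrow> ('a, 'n::finite) chart set \<Rightarrow> 'a set \<Rightarrow> bool" where
  "complete_pluripolar X A P \<longleftrightarrow>
     (\<exists>u. mfd_psh_on A (topspace X) u \<and>
          (\<forall>C\<in>connected_components_of X. \<exists>x\<in>C. u x \<noteq> -\<infinity>) \<and>
          P = {x \<in> topspace X. u x = -\<infinity>})"

definition holomorphic_hull ::
    "'a topology \<Rightarrow> ('a, 'n::finite) chart set \<Rightarrow> 'a set \<Rightarrow> 'a set" where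
  "holomorphic_hull X A K =
     {x \<in> topspace X. \<forall>f. mfd_holomorphic_on A (topspace X) f \<longrightarrow>
        ereal (cmod (f x)) \<le> (SUP y\<in>K. ereal (cmod (f y)))}"

definition stein_manifold :: "'a topology \<Rightarrow> ('a, 'n::finite) chart set \<Rightarrow> bool" where
  "stein_manifold X A \<longleftrightarrow>
     complex_manifold X A \<and>
     (\<forall>K. compactin X K \<longrightarrow> compactin X (holomorphic_hull X A K)) \<and>
     (\<forall>x\<in>topspace X. \<forall>y\<in>topspace X. x \<noteq> y \<longrightarrow>
        (\<exists>f. mfd_holomorphic_on A (topspace X) f \<and> f x \<noteq> f y))"

definition biholomorphic_to_ball ::
    "'a topology \<Rightarrow> ('a, 'n::finite) chart set \<Rightarrow> 'a set \<Rightarrow> bool" where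
  "biholomorphic_to_ball X A W \<longleftrightarrow>
     (\<exists>(g :: 'a \<Rightarrow> (complex, 'n) vec) h.
        (\<forall>i. mfd_holomorphic_on A W (\<lambda>x. g x $ i)) \<and>
        continuous_map (top_of_set (ball 0 1)) X h \<and>
        (\<forall>(U, \<phi>)\<in>A. \<forall>i. mv_holomorphic_on (\<lambda>z. \<phi> (h z) $ i) {z \<in> ball 0 1. h z \<in> U}) \<and>
        (\<forall>x\<in>W. g x \<in> ball 0 1 \<and> h (g x) = x) \<and>
        (\<forall>z\<in>ball 0 1. h z \<in> W \<and> g (h z) = z))"


section \<open>Tangent spaces\<close>

text \<open>A holomorphic tangent vector at \<open>p\<close> is the family of its coordinate vectors in the charts
  of the atlas around \<open>p\<close>, any two of which are related by the differential of the transition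
  map.  Charts not containing \<open>p\<close> get the dummy value 0, so that the tangent space is a complex
  vector space under the pointwise operations.\<close>

type_synonym ('a, 'n) tangent = "('a, 'n) chart \<Rightarrow> (complex, 'n) vec"

definition tangent_scale :: "complex \<Rightarrow> ('a, 'n::finite) tangent \<Rightarrow> ('a, 'n) tangent" where
  "tangent_scale k v = (\<lambda>c. k *s v c)"

lemma vector_space_tangent_scale: "vector_space tangent_scale"
  by unfold_locales
     (auto simp: tangent_scale_def fun_eq_iff vec.scale_right_distrib vec.scale_left_distrib)

definition tangent_space :: "('a, 'n::finite) chart set \<Rightarrow> 'a \<Rightarrow> ('a, 'n) tangent set" where
  "tangent_space A p =
     {v. (\<forall>c. \<not> (c \<in> A \<and> p \<in> fst c) \<longrightarrow> v c = 0) \<and>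
         (\<forall>c\<in>A. \<forall>d\<in>A. p \<in> fst c \<and> p \<in> fst d \<longrightarrow>
            v d = frechet_derivative (transition_map c d) (at (snd c p)) (v c))}"


section \<open>The Kobayashi metric and the Kobayashi pseudodistance\<close>

text \<open>Holomorphic maps from the unit disc into an open subset \<open>M\<close> of the manifold.\<close>

definition holomorphic_disc ::
    "'a topology \<Rightarrow> ('a, 'n::finite) chart set \<Rightarrow> 'a set \<Rightarrow> (complex \<Rightarrow> 'a) \<Rightarrow> bool" where
  "holomorphic_disc X A M f \<longleftrightarrow>
     continuous_map (top_of_set (ball 0 1)) X f \<and> f ` ball 0 1 \<subseteq> M \<and>
     (\<forall>(U, \<phi>)\<in>A. \<forall>i. (\<lambda>\<zeta>. \<phi> (f \<zeta>) $ i) holomorphic_on {\<zeta> \<in> ball 0 1. f \<zeta> \<in> U})"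

definition disc_velocity :: "('a, 'n::finite) chart set \<Rightarrow> (complex \<Rightarrow> 'a) \<Rightarrow> ('a, 'n) tangent" where
  "disc_velocity A f = (\<lambda>c. if c \<in> A \<and> f 0 \<in> fst c
     then (\<chi> i. deriv (\<lambda>\<zeta>. snd c (f \<zeta>) $ i) 0) else 0)"

definition kobayashi_metric ::
    "'a topology \<Rightarrow> ('a, 'n::finite) chart set \<Rightarrow> 'a set \<Rightarrow> 'a \<Rightarrow> ('a, 'n) tangent \<Rightarrow> real" where
  "kobayashi_metric X A M p v =
     Inf {r. 0 < r \<and> (\<exists>f. holomorphic_disc X A M f \<and> f 0 = p \<and>
                          v = tangent_scale (complex_of_real r) (disc_velocity A f))}"

definition kobayashi_corank ::
    "'a topology \<Rightarrow> ('a, 'n::finite) chart set \<Rightarrow> 'a set \<Rightarrow> 'a \<Rightarrow> nat" where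
  "kobayashi_corank X A M p =
     vector_space.dim tangent_scale {v \<in> tangent_space A p. kobayashi_metric X A M p v = 0}"

definition poincare_dist :: "complex \<Rightarrow> complex \<Rightarrow> real" where
  "poincare_dist a b = artanh (cmod ((a - b) / (1 - cnj a * b)))"

text \<open>Infimum over chains of \<open>k\<close> holomorphic discs from \<open>p = x 0\<close> to \<open>q = x k\<close>, where the
  \<open>i\<close>-th disc joins \<open>x i\<close> to \<open>x (Suc i)\<close>.  It is infinite if there is no such chain.\<close>

definition kobayashi_dist ::
    "'a topology \<Rightarrow> ('a, 'n::finite) chart set \<Rightarrow> 'a set \<Rightarrow> 'a \<Rightarrow> 'a \<Rightarrow> ereal" where
  "kobayashi_dist X A M p q =
     Inf {ereal (\<Sum>i<k. poincare_dist (a i) (b i)) |k x f a b.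
            x 0 = p \<and> x k = q \<and>
            (\<forall>i<k. holomorphic_disc X A M (f i) \<and> a i \<in> ball 0 1 \<and> b i \<in> ball 0 1 \<and>
                   f i (a i) = x i \<and> f i (b i) = x (Suc i))}"

definition kobayashi_hyperbolic ::
    "'a topology \<Rightarrow> ('a, 'n::finite) chart set \<Rightarrow> 'a set \<Rightarrow> bool" where
  "kobayashi_hyperbolic X A M \<longleftrightarrow>
     (\<forall>p\<in>M. \<forall>q\<in>M. p \<noteq> q \<longrightarrow> 0 < kobayashi_dist X A M p q)"

end

theory Submission
  imports Defs
begin

text \<open>If \<open>F\<^sub>M\<close> has corank 0 at \<open>p\<close>, normalise the biholomorphisms \<open>g\<^sub>j\<close> from \<open>M\<^sub>j\<close> onto the
  ball by \<open>g\<^sub>j(p) = 0\<close>.  The derivatives of the \<open>g\<^sub>j\<close> at \<open>p\<close> then subconverge to an invertible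
  map, so that the self-maps \<open>g\<^sub>k \<circ> g\<^sub>j\<^sup>-\<^sup>1\<close> of the ball have derivatives close to the identity
  at 0.  By the Schwarz lemma they are close to the identity on every smaller ball.  Hence the
  \<open>g\<^sub>j\<close> converge to a holomorphic map \<open>G\<close> from \<open>M\<close> to the ball, and \<open>\<bar>G\<bar>\<close> is an exhaustion
  of \<open>M\<close>.  But \<open>\<bar>G\<bar>\<^sup>2 < 1\<close> is plurisubharmonic off the pluripolar set \<open>P\<close>, and by the maximum
  principle it is bounded away from 1 near a boundary point of \<open>P\<close>, a contradiction.

  A tangent vector of length 0 is realised by holomorphic discs of arbitrarily large velocity.
  Such discs leave a given coordinate ball arbitrarily close to their centre, so that \<open>p\<close> has
  Kobayashi distance 0 from some point of the bounding sphere.\<close>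

unbundle no Formal_Power_Series.fps_syntax

section \<open>Holomorphic maps between complex vector spaces\<close>

text \<open>Two things can go wrong with a limit of the g_j: it may fail to exist, and its norm may
  fail to exhaust M. One quantitative estimate settles both. If a self-map T of the ball fixes 0 and
  its derivative at 0 is within \<epsilon> of the identity, then |T z - z|^2 is at most 4 \<epsilon>
  / (1 - r) for |z| \<le> r. This makes the g_j Cauchy wherever |g_j| \<le> r. Combined with
  Brouwer's theorem it makes T cover a slightly smaller ball, so that {|G| \<le> r} lies in a
  compact part of a single M_j. The derivative of T is close to the identity for an algebraic
  reason: with A_j the derivative of g_j in the coordinates of M_0, it equals A_k A_j^(-1), and both
  factors are near one invertible limit. On a complex line |G|^2 is only compared with its tangent
  at a maximum point. That tangent is the real part of a holomorphic function, so the sub-mean value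
  inequality is needed for the function u with poles P and for nothing else. A boundary point of P
  exists because P is closed and nonempty: if P were also open, it would contain a whole component,
  on which u would be identically -\<infinity>.\<close>

definition hol_map_on ::
    "((complex, 'n::finite) vec \<Rightarrow> (complex, 'm::finite) vec) \<Rightarrow> (complex, 'n) vec set \<Rightarrow> bool" where
  "hol_map_on F S \<longleftrightarrow>
     (\<forall>z\<in>S. \<exists>D. (F has_derivative D) (at z) \<and> (\<forall>c v. D (c *s v) = c *s D v))"

lemma has_derivative_vec_nth:
  fixes F :: "'a::real_normed_vector \<Rightarrow> ('b::real_normed_vector, 'm::finite) vec"
  assumes "(F has_derivative D) G"
  shows "((\<lambda>z. F z $ i) has_derivative (\<lambda>v. D v $ i)) G"
  using bounded_linear.has_derivative[OF bounded_linear_vec_nth assms] .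

lemma has_derivative_vec_lambda:
  fixes F :: "'a::real_normed_vector \<Rightarrow> (complex, 'm::finite) vec"
  assumes "\<And>i. ((\<lambda>z. F z $ i) has_derivative D i) G"
  shows "(F has_derivative (\<lambda>v. \<chi> i. D i v)) G"
proof -
  have bl: "bounded_linear (axis i :: complex \<Rightarrow> (complex, 'm) vec)" for i
    by (rule linear_conv_bounded_linear[THEN iffD1])
       (auto simp: linear_iff axis_def vec_eq_iff)
  have *: "x = (\<Sum>i\<in>UNIV. axis i (x $ i))" for x :: "(complex, 'm) vec"
    by (simp add: vec_eq_iff axis_def if_distrib sum.If_cases)
  have "((\<lambda>z. \<Sum>i\<in>UNIV. axis i (F z $ i)) has_derivative (\<lambda>v. \<Sum>i\<in>UNIV. axis i (D i v))) G"
    by (intro has_derivative_sum bounded_linear.has_derivative[OF bl] assms)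
  moreover have "(\<lambda>z. \<Sum>i\<in>UNIV. axis i (F z $ i)) = F"
    using * by fastforce
  moreover have "(\<lambda>v. \<Sum>i\<in>UNIV. axis i (D i v)) = (\<lambda>v. \<chi> i. D i v)"
    using *[of "\<chi> i. D i v" for v] by (auto simp: fun_eq_iff)
  ultimately show ?thesis by simp
qed

text \<open>A real derivative is additive already, so complex homogeneity is all that separates it
  from a complex linear map. \<open>hol_map_on\<close> is phrased in the same way.\<close>

lemma mv_holomorphic_on_iff:
  "mv_holomorphic_on f S \<longleftrightarrow>
     (\<forall>z\<in>S. \<exists>D. (f has_derivative D) (at z) \<and> (\<forall>c v. D (c *s v) = c * D v))"
proof -
  have "Vector_Spaces.linear (*s) (*) D \<longleftrightarrow> (\<forall>c v. D (c *s v) = c * D v)"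
    if "(f has_derivative D) (at z)" for D z
  proof
    assume "Vector_Spaces.linear (*s) (*) D"
    then interpret Vector_Spaces.linear "(*s)" "(*)" D .
    show "\<forall>c v. D (c *s v) = c * D v" using scale by auto
  next
    assume s: "\<forall>c v. D (c *s v) = c * D v"
    interpret D: bounded_linear D using that has_derivative_bounded_linear by blast
    show "Vector_Spaces.linear (*s) (*) D"
      by unfold_locales (simp_all add: s D.add vec.scale_right_distrib vec.scale_left_distrib distrib_left distrib_right)
  qed
  then show ?thesis
    unfolding mv_holomorphic_on_def by blast
qed

lemma hol_map_on_iff: "hol_map_on F S \<longleftrightarrow> (\<forall>i. mv_holomorphic_on (\<lambda>z. F z $ i) S)"
proof
  assume F: "hol_map_on F S"
  show "\<forall>i. mv_holomorphic_on (\<lambda>z. F z $ i) S"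
    unfolding mv_holomorphic_on_iff
  proof (intro allI ballI)
    fix i z assume "z \<in> S"
    then obtain D where "(F has_derivative D) (at z)" "\<forall>c v. D (c *s v) = c *s D v"
      using F unfolding hol_map_on_def by blast
    then show "\<exists>D. ((\<lambda>z. F z $ i) has_derivative D) (at z) \<and> (\<forall>c v. D (c *s v) = c * D v)"
      by (intro exI[of _ "\<lambda>v. D v $ i"]) (simp add: has_derivative_vec_nth)
  qed
next
  assume *: "\<forall>i. mv_holomorphic_on (\<lambda>z. F z $ i) S"
  show "hol_map_on F S"
    unfolding hol_map_on_def
  proof
    fix z assume "z \<in> S"
    then have "\<forall>i. \<exists>D. ((\<lambda>z. F z $ i) has_derivative D) (at z) \<and> (\<forall>c v. D (c *s v) = c * D v)"
      using * unfolding mv_holomorphic_on_iff by blast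
    then obtain D where D: "\<And>i. ((\<lambda>z. F z $ i) has_derivative D i) (at z)"
      "\<And>i c v. D i (c *s v) = c * D i v" by metis
    show "\<exists>D. (F has_derivative D) (at z) \<and> (\<forall>c v. D (c *s v) = c *s D v)"
      using has_derivative_vec_lambda[OF D(1)] D(2) by (auto simp: vec_eq_iff intro!: exI)
  qed
qed

lemma hol_map_on_subset: "hol_map_on F S \<Longrightarrow> T \<subseteq> S \<Longrightarrow> hol_map_on F T"
  unfolding hol_map_on_def by blast

lemma hol_map_on_imp_continuous_on: "hol_map_on F S \<Longrightarrow> continuous_on S F"
  unfolding hol_map_on_def continuous_on_eq_continuous_within
  by (meson continuous_at_imp_continuous_at_within has_derivative_continuous)

lemma hol_map_on_compose:
  assumes "hol_map_on F S" "hol_map_on G T" "F ` S \<subseteq> T"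
  shows "hol_map_on (\<lambda>z. G (F z)) S"
  unfolding hol_map_on_def
proof
  fix z assume "z \<in> S"
  then obtain D E where "(F has_derivative D) (at z)" "\<forall>c v. D (c *s v) = c *s D v"
    "(G has_derivative E) (at (F z))" "\<forall>c v. E (c *s v) = c *s E v"
    using assms unfolding hol_map_on_def by blast
  then show "\<exists>D. ((\<lambda>z. G (F z)) has_derivative D) (at z) \<and> (\<forall>c v. D (c *s v) = c *s D v)"
    by (intro exI[of _ "\<lambda>v. E (D v)"]) (auto intro: has_derivative_compose)
qed

lemma hol_map_on_cong_open:
  assumes "open S" "\<And>z. z \<in> S \<Longrightarrow> F z = G z" "hol_map_on F S"
  shows "hol_map_on G S"
  using assms unfolding hol_map_on_def
  by (metis has_derivative_transform_within_open)

lemma hol_map_on_local: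
  assumes "\<And>z. z \<in> S \<Longrightarrow> \<exists>U. z \<in> U \<and> hol_map_on F U"
  shows "hol_map_on F S"
  using assms unfolding hol_map_on_def by blast

lemma frechet_derivative_hol_map:
  assumes "hol_map_on F S" "z \<in> S"
  shows "(F has_derivative frechet_derivative F (at z)) (at z)"
    and "frechet_derivative F (at z) (c *s v) = c *s frechet_derivative F (at z) v"
proof -
  obtain D where D: "(F has_derivative D) (at z)" "\<forall>c v. D (c *s v) = c *s D v"
    using assms unfolding hol_map_on_def by blast
  moreover have "D = frechet_derivative F (at z)"
    using D(1) frechet_derivative_at by blast
  ultimately show "(F has_derivative frechet_derivative F (at z)) (at z)"
    "frechet_derivative F (at z) (c *s v) = c *s frechet_derivative F (at z) v" by auto
qed

section \<open>Restriction to complex lines\<close>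

lemma norm_vector_smult: "norm (c *s v) = cmod c * norm (v :: (complex, 'n::finite) vec)"
  by (simp add: norm_vec_def norm_mult L2_set_right_distrib)

lemma bounded_linear_smult_left: "bounded_linear (\<lambda>\<zeta>. \<zeta> *s (v :: (complex, 'n::finite) vec))"
  by (rule linear_conv_bounded_linear[THEN iffD1])
     (auto simp: linear_iff vec_eq_iff algebra_simps)

lemma has_derivative_line:
  "((\<lambda>\<zeta>. a + \<zeta> *s v) has_derivative (\<lambda>\<zeta>. \<zeta> *s v)) (at \<zeta>)"
  for v :: "(complex, 'n::finite) vec"
  using bounded_linear_imp_has_derivative[OF bounded_linear_smult_left]
  by (auto intro!: derivative_eq_intros)

lemma continuous_on_line: "continuous_on S (\<lambda>\<zeta>. a + \<zeta> *s v)"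
  for v :: "(complex, 'n::finite) vec"
  using has_derivative_line has_derivative_continuous
  by (metis continuous_at_imp_continuous_on)

lemma open_line_preimage: "open S \<Longrightarrow> open {\<zeta>. a + \<zeta> *s v \<in> S}"
  for v :: "(complex, 'n::finite) vec"
  using open_vimage[of S "\<lambda>\<zeta>. a + \<zeta> *s v"] continuous_on_line by (auto simp: vimage_def)

lemma hol_map_line_has_field_derivative:
  fixes F :: "(complex, 'n::finite) vec \<Rightarrow> (complex, 'm::finite) vec"
  assumes "(F has_derivative D) (at (a + \<zeta> *s v))" "\<And>c v. D (c *s v) = c *s D v"
  shows "((\<lambda>\<zeta>. F (a + \<zeta> *s v) $ i) has_field_derivative D v $ i) (at \<zeta>)"
proof -
  have "((\<lambda>\<zeta>. F (a + \<zeta> *s v) $ i) has_derivative (\<lambda>c. D (c *s v) $ i)) (at \<zeta>)"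
    using has_derivative_compose[OF has_derivative_line assms(1)] by (rule has_derivative_vec_nth)
  then show ?thesis
    unfolding has_field_derivative_def by (simp add: assms(2) mult_commute_abs)
qed

lemma hol_map_line_holomorphic_on:
  assumes "hol_map_on F S" "\<And>\<zeta>. \<zeta> \<in> T \<Longrightarrow> a + \<zeta> *s v \<in> S"
  shows "(\<lambda>\<zeta>. F (a + \<zeta> *s v) $ i) holomorphic_on T"
  unfolding holomorphic_on_def
proof
  fix \<zeta> assume "\<zeta> \<in> T"
  then have "a + \<zeta> *s v \<in> S" using assms by blast
  then have "((\<lambda>\<zeta>. F (a + \<zeta> *s v) $ i) has_field_derivative
      frechet_derivative F (at (a + \<zeta> *s v)) v $ i) (at \<zeta>)"
    by (intro hol_map_line_has_field_derivative frechet_derivative_hol_map[OF assms(1)])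
  then show "(\<lambda>\<zeta>. F (a + \<zeta> *s v) $ i) field_differentiable at \<zeta> within T"
    using field_differentiable_at_within field_differentiable_def by blast
qed

section \<open>The Hermitian product\<close>

text \<open>Linear in the first argument, so that \<open>herm (F \<zeta>) w\<close> is holomorphic
  along with \<open>F\<close>. Statements about vector-valued maps thereby reduce to scalar
  ones.\<close>

definition herm :: "(complex, 'n::finite) vec \<Rightarrow> (complex, 'n) vec \<Rightarrow> complex" where
  "herm z w = (\<Sum>i\<in>UNIV. z $ i * cnj (w $ i))"

lemma herm_add_left: "herm (x + y) w = herm x w + herm y w"
  and herm_diff_left: "herm (x - y) w = herm x w - herm y w"
  and herm_smult_left: "herm (c *s x) w = c * herm x w"
  and herm_smult_right: "herm x (c *s w) = cnj c * herm x w"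
  and herm_zero_left [simp]: "herm 0 w = 0"
  by (simp_all add: herm_def algebra_simps sum.distrib sum_subtractf sum_distrib_left)

lemma Re_herm: "Re (herm z w) = z \<bullet> w"
  by (simp add: herm_def inner_vec_def inner_complex_def)

lemma herm_self: "herm z z = complex_of_real ((norm z)\<^sup>2)"
proof -
  have "Im (herm z z) = 0" by (simp add: herm_def)
  then show ?thesis
    by (simp add: complex_eq_iff Re_herm power2_norm_eq_inner)
qed

lemma cmod_herm_le: "cmod (herm z w) \<le> norm z * norm w"
proof -
  \<comment> \<open>Rotating the phase makes the product real, and the real Cauchy-Schwarz
    inequality applies.\<close>
  define c where "c = cnj (sgn (herm z w))"
  have c: "cmod c \<le> 1" by (simp add: c_def norm_sgn)
  have "complex_of_real (cmod (herm z w)) = c * herm z w"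
    using complex_norm_square[of "herm z w"]
    by (cases "herm z w = 0") (auto simp: c_def sgn_eq field_simps power2_eq_square)
  then have "cmod (herm z w) = Re (herm (c *s z) w)"
    by (metis Re_complex_of_real herm_smult_left)
  also have "\<dots> \<le> norm (c *s z) * norm w"
    unfolding Re_herm by (rule norm_cauchy_schwarz)
  also have "\<dots> \<le> norm z * norm w"
    using c by (auto simp: norm_vector_smult intro!: mult_right_mono mult_left_le_one_le)
  finally show ?thesis .
qed

lemma holomorphic_on_herm:
  assumes "\<And>i. (\<lambda>\<zeta>. F \<zeta> $ i) holomorphic_on S"
  shows "(\<lambda>\<zeta>. herm (F \<zeta>) w) holomorphic_on S"
  unfolding herm_def by (intro holomorphic_intros assms)

text \<open>Harnack's inequality for maps into the right half-plane: the Cayley transform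
  \<open>G\<close> carries the half-plane to the disc and \<open>F 0\<close> to 0, and the Schwarz
  bound for \<open>G\<close> is solved for \<open>cmod (F \<zeta>)\<close>.\<close>

lemma cmod_le_of_Re_nonneg:
  assumes hol: "F holomorphic_on ball 0 1"
    and Re: "\<And>z. cmod z < 1 \<Longrightarrow> 0 < Re (F z)" and "cmod \<zeta> < 1"
  shows "cmod (F \<zeta>) \<le> cmod (F 0) * (1 + cmod \<zeta>) / (1 - cmod \<zeta>)"
proof -
  define G where "G = (\<lambda>z. (F z - F 0) / (F z + cnj (F 0)))"
  have ne: "F z + cnj (F 0) \<noteq> 0" if "cmod z < 1" for z
    using Re[OF that] Re[of 0] by (auto simp: complex_eq_iff)
  have "G holomorphic_on ball 0 1"
    unfolding G_def by (intro holomorphic_intros hol) (use ne in auto)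
  moreover have "G 0 = 0" by (simp add: G_def)
  moreover have "cmod (G z) < 1" if z: "cmod z < 1" for z
  proof -
    \<comment> \<open>The two sides differ by \<open>4 * Re (F z) * Re (F 0)\<close>.\<close>
    have "(cmod (F z - F 0))\<^sup>2 < (cmod (F z + cnj (F 0)))\<^sup>2"
      using mult_pos_pos[OF Re[OF z] Re[of 0]]
      unfolding cmod_power2 by (simp add: power2_eq_square algebra_simps)
    then have "cmod (F z - F 0) < cmod (F z + cnj (F 0))"
      by (simp add: power2_less_imp_less)
    then show ?thesis
      using ne[OF z] by (simp add: G_def norm_divide)
  qed
  ultimately have "cmod (G \<zeta>) \<le> cmod \<zeta>"
    using Schwarz_Lemma(1) assms(3) by blast
  then have "cmod (F \<zeta> - F 0) \<le> cmod \<zeta> * cmod (F \<zeta> + cnj (F 0))"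
    using ne[OF assms(3)] by (simp add: G_def norm_divide field_simps)
  also have "\<dots> \<le> cmod \<zeta> * (cmod (F \<zeta>) + cmod (F 0))"
    by (intro mult_left_mono norm_triangle_le) auto
  finally have "cmod (F \<zeta>) - cmod (F 0) \<le> cmod \<zeta> * (cmod (F \<zeta>) + cmod (F 0))"
    using norm_triangle_ineq2 order_trans by blast
  then show ?thesis
    using assms(3) by (simp add: field_simps)
qed

section \<open>Self-maps of the ball\<close>

text \<open>The scalar Schwarz lemma is applied to \<open>herm (F \<zeta>) e\<close>, with
  \<open>e\<close> the direction of the value, or of the derivative, whose norm is to be
  bounded.\<close>

lemma ball_map_schwarz:
  fixes F :: "complex \<Rightarrow> (complex, 'n::finite) vec"
  assumes hol: "\<And>i. (\<lambda>\<zeta>. F \<zeta> $ i) holomorphic_on ball 0 1"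
    and F0: "F 0 = 0" and F1: "\<And>\<zeta>. cmod \<zeta> < 1 \<Longrightarrow> norm (F \<zeta>) < 1"
  shows "cmod \<zeta> < 1 \<Longrightarrow> norm (F \<zeta>) \<le> cmod \<zeta>"
    and "norm (\<chi> i. deriv (\<lambda>\<zeta>. F \<zeta> $ i) 0) \<le> 1"
proof -
  have holh: "(\<lambda>\<zeta>. herm (F \<zeta>) e) holomorphic_on ball 0 1" for e
    by (rule holomorphic_on_herm[OF hol])
  have lt: "cmod (herm (F \<zeta>) e) < 1" if "norm e = 1" "cmod \<zeta> < 1" for e \<zeta>
    using cmod_herm_le[of "F \<zeta>" e] F1[of \<zeta>] that by simp
  have h0: "herm (F 0) e = 0" for e by (simp add: F0)
  show "norm (F \<zeta>) \<le> cmod \<zeta>" if z: "cmod \<zeta> < 1"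
  proof (cases "F \<zeta> = 0")
    case False
    define e where "e = complex_of_real (1 / norm (F \<zeta>)) *s F \<zeta>"
    have e: "norm e = 1" using False by (simp add: e_def norm_vector_smult norm_divide)
    have "herm (F \<zeta>) e = norm (F \<zeta>)"
      using False by (simp add: e_def herm_smult_right herm_self power2_eq_square)
    then show ?thesis
      using Schwarz_Lemma(1)[OF holh h0 lt[OF e] z] by simp
  qed simp
  define d where "d = (\<chi> i. deriv (\<lambda>\<zeta>. F \<zeta> $ i) 0)"
  have dd: "((\<lambda>\<zeta>. F \<zeta> $ i) has_field_derivative d $ i) (at 0)" for i
    using holomorphic_derivI[OF hol, of 0 i] by (simp add: d_def)
  have "((\<lambda>\<zeta>. herm (F \<zeta>) e) has_field_derivative herm d e) (at 0)" for e
    unfolding herm_def by (intro DERIV_sum DERIV_cmult_right dd)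
  then have der: "deriv (\<lambda>\<zeta>. herm (F \<zeta>) e) 0 = herm d e" for e
    by (rule DERIV_imp_deriv)
  show "norm (\<chi> i. deriv (\<lambda>\<zeta>. F \<zeta> $ i) 0) \<le> 1"
    unfolding d_def[symmetric]
  proof (cases "d = 0")
    case False
    define e where "e = complex_of_real (1 / norm d) *s d"
    have e: "norm e = 1" using False by (simp add: e_def norm_vector_smult norm_divide)
    have "herm d e = norm d"
      using False by (simp add: e_def herm_smult_right herm_self power2_eq_square)
    then show "norm d \<le> 1"
      using Schwarz_Lemma(2)[OF holh h0 lt[OF e], of 0] der[of e] by simp
  qed simp
qed

text \<open>A quantitative form of Cartan's uniqueness theorem: apply Harnack's inequality to
  \<open>1 - \<langle>F \<zeta>, u\<rangle> / \<zeta>\<close>.\<close>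

lemma ball_map_near_identity:
  fixes F :: "complex \<Rightarrow> (complex, 'n::finite) vec"
  assumes hol: "\<And>i. (\<lambda>\<zeta>. F \<zeta> $ i) holomorphic_on ball 0 1"
    and F0: "F 0 = 0" and F1: "\<And>\<zeta>. cmod \<zeta> < 1 \<Longrightarrow> norm (F \<zeta>) < 1"
    and u: "norm u = 1" and d: "norm ((\<chi> i. deriv (\<lambda>\<zeta>. F \<zeta> $ i) 0) - u) \<le> \<epsilon>"
    and z: "cmod \<zeta> < 1"
  shows "(norm (F \<zeta> - \<zeta> *s u))\<^sup>2 \<le> 2 * \<epsilon> * (1 + cmod \<zeta>) / (1 - cmod \<zeta>)"
proof -
  define \<phi> where "\<phi> = (\<lambda>\<zeta>. herm (F \<zeta>) u)"
  define d' where "d' = (\<chi> i. deriv (\<lambda>\<zeta>. F \<zeta> $ i) 0)"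
  have hol\<phi>: "\<phi> holomorphic_on ball 0 1"
    unfolding \<phi>_def by (rule holomorphic_on_herm[OF hol])
  have \<phi>0: "\<phi> 0 = 0" by (simp add: \<phi>_def F0)
  have \<phi>lt: "cmod (\<phi> \<zeta>) < 1" if "cmod \<zeta> < 1" for \<zeta>
    using cmod_herm_le[of "F \<zeta>" u] F1[of \<zeta>] that u by (simp add: \<phi>_def)
  obtain \<psi> where hol\<psi>: "\<psi> holomorphic_on ball 0 1"
    and \<psi>: "\<And>z. norm z < 1 \<Longrightarrow> \<phi> z = z * \<psi> z" and \<psi>0: "deriv \<phi> 0 = \<psi> 0"
    using Schwarz3[OF hol\<phi> \<phi>0] by auto
  have dd: "((\<lambda>\<zeta>. F \<zeta> $ i) has_field_derivative d' $ i) (at 0)" for i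
    using holomorphic_derivI[OF hol, of 0 i] by (simp add: d'_def)
  have "(\<phi> has_field_derivative herm d' u) (at 0)"
    unfolding herm_def \<phi>_def by (intro DERIV_sum DERIV_cmult_right dd)
  then have "\<psi> 0 = herm d' u" using \<psi>0 DERIV_imp_deriv by metis
  then have "1 - \<psi> 0 = herm (u - d') u"
    using u by (simp add: herm_diff_left herm_self)
  then have \<epsilon>: "cmod (1 - \<psi> 0) \<le> \<epsilon>"
    using cmod_herm_le[of "u - d'" u] d u by (simp add: d'_def norm_minus_commute)
  have \<psi>1: "cmod (\<psi> z) \<le> 1" if "cmod z < 1" for z
  proof (cases "z = 0")
    case True
    then show ?thesis using Schwarz_Lemma(2)[OF hol\<phi> \<phi>0 \<phi>lt, of 0] \<psi>0 by simp
  next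
    case False
    then show ?thesis
      using Schwarz_Lemma(1)[OF hol\<phi> \<phi>0 \<phi>lt that] \<psi>[OF that] by (simp add: norm_mult)
  qed
  have bound: "cmod (1 - \<psi> \<zeta>) \<le> \<epsilon> * (1 + cmod \<zeta>) / (1 - cmod \<zeta>)"
  proof -
    define C where "C = (1 + cmod \<zeta>) / (1 - cmod \<zeta>)"
    have C: "C > 0" using z by (simp add: C_def add_pos_nonneg)
    \<comment> \<open>\<open>1 - \<psi>\<close> has only nonnegative real part. The shift by \<tau>
      makes it positive, and \<tau> tends to 0 afterwards.\<close>
    have ineq: "cmod (1 - \<psi> \<zeta>) \<le> \<epsilon> * C + \<tau> * (1 + C)" if \<tau>: "\<tau> > 0" for \<tau>
    proof -
      let ?F = "\<lambda>z. 1 - \<psi> z + complex_of_real \<tau>"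
      have "?F holomorphic_on ball 0 1" by (intro holomorphic_intros hol\<psi>)
      moreover have "0 < Re (?F z)" if "cmod z < 1" for z
        using \<psi>1[OF that] complex_Re_le_cmod[of "\<psi> z"] \<tau> by simp
      ultimately have "cmod (?F \<zeta>) \<le> cmod (?F 0) * (1 + cmod \<zeta>) / (1 - cmod \<zeta>)"
        using cmod_le_of_Re_nonneg z by blast
      also have "\<dots> = cmod (?F 0) * C" by (simp add: C_def)
      also have "\<dots> \<le> (\<epsilon> + \<tau>) * C"
        using \<epsilon> \<tau> C norm_triangle_ineq[of "1 - \<psi> 0" "complex_of_real \<tau>"]
        by (intro mult_right_mono) auto
      finally have "cmod (?F \<zeta>) \<le> (\<epsilon> + \<tau>) * C" .
      moreover have "cmod (1 - \<psi> \<zeta>) \<le> cmod (?F \<zeta>) + \<tau>"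
        using norm_triangle_ineq4[of "?F \<zeta>" "complex_of_real \<tau>"] \<tau> by simp
      ultimately show ?thesis by (simp add: algebra_simps)
    qed
    have "cmod (1 - \<psi> \<zeta>) \<le> \<epsilon> * C + e" if "e > 0" for e
      using ineq[of "e / (1 + C)"] that C by simp
    then have "cmod (1 - \<psi> \<zeta>) \<le> \<epsilon> * C" by (rule field_le_epsilon)
    then show ?thesis by (simp add: C_def)
  qed
  have le: "norm (F \<zeta>) \<le> cmod \<zeta>" by (rule ball_map_schwarz(1)[OF hol F0 F1 z])
  have "F \<zeta> \<bullet> (\<zeta> *s u) = Re (cnj \<zeta> * \<phi> \<zeta>)"
    by (simp add: Re_herm[symmetric] herm_smult_right \<phi>_def)
  also have "cnj \<zeta> * \<phi> \<zeta> = complex_of_real ((cmod \<zeta>)\<^sup>2) * \<psi> \<zeta>"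
    using \<psi>[OF z] by (simp only: complex_norm_square mult_ac)
  finally have inn: "F \<zeta> \<bullet> (\<zeta> *s u) = (cmod \<zeta>)\<^sup>2 * Re (\<psi> \<zeta>)" by simp
  have *: "(norm (x - y))\<^sup>2 = (norm x)\<^sup>2 + (norm y)\<^sup>2 - 2 * (x \<bullet> y)"
    for x y :: "(complex, 'n) vec"
    by (simp add: power2_norm_eq_inner inner_diff_left inner_diff_right inner_commute)
  \<comment> \<open>\<psi> controls the component of \<open>F \<zeta>\<close> along \<open>u\<close>
    only. The orthogonal part is taken care of by
    \<open>norm (F \<zeta>) \<le> cmod \<zeta>\<close>.\<close>
  have "(norm (F \<zeta> - \<zeta> *s u))\<^sup>2 = (norm (F \<zeta>))\<^sup>2 + (cmod \<zeta>)\<^sup>2 - 2 * ((cmod \<zeta>)\<^sup>2 * Re (\<psi> \<zeta>))"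
    unfolding * inn using u by (simp add: norm_vector_smult)
  also have "\<dots> \<le> 2 * (cmod \<zeta>)\<^sup>2 * Re (1 - \<psi> \<zeta>)"
    using power_mono[OF le, of 2] by (simp add: algebra_simps)
  also have "\<dots> \<le> 2 * 1 * cmod (1 - \<psi> \<zeta>)"
  proof (rule mult_mono)
    show "2 * (cmod \<zeta>)\<^sup>2 \<le> 2 * 1" using z by (simp add: power_le_one)
    show "Re (1 - \<psi> \<zeta>) \<le> cmod (1 - \<psi> \<zeta>)" by (rule complex_Re_le_cmod)
    show "0 \<le> Re (1 - \<psi> \<zeta>)" using \<psi>1[OF z] complex_Re_le_cmod[of "\<psi> \<zeta>"] by simp
  qed simp
  finally show ?thesis using bound by simp
qed

subsection \<open>Automorphisms of the ball\<close>

lemma mv_holomorphic_on_const: "mv_holomorphic_on (\<lambda>z. k) S"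
  unfolding mv_holomorphic_on_iff by (auto intro!: exI[of _ "\<lambda>v. 0"])

lemma mv_holomorphic_on_component: "mv_holomorphic_on (\<lambda>z. z $ i) S"
  unfolding mv_holomorphic_on_iff
  by (auto intro!: exI[of _ "\<lambda>v. v $ i"] bounded_linear_imp_has_derivative bounded_linear_vec_nth)

lemma mv_holomorphic_on_add:
  assumes "mv_holomorphic_on f S" "mv_holomorphic_on g S"
  shows "mv_holomorphic_on (\<lambda>z. f z + g z) S"
  unfolding mv_holomorphic_on_iff
proof
  fix z assume "z \<in> S"
  then obtain D E where "(f has_derivative D) (at z)" "\<forall>c v. D (c *s v) = c * D v"
    "(g has_derivative E) (at z)" "\<forall>c v. E (c *s v) = c * E v"
    using assms unfolding mv_holomorphic_on_iff by blast
  then show "\<exists>D. ((\<lambda>z. f z + g z) has_derivative D) (at z) \<and> (\<forall>c v. D (c *s v) = c * D v)"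
    by (intro exI[of _ "\<lambda>v. D v + E v"]) (auto simp: algebra_simps)
qed

lemma mv_holomorphic_on_mult:
  assumes "mv_holomorphic_on f S" "mv_holomorphic_on g S"
  shows "mv_holomorphic_on (\<lambda>z. f z * g z) S"
  unfolding mv_holomorphic_on_iff
proof
  fix z assume "z \<in> S"
  then obtain D E where "(f has_derivative D) (at z)" "\<forall>c v. D (c *s v) = c * D v"
    "(g has_derivative E) (at z)" "\<forall>c v. E (c *s v) = c * E v"
    using assms unfolding mv_holomorphic_on_iff by blast
  then show "\<exists>D. ((\<lambda>z. f z * g z) has_derivative D) (at z) \<and> (\<forall>c v. D (c *s v) = c * D v)"
    by (intro exI[of _ "\<lambda>v. f z * E v + D v * g z"] conjI has_derivative_mult)
       (auto simp: algebra_simps)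
qed

lemma mv_holomorphic_on_diff:
  assumes "mv_holomorphic_on f S" "mv_holomorphic_on g S"
  shows "mv_holomorphic_on (\<lambda>z. f z - g z) S"
  using mv_holomorphic_on_add[OF assms(1) mv_holomorphic_on_mult[OF
    mv_holomorphic_on_const[of "-1"] assms(2)]] by simp

lemma mv_holomorphic_on_sum:
  assumes "\<And>i. i \<in> I \<Longrightarrow> mv_holomorphic_on (f i) S"
  shows "mv_holomorphic_on (\<lambda>z. \<Sum>i\<in>I. f i z) S"
  using assms
  by (induction I rule: infinite_finite_induct)
     (auto intro: mv_holomorphic_on_add mv_holomorphic_on_const)

lemma mv_holomorphic_on_inverse:
  assumes "mv_holomorphic_on f S" "\<And>z. z \<in> S \<Longrightarrow> f z \<noteq> 0"
  shows "mv_holomorphic_on (\<lambda>z. inverse (f z)) S"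
  unfolding mv_holomorphic_on_iff
proof
  fix z assume z: "z \<in> S"
  then obtain D where D: "(f has_derivative D) (at z)" "\<forall>c v. D (c *s v) = c * D v"
    using assms unfolding mv_holomorphic_on_iff by blast
  then show "\<exists>D. ((\<lambda>z. inverse (f z)) has_derivative D) (at z) \<and> (\<forall>c v. D (c *s v) = c * D v)"
    using assms(2)[OF z]
    by (intro exI[of _ "\<lambda>v. - (inverse (f z) * D v * inverse (f z))"] conjI Deriv.has_derivative_inverse)
       (auto simp: algebra_simps)
qed

lemma mv_holomorphic_on_herm: "mv_holomorphic_on (\<lambda>z. herm z w) S"
  unfolding herm_def
  by (intro mv_holomorphic_on_sum mv_holomorphic_on_mult mv_holomorphic_on_component
      mv_holomorphic_on_const)

section \<open>Moebius maps of the ball and transitivity\<close>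

lemma norm_orthogonal_smult:
  assumes "herm w e = 0" "norm e = 1"
  shows "(norm (a *s e + b *s w))\<^sup>2 = (cmod a)\<^sup>2 + (cmod b)\<^sup>2 * (norm w)\<^sup>2"
proof -
  have "(b *s w) \<bullet> (a *s e) = 0"
    by (simp add: Re_herm[symmetric] herm_smult_left herm_smult_right assms)
  then have "(norm (a *s e + b *s w))\<^sup>2 = (norm (a *s e))\<^sup>2 + (norm (b *s w))\<^sup>2"
    by (simp add: power2_norm_eq_inner inner_add_left inner_add_right inner_commute)
  then show ?thesis
    using assms(2) by (simp add: norm_vector_smult power_mult_distrib)
qed

text \<open>In an orthonormal basis starting with \<open>e\<close>, this is the automorphism
  \<open>(z\<^sub>1, z') \<mapsto> (z\<^sub>1 - t, (1 - t\<^sup>2)\<^sup>1\<^sup>/\<^sup>2 z') / (1 - t z\<^sub>1)\<close>.\<close>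

definition ball_moebius ::
    "(complex, 'n::finite) vec \<Rightarrow> real \<Rightarrow> (complex, 'n) vec \<Rightarrow> (complex, 'n) vec" where
  "ball_moebius e t z = ((herm z e - of_real t) * inverse (1 - of_real t * herm z e)) *s e
     + (of_real (sqrt (1 - t\<^sup>2)) * inverse (1 - of_real t * herm z e)) *s (z - herm z e *s e)"

context
  fixes e :: "(complex, 'n::finite) vec" and t :: real
  assumes e: "norm e = 1" and t: "\<bar>t\<bar> < 1"
begin

lemma moebius_denominator_nonzero:
  assumes "norm z < 1"
  shows "1 - complex_of_real t * herm z e \<noteq> 0"
proof
  assume "1 - complex_of_real t * herm z e = 0"
  then have "1 = \<bar>t\<bar> * cmod (herm z e)"
    by (metis eq_iff_diff_eq_0 norm_mult norm_of_real norm_one)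
  moreover have "\<bar>t\<bar> * cmod (herm z e) < 1 * 1"
    using cmod_herm_le[of z e] e t assms by (intro mult_strict_mono') auto
  ultimately show False by simp
qed

lemma herm_moebius_remainder: "herm (z - herm z e *s e) e = 0"
  using e by (simp add: herm_diff_left herm_smult_left herm_self)

lemma herm_ball_moebius:
  "herm (ball_moebius e t z) e = (herm z e - of_real t) * inverse (1 - of_real t * herm z e)"
  unfolding ball_moebius_def herm_add_left herm_smult_left herm_moebius_remainder
  using e by (simp add: herm_self)

lemma ball_moebius_in_ball:
  assumes "norm z < 1"
  shows "norm (ball_moebius e t z) < 1"
proof -
  define h w where "h = herm z e" and "w = z - h *s e"
  have w: "herm w e = 0" unfolding w_def h_def by (rule herm_moebius_remainder)
  have t2: "t\<^sup>2 < 1" using t by (simp add: abs_square_less_1)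
  have "z = h *s e + 1 *s w" by (simp add: w_def)
  then have "(norm z)\<^sup>2 = (cmod h)\<^sup>2 + (norm w)\<^sup>2"
    using norm_orthogonal_smult[OF w e, of h 1] by simp
  moreover have "(norm z)\<^sup>2 < 1" using assms by (simp add: abs_square_less_1)
  ultimately have "0 < (1 - t\<^sup>2) * (1 - (cmod h)\<^sup>2 - (norm w)\<^sup>2)"
    using t2 by simp
  \<comment> \<open>Divided by the squared denominator, this says for the image \<open>y\<close> of
    \<open>z\<close> that \<open>1 - (norm y)\<^sup>2 = (1 - t\<^sup>2) * (1 - (norm z)\<^sup>2) /
    (cmod (1 - t * h))\<^sup>2\<close>.\<close>
  moreover have "(cmod (1 - of_real t * h))\<^sup>2 - (cmod (h - of_real t))\<^sup>2 - (1 - t\<^sup>2) * (norm w)\<^sup>2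
      = (1 - t\<^sup>2) * (1 - (cmod h)\<^sup>2 - (norm w)\<^sup>2)"
    unfolding cmod_power2 by (simp add: power2_eq_square algebra_simps)
  ultimately have "(cmod (h - of_real t))\<^sup>2 + (1 - t\<^sup>2) * (norm w)\<^sup>2 < (cmod (1 - of_real t * h))\<^sup>2"
    by linarith
  moreover have "1 - complex_of_real t * h \<noteq> 0"
    unfolding h_def by (rule moebius_denominator_nonzero[OF assms])
  moreover have "(norm (ball_moebius e t z))\<^sup>2 =
      ((cmod (h - of_real t))\<^sup>2 + (1 - t\<^sup>2) * (norm w)\<^sup>2) / (cmod (1 - of_real t * h))\<^sup>2"
    unfolding ball_moebius_def h_def[symmetric] w_def[symmetric] norm_orthogonal_smult[OF w e]
    using t2 by (simp add: norm_mult norm_inverse power_mult_distrib divide_inverse power_inverse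
        distrib_left distrib_right mult_ac)
  ultimately have "(norm (ball_moebius e t z))\<^sup>2 < 1" by simp
  then show ?thesis by (simp add: abs_square_less_1)
qed

lemma hol_map_on_ball_moebius: "hol_map_on (ball_moebius e t) (ball 0 1)"
  unfolding hol_map_on_iff ball_moebius_def
    vector_add_component vector_minus_component vector_smult_component
  using moebius_denominator_nonzero
  by (intro allI mv_holomorphic_on_add mv_holomorphic_on_diff mv_holomorphic_on_mult
    mv_holomorphic_on_inverse mv_holomorphic_on_herm mv_holomorphic_on_const
    mv_holomorphic_on_component) auto

lemma ball_moebius_inverse:
  assumes "norm z < 1"
  shows "ball_moebius e (- t) (ball_moebius e t z) = z"
proof -
  define h w where "h = herm z e" and "w = z - h *s e"
  define d where "d = 1 - complex_of_real t * h"
  define s where "s = complex_of_real (sqrt (1 - t\<^sup>2))"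
  define y where "y = ball_moebius e t z"
  define h' where "h' = (h - of_real t) / d"
  have t2: "t\<^sup>2 < 1" using t by (simp add: abs_square_less_1)
  have d: "d \<noteq> 0"
    unfolding d_def h_def by (rule moebius_denominator_nonzero[OF assms])
  have ss: "s * s = 1 - (complex_of_real t)\<^sup>2" and tne: "1 - (complex_of_real t)\<^sup>2 \<noteq> 0"
  proof -
    have "s * s = complex_of_real (1 - t\<^sup>2)"
      using t2 by (simp add: s_def of_real_mult[symmetric] del: of_real_mult)
    then show "s * s = 1 - (complex_of_real t)\<^sup>2" by simp
    have "complex_of_real (1 - t\<^sup>2) \<noteq> 0" using t2 by (simp only: of_real_eq_0_iff)
    then show "1 - (complex_of_real t)\<^sup>2 \<noteq> 0" by simp
  qed
  have hy: "herm y e = h'"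
    unfolding y_def herm_ball_moebius h'_def h_def d_def by (simp add: divide_inverse)
  have y: "y - h' *s e = (s * inverse d) *s w"
    unfolding y_def ball_moebius_def h'_def w_def s_def d_def h_def by (simp add: divide_inverse)
  \<comment> \<open>Along \<open>e\<close> the two maps are mutually inverse disc automorphisms. On
    the orthogonal complement their factors multiply to \<open>s * s / (1 - t\<^sup>2)\<close>,
    which is 1.\<close>
  have den: "1 - complex_of_real (- t) * h' = (1 - (complex_of_real t)\<^sup>2) / d"
    using d by (simp add: h'_def field_simps power2_eq_square) (simp add: d_def algebra_simps)
  have num: "h' - complex_of_real (- t) = (1 - (complex_of_real t)\<^sup>2) * h / d"
    using d by (simp add: h'_def field_simps power2_eq_square) (simp add: d_def algebra_simps)
  have "(h' - complex_of_real (- t)) * inverse (1 - complex_of_real (- t) * h') = h"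
    unfolding den num using d tne by simp
  moreover have "s * inverse (1 - complex_of_real (- t) * h') * (s * inverse d)
      = s * s / (1 - (complex_of_real t)\<^sup>2)"
    unfolding den using d tne by (simp add: field_simps)
  moreover have "complex_of_real (sqrt (1 - (- t)\<^sup>2)) = s" by (simp add: s_def)
  ultimately have "ball_moebius e (- t) y = h *s e + (s * s / (1 - (complex_of_real t)\<^sup>2)) *s w"
    unfolding ball_moebius_def hy y vector_smult_assoc by (simp only:)
  then show ?thesis
    using tne by (simp add: ss y_def w_def)
qed

end

lemma ball_transitive:
  fixes a :: "(complex, 'n::finite) vec"
  assumes "norm a < 1"
  obtains \<psi> \<psi>' :: "(complex, 'n) vec \<Rightarrow> (complex, 'n) vec"
  where "hol_map_on \<psi> (ball 0 1)" "hol_map_on \<psi>' (ball 0 1)"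
    "\<And>z. z \<in> ball 0 1 \<Longrightarrow> \<psi> z \<in> ball 0 1" "\<And>z. z \<in> ball 0 1 \<Longrightarrow> \<psi>' z \<in> ball 0 1"
    "\<And>z. z \<in> ball 0 1 \<Longrightarrow> \<psi>' (\<psi> z) = z" "\<And>z. z \<in> ball 0 1 \<Longrightarrow> \<psi> (\<psi>' z) = z"
    "\<psi> a = 0" "\<psi>' 0 = a"
proof -
  define t where "t = norm a"
  obtain e :: "(complex, 'n) vec" where e: "norm e = 1" and a: "a = complex_of_real t *s e"
  proof (cases "a = 0")
    case True
    then show ?thesis
      using that[of "axis undefined 1"] by (simp add: t_def)
  next
    case False
    then show ?thesis
      using that[of "complex_of_real (1 / t) *s a"]
      by (simp add: t_def norm_vector_smult vector_smult_assoc norm_divide)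
  qed
  have t: "\<bar>t\<bar> < 1" "\<bar>- t\<bar> < 1" using assms by (auto simp: t_def)
  have "ball_moebius e t a = 0"
    unfolding ball_moebius_def a herm_smult_left using e by (simp add: herm_self)
  moreover from this have "ball_moebius e (- t) 0 = a"
    using ball_moebius_inverse[OF e t(1) assms] by simp
  ultimately show thesis
    using that[OF hol_map_on_ball_moebius[OF e t(1)] hol_map_on_ball_moebius[OF e t(2)]]
      ball_moebius_in_ball[OF e t(1)] ball_moebius_in_ball[OF e t(2)]
      ball_moebius_inverse[OF e t(1)] ball_moebius_inverse[OF e t(2)]
    by simp
qed

section \<open>Plurisubharmonic functions near their poles\<close>

lemma holomorphic_circle_has_integral:
  assumes "k holomorphic_on cball 0 1"
  shows "((\<lambda>\<theta>. k (cis \<theta>)) has_integral complex_of_real (2 * pi) * k 0) {0..2 * pi}"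
proof -
  have "((\<lambda>u. k u / (u - 0)) has_contour_integral (2 * of_real pi * \<i> * k 0)) (circlepath 0 1)"
    by (rule Cauchy_integral_circlepath_simple[OF assms]) simp
  then have "((\<lambda>t. k (cis t) * \<i>) has_integral 2 * of_real pi * \<i> * k 0) {0..2 * pi}"
    unfolding circlepath_def by (subst (asm) has_contour_integral_part_circlepath_iff) simp_all
  then have "((\<lambda>t. k (cis t) * \<i> * (- \<i>)) has_integral 2 * of_real pi * \<i> * k 0 * (- \<i>)) {0..2 * pi}"
    by (rule has_integral_mult_left)
  moreover have "2 * of_real pi * \<i> * k 0 * (- \<i>) = complex_of_real (2 * pi) * k 0"
    by (simp add: complex_eq_iff)
  moreover have "x * \<i> * (- \<i>) = x" for x by (simp add: complex_eq_iff)
  ultimately show ?thesis by (simp only:)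
qed

text \<open>The negative part of \<open>g\<close> may have infinite integral, so the means cannot
  simply be subtracted. Instead the positive and negative parts are compared crosswise,
  \<open>gp + Gn \<le> Gp + gn\<close>, which makes sense in \<open>ennreal\<close>. Since
  \<open>gp \<le> Gp\<close> has finite integral, an infinite integral of \<open>gn\<close> gives
  the mean -\<infinity>.\<close>

lemma circle_mean_le:
  fixes g :: "real \<Rightarrow> ereal" and G :: "real \<Rightarrow> real"
  assumes meas: "g \<in> borel_measurable borel"
    and le: "\<And>\<theta>. \<theta> \<in> {0..2 * pi} \<Longrightarrow> g \<theta> \<le> ereal (G \<theta>)"
    and cont: "continuous_on {0..2 * pi} G"
    and int: "(G has_integral 2 * pi * c) {0..2 * pi}"
  shows "circle_mean g \<le> ereal c"
proof -
  let ?I = "{0..2 * pi}"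
  define gp gn Gp Gn where
    "gp = (\<lambda>\<theta>. e2ennreal (g \<theta>) * indicator ?I \<theta>)" and
    "gn = (\<lambda>\<theta>. e2ennreal (- g \<theta>) * indicator ?I \<theta>)" and
    "Gp = (\<lambda>\<theta>. ennreal (indicator ?I \<theta> *\<^sub>R G \<theta>))" and
    "Gn = (\<lambda>\<theta>. ennreal (- (indicator ?I \<theta> *\<^sub>R G \<theta>)))"
  have sint: "set_integrable lborel ?I G"
    by (rule borel_integrable_atLeastAtMost'[OF cont])
  then have integrable: "integrable lborel (\<lambda>\<theta>. indicator ?I \<theta> *\<^sub>R G \<theta>)"
    by (simp add: set_integrable_def)
  have [measurable]: "g \<in> borel_measurable lborel" using meas by simp
  have [measurable]: "(\<lambda>\<theta>. indicator ?I \<theta> *\<^sub>R G \<theta>) \<in> borel_measurable lborel"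
    using integrable by simp
  have mgp [measurable]: "gp \<in> borel_measurable lborel" unfolding gp_def by measurable
  have mgn [measurable]: "gn \<in> borel_measurable lborel" unfolding gn_def by measurable
  have mGp [measurable]: "Gp \<in> borel_measurable lborel" unfolding Gp_def by measurable
  have mGn [measurable]: "Gn \<in> borel_measurable lborel" unfolding Gn_def by measurable
  have finP: "integral\<^sup>N lborel Gp < \<infinity>" and finN: "integral\<^sup>N lborel Gn < \<infinity>"
    using integrable integrable_minus[OF integrable]
    unfolding Gp_def Gn_def real_integrable_def by (auto simp: top.not_eq_extremum)
  have "2 * pi * c = integral\<^sup>L lborel (\<lambda>\<theta>. indicator ?I \<theta> *\<^sub>R G \<theta>)"
    using set_borel_integral_eq_integral(2)[OF sint] integral_unique[OF int]
    by (simp add: set_lebesgue_integral_def)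
  also have "\<dots> = enn2real (integral\<^sup>N lborel Gp) - enn2real (integral\<^sup>N lborel Gn)"
    unfolding Gp_def Gn_def by (rule real_lebesgue_integral_def[OF integrable])
  finally have PN: "enn2real (integral\<^sup>N lborel Gp) - enn2real (integral\<^sup>N lborel Gn) = 2 * pi * c"
    by simp
  have pointwise: "gp \<theta> + Gn \<theta> \<le> Gp \<theta> + gn \<theta>" "gp \<theta> \<le> Gp \<theta>" for \<theta>
  proof -
    consider "\<theta> \<notin> ?I" | "\<theta> \<in> ?I" "g \<theta> = -\<infinity>" | r where "\<theta> \<in> ?I" "g \<theta> = ereal r" "r \<le> G \<theta>"
      using le[of \<theta>] by (cases "g \<theta>") auto
    then have "gp \<theta> + Gn \<theta> \<le> Gp \<theta> + gn \<theta> \<and> gp \<theta> \<le> Gp \<theta>"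
    proof cases
      case 1
      then show ?thesis by (auto simp: gp_def gn_def Gp_def Gn_def)
    next
      case 2
      then show ?thesis by (auto simp: gp_def gn_def Gp_def Gn_def e2ennreal_neg e2ennreal_infty)
    next
      case 3
      have "ennreal r + ennreal (- G \<theta>) \<le> ennreal (G \<theta>) + ennreal (- r)"
        using 3(3) by (cases "0 \<le> r"; cases "0 \<le> G \<theta>") (auto simp: ennreal_neg ennreal_leI)
      moreover have "e2ennreal (g \<theta>) = ennreal r" "e2ennreal (- g \<theta>) = ennreal (- r)"
        using 3 by (simp_all add: e2ennreal_ereal)
      ultimately show ?thesis
        using 3 by (auto simp: gp_def gn_def Gp_def Gn_def ennreal_leI)
    qed
    then show "gp \<theta> + Gn \<theta> \<le> Gp \<theta> + gn \<theta>" "gp \<theta> \<le> Gp \<theta>" by auto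
  qed
  have "integral\<^sup>N lborel gp + integral\<^sup>N lborel Gn \<le> integral\<^sup>N lborel Gp + integral\<^sup>N lborel gn"
    using nn_integral_mono[of lborel "\<lambda>\<theta>. gp \<theta> + Gn \<theta>" "\<lambda>\<theta>. Gp \<theta> + gn \<theta>"] pointwise
    by (simp add: nn_integral_add)
  moreover have "integral\<^sup>N lborel gp \<le> integral\<^sup>N lborel Gp"
    by (intro nn_integral_mono pointwise)
  moreover obtain P N where P: "integral\<^sup>N lborel Gp = ennreal P" "0 \<le> P"
    and N: "integral\<^sup>N lborel Gn = ennreal N" "0 \<le> N"
    using finP finN by (metis ennreal_cases infinity_ennreal_def order_less_irrefl)
  ultimately have *: "integral\<^sup>N lborel gp + ennreal N \<le> ennreal P + integral\<^sup>N lborel gn"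
    and fin: "integral\<^sup>N lborel gp \<le> ennreal P" by auto
  obtain p where p: "integral\<^sup>N lborel gp = ennreal p" "0 \<le> p"
    using fin by (metis ennreal_cases ennreal_less_top infinity_ennreal_def neq_top_trans
        top.extremum_strict order_le_less_trans)
  have PN': "P - N = 2 * pi * c" using PN P N by simp
  have cm: "circle_mean g = ereal (1 / (2 * pi)) *
      (enn2ereal (integral\<^sup>N lborel gp) - enn2ereal (integral\<^sup>N lborel gn))"
    unfolding circle_mean_def gp_def gn_def by simp
  show ?thesis
  proof (cases "integral\<^sup>N lborel gn")
    case (real n)
    then have "p + N \<le> P + n"
      using * p N P by (simp add: ennreal_plus[symmetric] del: ennreal_plus)
    then have "(p - n) \<le> c * (2 * pi)" using PN' by (simp add: algebra_simps)
    then have "(p - n) / (2 * pi) \<le> c" by (simp add: field_simps)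
    then show ?thesis
      unfolding cm using real p by (simp add: enn2ereal_ennreal)
  next
    case top
    then show ?thesis
      unfolding cm using p by (simp add: enn2ereal_ennreal)
  qed
qed

lemma mv_psh_on_line_measurable:
  assumes "mv_psh_on u S" "{a + \<zeta> *s v |\<zeta>. cmod \<zeta> \<le> 1} \<subseteq> S"
  shows "(\<lambda>\<theta>. u (a + cis \<theta> *s v)) \<in> borel_measurable borel"
proof (rule borel_measurableI_less)
  fix c
  have "continuous_on UNIV (\<lambda>\<theta>. a + cis \<theta> *s v)"
    by (rule continuous_on_compose2[OF continuous_on_line[of UNIV] continuous_on_cis])
       (auto intro: continuous_intros)
  moreover have "open {z \<in> S. u z < c}" using assms(1) by (auto simp: mv_psh_on_def)
  ultimately have "open ((\<lambda>\<theta>. a + cis \<theta> *s v) -` {z \<in> S. u z < c})"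
    by (rule open_vimage[rotated])
  moreover have "(\<lambda>\<theta>. a + cis \<theta> *s v) -` {z \<in> S. u z < c} = {\<theta>. u (a + cis \<theta> *s v) < c}"
  proof -
    have "a + cis \<theta> *s v \<in> S" for \<theta> using assms(2) by (auto intro!: exI[of _ "cis \<theta>"])
    then show ?thesis by auto
  qed
  ultimately show "{x \<in> space borel. u (a + cis x *s v) < c} \<in> sets borel" by simp
qed

text \<open>Sub-mean value inequality for \<open>u\<close>, mean value property for
  \<open>Re k\<close>. This is the only form in which the sub-mean value inequality is used
  below.\<close>

lemma mv_psh_on_le_harmonic:
  assumes psh: "mv_psh_on u S" and disc: "{a + \<zeta> *s v |\<zeta>. cmod \<zeta> \<le> 1} \<subseteq> S"
    and k: "k holomorphic_on cball 0 1"
    and le: "\<And>\<zeta>. cmod \<zeta> = 1 \<Longrightarrow> u (a + \<zeta> *s v) \<le> ereal (Re (k \<zeta>))"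
  shows "u a \<le> ereal (Re (k 0))"
proof -
  have "u a \<le> circle_mean (\<lambda>\<theta>. u (a + cis \<theta> *s v))"
    using psh disc by (auto simp: mv_psh_on_def)
  also have "\<dots> \<le> ereal (Re (k 0))"
  proof (rule circle_mean_le)
    show "(\<lambda>\<theta>. u (a + cis \<theta> *s v)) \<in> borel_measurable borel"
      by (rule mv_psh_on_line_measurable[OF psh disc])
    show "u (a + cis \<theta> *s v) \<le> ereal (Re (k (cis \<theta>)))" for \<theta> by (rule le) simp
    have "continuous_on {0..2 * pi} (\<lambda>\<theta>. k (cis \<theta>))"
      by (rule continuous_on_compose2[OF holomorphic_on_imp_continuous_on[OF k] continuous_on_cis])
         (auto intro: continuous_intros)
    then show "continuous_on {0..2 * pi} (\<lambda>\<theta>. Re (k (cis \<theta>)))"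
      by (rule continuous_on_Re)
    show "((\<lambda>\<theta>. Re (k (cis \<theta>))) has_integral 2 * pi * Re (k 0)) {0..2 * pi}"
      using has_integral_Re[OF holomorphic_circle_has_integral[OF k]] by simp
  qed
  finally show ?thesis .
qed

section \<open>Upper semicontinuous functions\<close>

text \<open>If no maximum were attained, the sets \<open>{z \<in> K. V z < V y}\<close> would cover
  \<open>K\<close>. In a finite subcover the \<open>y\<close> with the largest value
  \<open>V y\<close> lies in none of the sets.\<close>

lemma usc_attains_sup:
  fixes V :: "'a::topological_space \<Rightarrow> 'b::linorder"
  assumes "compact K" "K \<noteq> {}" "\<And>c. openin (top_of_set K) {z \<in> K. V z < c}"
  obtains z where "z \<in> K" "\<And>y. y \<in> K \<Longrightarrow> V y \<le> V z"
proof (rule ccontr)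
  note wit = that
  assume "\<not> thesis"
  then have *: "\<exists>y\<in>K. V z < V y" if "z \<in> K" for z
    using wit[OF that] by (meson not_le_imp_less)
  let ?A = "\<lambda>y. {z \<in> K. V z < V y}"
  have "K \<subseteq> \<Union>(?A ` K)" using * by auto
  moreover have "\<forall>c\<in>?A ` K. openin (top_of_set K) c" using assms(3) by auto
  ultimately obtain D where "D \<subseteq> ?A ` K" "finite D" "K \<subseteq> \<Union>D"
    using assms(1)[unfolded compact_eq_openin_cover, THEN spec, THEN mp, of "?A ` K"] by auto
  moreover from this(1,2) obtain Y where "Y \<subseteq> K" "finite Y" "D = ?A ` Y"
    by (meson finite_subset_image)
  ultimately have Y: "Y \<subseteq> K" "finite Y" "K \<subseteq> \<Union>(?A ` Y)" by (auto simp only:)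
  have "Y \<noteq> {}" using Y(3) assms(2) by auto
  then have "Max (V ` Y) \<in> V ` Y" using Y(2) by simp
  then obtain y where y: "y \<in> Y" "V y = Max (V ` Y)" by auto
  then obtain y' where "y' \<in> Y" "V y < V y'" using Y by blast
  moreover from this(1) have "V y' \<le> Max (V ` Y)" using Y(2) by simp
  ultimately show False using y(2) by simp
qed

text \<open>\<open>b\<close> is allowed to be discontinuous at the poles of \<open>U\<close>. There
  an upper bound for \<open>b\<close> is enough, because the sum is -\<infinity> anyway.\<close>

lemma usc_add:
  fixes U :: "'a::metric_space \<Rightarrow> ereal"
  assumes usc: "\<And>c. openin (top_of_set K) {z \<in> K. U z < c}"
    and fin: "\<And>z. z \<in> K \<Longrightarrow> U z \<noteq> \<infinity>"
    and B: "\<And>z. z \<in> K \<Longrightarrow> b z \<le> B"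
    and cont: "\<And>z. z \<in> K \<Longrightarrow> U z \<noteq> -\<infinity> \<Longrightarrow> continuous (at z within K) b"
  shows "openin (top_of_set K) {z \<in> K. U z + ereal (b z) < c}"
  unfolding openin_euclidean_subtopology_iff
proof (intro conjI ballI)
  fix z assume "z \<in> {z \<in> K. U z + ereal (b z) < c}"
  then have z: "z \<in> K" "U z + ereal (b z) < c" by auto
  then obtain d where d: "U z + ereal (b z) < ereal d" "ereal d < c"
    using ereal_dense2 by blast
  have usc': "\<exists>e>0. \<forall>y\<in>K. dist y z < e \<longrightarrow> U y < t" if "U z < t" for t
    using usc[of t] z(1) that unfolding openin_euclidean_subtopology_iff by blast
  show "\<exists>e>0. \<forall>y\<in>K. dist y z < e \<longrightarrow> y \<in> {z \<in> K. U z + ereal (b z) < c}"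
  proof (cases "U z")
    \<comment> \<open>Near a pole \<open>U\<close> drops below \<open>d - B\<close>, which absorbs
      any value of \<open>b\<close>.\<close>
    case MInf
    then obtain e where e: "e > 0" "\<And>y. y \<in> K \<Longrightarrow> dist y z < e \<Longrightarrow> U y < ereal (d - B)"
      using usc'[of "ereal (d - B)"] by auto
    have "U y + ereal (b y) < c" if "y \<in> K" "dist y z < e" for y
    proof (cases "U y")
      case (real r)
      have "r + b y < d" using e(2)[OF that] B[OF that(1)] real by simp
      then show ?thesis using real d(2) order.strict_trans[of "ereal (r + b y)" "ereal d" c] by simp
    qed (use e(2)[OF that] d(2) in auto)
    then show ?thesis using e(1) by auto
  next
    case (real r)
    define \<delta> where "\<delta> = (d - r - b z) / 2"
    have \<delta>: "\<delta> > 0" using d(1) real by (simp add: \<delta>_def)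
    obtain e where e: "e > 0" "\<And>y. y \<in> K \<Longrightarrow> dist y z < e \<Longrightarrow> U y < ereal (r + \<delta>)"
      using usc'[of "ereal (r + \<delta>)"] real \<delta> by auto
    obtain e' where e': "e' > 0" "\<And>y. y \<in> K \<Longrightarrow> dist y z < e' \<Longrightarrow> dist (b y) (b z) < \<delta>"
      using cont[OF z(1)] real \<delta> unfolding continuous_within_eps_delta by auto
    have "U y + ereal (b y) < c" if y: "y \<in> K" "dist y z < min e e'" for y
    proof (cases "U y")
      case (real r')
      have "r' < r + \<delta>" using e(2)[of y] y real by simp
      moreover have "b y < b z + \<delta>" using e'(2)[of y] y by (simp add: dist_real_def abs_less_iff)
      ultimately have "r' + b y < d" by (simp add: \<delta>_def field_simps)
      then show ?thesis using real d(2) order.strict_trans[of "ereal (r' + b y)" "ereal d" c] by simp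
    qed (use e(2)[of y] y d(2) in auto)
    then show ?thesis using e(1) e'(1) by (auto intro!: exI[of _ "min e e'"])
  qed (use fin z in auto)
qed auto


section \<open>A maximum principle across the poles\<close>

text \<open>Convexity of the squared norm. The lower bound is the real part of a function
  holomorphic in \<open>x\<close> and touches at \<open>x0\<close>: such a minorant stands in for
  the subharmonicity of the squared norm of a holomorphic map.\<close>

lemma norm_sq_ge_tangent: "(norm x)\<^sup>2 \<ge> (norm x0)\<^sup>2 + 2 * Re (herm (x - x0) x0)"
  for x :: "(complex, 'm::finite) vec"
proof -
  have "(norm (x - x0))\<^sup>2 \<ge> 0" by simp
  then show ?thesis
    unfolding Re_herm
    by (simp add: power2_norm_eq_inner inner_diff_left inner_diff_right inner_commute)
qed

lemma cmod_sq_ge_tangent: "(cmod x)\<^sup>2 \<ge> (cmod x0)\<^sup>2 + 2 * Re (cnj x0 * (x - x0))"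
  using zero_le_power2[of "cmod (x - x0)"] unfolding cmod_power2
  by (simp add: power2_eq_square algebra_simps)

text \<open>A form of the three circles theorem.  The terms \<open>\<bar>\<zeta>\<bar>\<^sup>2\<close> and \<open>\<epsilon> u\<close> added to
  \<open>\<bar>g\<bar>\<^sup>2 + \<eta> / \<bar>\<zeta>\<bar>\<^sup>2\<close> force its maximum over the annulus to be attained on the boundary
  and away from the poles of \<open>u\<close>.\<close>

lemma psh_three_circles:
  fixes g :: "(complex, 'n::finite) vec \<Rightarrow> (complex, 'm::finite) vec"
  assumes psh: "mv_psh_on u S" and T: "T = {x \<in> S. u x \<noteq> -\<infinity>}" "open T"
    and cont: "continuous_on T g"
    and hol: "\<And>x v i. (\<lambda>\<zeta>. g (x + \<zeta> *s v) $ i) holomorphic_on {\<zeta>. x + \<zeta> *s v \<in> T}"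
    and g1: "\<And>x. x \<in> T \<Longrightarrow> norm (g x) < 1"
    and disc: "\<And>\<zeta>. cmod \<zeta> \<le> R \<Longrightarrow> y + \<zeta> *s w \<in> S"
    and \<rho>: "0 < \<rho>" "\<rho> < 1" and R: "1 < R" and c: "c < 1"
    and inner: "\<And>\<zeta>. cmod \<zeta> = \<rho> \<Longrightarrow> y + \<zeta> *s w \<in> T \<Longrightarrow> (norm (g (y + \<zeta> *s w)))\<^sup>2 \<le> c"
    and yw: "y + w \<in> T"
  shows "(norm (g (y + w)))\<^sup>2 + (1 - c) * \<rho>\<^sup>2 \<le> 1 + (1 - c) * \<rho>\<^sup>2 / R\<^sup>2"
proof -
  define f where "f = (\<lambda>\<zeta>. y + \<zeta> *s w)"
  \<comment> \<open>With this value \<open>c + \<eta> / \<rho>\<^sup>2 = 1\<close>. So the squared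
    norm of \<open>g\<close> plus \<open>\<eta> / (cmod \<zeta>)\<^sup>2\<close> is at most 1 on the
    inner circle and at most \<open>m = 1 + \<eta> / R\<^sup>2\<close> on the outer one.\<close>
  define \<eta> where "\<eta> = (1 - c) * \<rho>\<^sup>2"
  define m where "m = 1 + \<eta> / R\<^sup>2"
  define K where "K = {\<zeta>. \<rho> \<le> cmod \<zeta> \<and> cmod \<zeta> \<le> R}"
  have \<eta>: "\<eta> > 0" using \<rho> c by (simp add: \<eta>_def)
  have contf: "continuous_on A f" for A unfolding f_def by (rule continuous_on_line)
  have fS: "f \<zeta> \<in> S" if "\<zeta> \<in> K" for \<zeta> using disc that by (auto simp: f_def K_def)
  have "K = cball 0 R - ball 0 \<rho>" by (auto simp: K_def)
  then have K: "compact K" by (simp add: compact_diff)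
  have K1: "1 \<in> K" using \<rho> R by (simp add: K_def)
  have uinf: "u x \<noteq> \<infinity>" if "x \<in> S" for x using psh that by (auto simp: mv_psh_on_def)
  have usc: "openin (top_of_set K) {\<zeta> \<in> K. u (f \<zeta>) < t}" for t
  proof -
    have "open {z \<in> S. u z < t}" using psh by (auto simp: mv_psh_on_def)
    then have "openin (top_of_set K) (K \<inter> f -` {z \<in> S. u z < t})"
      by (rule continuous_openin_preimage_gen[OF contf])
    moreover have "K \<inter> f -` {z \<in> S. u z < t} = {\<zeta> \<in> K. u (f \<zeta>) < t}" using fS by auto
    ultimately show ?thesis by simp
  qed
  obtain \<zeta>m where "\<zeta>m \<in> K" "\<And>\<zeta>. \<zeta> \<in> K \<Longrightarrow> u (f \<zeta>) \<le> u (f \<zeta>m)"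
    using usc_attains_sup[OF K _ usc] K1 by blast
  then obtain Ub where Ub: "\<And>\<zeta>. \<zeta> \<in> K \<Longrightarrow> u (f \<zeta>) \<le> ereal Ub"
    using uinf[OF fS] by (metis ereal_infty_less_eq(1) ereal_less_eq(2) order_trans real_of_ereal.elims)
  have f1: "f 1 \<in> T" using yw by (simp add: f_def)
  then obtain u1 where u1: "u (f 1) = ereal u1"
    using T uinf by (cases "u (f 1)") auto
  have ineq: "(norm (g (f 1)))\<^sup>2 + \<eta> \<le> m + \<epsilon> * (Ub + R\<^sup>2 - 1 - u1)" if \<epsilon>: "\<epsilon> > 0" for \<epsilon>
  proof -
    \<comment> \<open>Dividing the other terms by \<epsilon> amounts to weighting \<open>u\<close>
      by \<epsilon>, but keeps \<open>u\<close> itself as the summand to which plurisubharmonicity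
      applies. The pole term is the squared modulus of the holomorphic function
      \<open>1 / \<zeta>\<close>, so that it too has a tangent minorant.\<close>
    define b where "b = (\<lambda>\<zeta>. ((norm (g (f \<zeta>)))\<^sup>2 + \<eta> * (cmod (1 / \<zeta>))\<^sup>2) / \<epsilon> + (cmod \<zeta>)\<^sup>2)"
    obtain B where B: "b \<zeta> \<le> B" if "\<zeta> \<in> K" "f \<zeta> \<in> T" for \<zeta>
    proof
      fix \<zeta> assume \<zeta>: "\<zeta> \<in> K" "f \<zeta> \<in> T"
      have "(norm (g (f \<zeta>)))\<^sup>2 \<le> 1" using g1[OF \<zeta>(2)] by (simp add: power_le_one)
      moreover have "(cmod (1 / \<zeta>))\<^sup>2 \<le> (1 / \<rho>)\<^sup>2"
        using \<zeta>(1) \<rho> by (intro power_mono) (auto simp: K_def norm_divide frac_le)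
      moreover have "(cmod \<zeta>)\<^sup>2 \<le> R\<^sup>2" using \<zeta>(1) by (intro power_mono) (auto simp: K_def)
      ultimately show "b \<zeta> \<le> (1 + \<eta> * (1 / \<rho>)\<^sup>2) / \<epsilon> + R\<^sup>2"
        unfolding b_def using \<eta> \<epsilon> by (intro add_mono divide_right_mono mult_left_mono) auto
    qed
    \<comment> \<open>Off \<open>T\<close> nothing is known of \<open>g\<close>. There
      \<open>u\<close> is -\<infinity>, so any value admissible for \<open>usc_add\<close> will do,
      such as the upper bound \<open>B\<close>.\<close>
    define b' where "b' = (\<lambda>\<zeta>. if f \<zeta> \<in> T then b \<zeta> else B)"
    define V where "V = (\<lambda>\<zeta>. u (f \<zeta>) + ereal (b' \<zeta>))"
    have openfT: "open {\<zeta>. f \<zeta> \<in> T}" unfolding f_def by (rule open_line_preimage[OF T(2)])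
    have contb: "continuous (at \<zeta> within K) b'" if "\<zeta> \<in> K" "u (f \<zeta>) \<noteq> -\<infinity>" for \<zeta>
    proof -
      have \<zeta>: "f \<zeta> \<in> T" using that fS T(1) by simp
      have "continuous_on ({\<zeta>. f \<zeta> \<in> T} - {0}) b"
        unfolding b_def
        by (intro continuous_intros continuous_on_compose2[OF cont contf]) (use \<epsilon> in auto)
      moreover have "open ({\<zeta>. f \<zeta> \<in> T} - {0})" using openfT by (simp add: open_delete)
      moreover have "\<zeta> \<in> {\<zeta>. f \<zeta> \<in> T} - {0}" using \<zeta> that(1) \<rho> by (auto simp: K_def)
      ultimately have "isCont b \<zeta>" by (simp add: continuous_on_eq_continuous_at)
      moreover have "eventually (\<lambda>\<zeta>. b \<zeta> = b' \<zeta>) (nhds \<zeta>)"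
        by (rule eventually_mono[OF eventually_nhds_in_open[OF openfT]])
           (use \<zeta> in \<open>auto simp: b'_def\<close>)
      ultimately have "isCont b' \<zeta>" by (simp add: isCont_cong)
      then show ?thesis by (rule continuous_at_imp_continuous_at_within)
    qed
    have "openin (top_of_set K) {\<zeta> \<in> K. V \<zeta> < t}" for t
      unfolding V_def
      by (rule usc_add[of K "\<lambda>\<zeta>. u (f \<zeta>)" b' B, OF usc _ _ contb]) (use uinf fS B in \<open>auto simp: b'_def\<close>)
    then obtain \<zeta>0 where \<zeta>0: "\<zeta>0 \<in> K" and max: "\<And>\<zeta>. \<zeta> \<in> K \<Longrightarrow> V \<zeta> \<le> V \<zeta>0"
      using usc_attains_sup[OF K, of V] K1 by blast
    have V1: "V 1 = ereal (u1 + b 1)" using f1 u1 by (simp add: V_def b'_def)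
    then have "u (f \<zeta>0) \<noteq> -\<infinity>" using max[OF K1] by (auto simp: V_def)
    then obtain u0 where u0: "u (f \<zeta>0) = ereal u0" and f0: "f \<zeta>0 \<in> T"
      using T(1) fS[OF \<zeta>0] uinf by (cases "u (f \<zeta>0)") auto
    have V0: "V \<zeta>0 = ereal (u0 + b \<zeta>0)" using f0 u0 by (simp add: V_def b'_def)
    have \<zeta>0ne: "\<zeta>0 \<noteq> 0" using \<zeta>0 \<rho> by (auto simp: K_def)
    have "cmod \<zeta>0 = \<rho> \<or> cmod \<zeta>0 = R"
    proof (rule ccontr)
      assume "\<not> ?thesis"
      then have "\<zeta>0 \<in> (ball 0 R - cball 0 \<rho>) \<inter> {\<zeta>. f \<zeta> \<in> T}" using \<zeta>0 f0 by (auto simp: K_def)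
      moreover have "open ((ball 0 R - cball 0 \<rho>) \<inter> {\<zeta>. f \<zeta> \<in> T})"
        using openfT by (intro open_Int open_Diff) auto
      ultimately obtain r where r: "r > 0"
        "cball \<zeta>0 r \<subseteq> (ball 0 R - cball 0 \<rho>) \<inter> {\<zeta>. f \<zeta> \<in> T}"
        unfolding open_contains_cball by blast
      define l where "l = (\<lambda>\<xi>. \<zeta>0 + of_real r * \<xi>)"
      have l: "l \<xi> \<in> cball \<zeta>0 r" if "cmod \<xi> \<le> 1" for \<xi>
        using that r(1) by (simp add: l_def dist_norm norm_mult)
      have lK: "l \<xi> \<in> K" "f (l \<xi>) \<in> T" "l \<xi> \<noteq> 0" if "cmod \<xi> \<le> 1" for \<xi>
        using r(2) l[OF that] \<rho> by (auto simp: K_def subset_iff)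
      have fl: "f (l \<xi>) = f \<zeta>0 + \<xi> *s (of_real r *s w)" for \<xi>
        by (simp add: f_def l_def vec_eq_iff algebra_simps)
      \<comment> \<open>\<open>Re (k \<xi>)\<close> is the linear part of the tangent minorant of
        \<open>b\<close> at \<open>\<zeta>0\<close>. The term \<open>(cmod \<zeta>)\<^sup>2\<close>
        expands exactly and contributes a further \<open>r\<^sup>2\<close> on the circle. Maximality
        of \<open>V \<zeta>0\<close> then gives \<open>u \<le> u0 - r\<^sup>2 - Re (k \<xi>)\<close>
        on the circle, hence \<open>u0 \<le> u0 - r\<^sup>2\<close> at the centre.\<close>
      define k where "k = (\<lambda>\<xi>. of_real (2 / \<epsilon>) * (herm (g (f (l \<xi>)) - g (f \<zeta>0)) (g (f \<zeta>0))
          + of_real \<eta> * (cnj (1 / \<zeta>0) * (1 / l \<xi> - 1 / \<zeta>0))) + 2 * (cnj \<zeta>0 * (l \<xi> - \<zeta>0)))"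
      have "(\<lambda>\<xi>. g (f (l \<xi>)) $ i) holomorphic_on cball 0 1" for i
        unfolding fl by (rule holomorphic_on_subset[OF hol]) (use lK(2) fl in auto)
      then have holk: "k holomorphic_on cball 0 1"
        unfolding k_def herm_diff_left l_def
        by (intro holomorphic_intros holomorphic_on_herm) (use lK(3) in \<open>auto simp: l_def\<close>)
      have k0: "k 0 = 0" by (simp add: k_def l_def)
      have "u (f \<zeta>0) \<le> ereal (Re (of_real (u0 - r\<^sup>2) - k 0))"
      proof (rule mv_psh_on_le_harmonic[OF psh])
        show "{f \<zeta>0 + \<xi> *s (of_real r *s w) |\<xi>. cmod \<xi> \<le> 1} \<subseteq> S"
          using fS[OF lK(1)] fl by auto
        show "(\<lambda>\<xi>. of_real (u0 - r\<^sup>2) - k \<xi>) holomorphic_on cball 0 1"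
          by (intro holomorphic_intros holk)
        fix \<xi> :: complex assume \<xi>: "cmod \<xi> = 1"
        then have \<xi>1: "cmod \<xi> \<le> 1" by simp
        define \<zeta> where "\<zeta> = l \<xi>"
        have \<zeta>: "\<zeta> \<in> K" "f \<zeta> \<in> T" using lK[OF \<xi>1] by (auto simp: \<zeta>_def)
        have "u (f \<zeta>) + ereal (b \<zeta>) \<le> ereal (u0 + b \<zeta>0)"
          using max[OF \<zeta>(1)] \<zeta>(2) unfolding V0 by (simp add: V_def b'_def)
        then have *: "u (f \<zeta>) \<le> ereal (u0 + b \<zeta>0 - b \<zeta>)"
          by (cases "u (f \<zeta>)") auto
        let ?P = "Re (herm (g (f \<zeta>) - g (f \<zeta>0)) (g (f \<zeta>0)))"
        let ?Q = "Re (cnj (1 / \<zeta>0) * (1 / \<zeta> - 1 / \<zeta>0))"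
        let ?Z = "Re (cnj \<zeta>0 * (\<zeta> - \<zeta>0))"
        have "r = cmod (\<zeta> - \<zeta>0)" using \<xi> r(1) by (simp add: \<zeta>_def l_def norm_mult)
        then have r2: "r\<^sup>2 = (cmod (\<zeta> - \<zeta>0))\<^sup>2" by simp
        have z2: "(cmod \<zeta>)\<^sup>2 = (cmod \<zeta>0)\<^sup>2 + 2 * ?Z + r\<^sup>2"
          unfolding r2 cmod_power2 by (simp add: power2_eq_square algebra_simps)
        have gg: "(norm (g (f \<zeta>0)))\<^sup>2 + 2 * ?P \<le> (norm (g (f \<zeta>)))\<^sup>2" by (rule norm_sq_ge_tangent)
        have "\<eta> * ((cmod (1 / \<zeta>0))\<^sup>2 + 2 * ?Q) \<le> \<eta> * (cmod (1 / \<zeta>))\<^sup>2"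
          using \<eta> by (intro mult_left_mono cmod_sq_ge_tangent) simp
        then have "((norm (g (f \<zeta>0)))\<^sup>2 + \<eta> * (cmod (1 / \<zeta>0))\<^sup>2 + 2 * (?P + \<eta> * ?Q)) / \<epsilon>
            \<le> ((norm (g (f \<zeta>)))\<^sup>2 + \<eta> * (cmod (1 / \<zeta>))\<^sup>2) / \<epsilon>"
          using gg \<epsilon> by (intro divide_right_mono) (auto simp: algebra_simps)
        then have "b \<zeta>0 + (2 / \<epsilon> * (?P + \<eta> * ?Q) + 2 * ?Z) + r\<^sup>2 \<le> b \<zeta>"
          unfolding b_def z2 by (simp add: add_divide_distrib)
        moreover have "Re (k \<xi>) = 2 / \<epsilon> * (?P + \<eta> * ?Q) + 2 * ?Z"
        proof -
          have "Re (of_real x * z) = x * Re z" "Re (2 * z) = 2 * Re z" for x z by simp_all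
          then show ?thesis unfolding k_def \<zeta>_def[symmetric] by (simp only: plus_complex.sel)
        qed
        ultimately have "u0 + b \<zeta>0 - b \<zeta> \<le> Re (of_real (u0 - r\<^sup>2) - k \<xi>)" by simp
        then show "u (f \<zeta>0 + \<xi> *s (of_real r *s w)) \<le> ereal (Re (of_real (u0 - r\<^sup>2) - k \<xi>))"
          using * unfolding fl[symmetric] \<zeta>_def by (meson ereal_less_eq(3) order_trans)
      qed
      then show False using r(1) by (simp add: u0 k0)
    qed
    then have bd: "(norm (g (f \<zeta>0)))\<^sup>2 + \<eta> * (cmod (1 / \<zeta>0))\<^sup>2 \<le> m"
    proof
      assume \<zeta>: "cmod \<zeta>0 = \<rho>"
      then have "(norm (g (f \<zeta>0)))\<^sup>2 \<le> c" using inner f0 by (simp add: f_def)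
      moreover have "\<eta> * (cmod (1 / \<zeta>0))\<^sup>2 = 1 - c"
        using \<zeta> \<rho> by (simp add: \<eta>_def norm_divide power_divide)
      moreover have "\<eta> / R\<^sup>2 \<ge> 0" using \<eta> by simp
      ultimately show ?thesis by (simp add: m_def)
    next
      assume \<zeta>: "cmod \<zeta>0 = R"
      have "(norm (g (f \<zeta>0)))\<^sup>2 \<le> 1" using g1[OF f0] by (simp add: power_le_one)
      then show ?thesis using \<zeta> by (simp add: m_def norm_divide power_divide)
    qed
    have "u0 \<le> Ub" using Ub[OF \<zeta>0] u0 by simp
    moreover have "(cmod \<zeta>0)\<^sup>2 \<le> R\<^sup>2" using \<zeta>0 by (intro power_mono) (auto simp: K_def)
    moreover have "((norm (g (f \<zeta>0)))\<^sup>2 + \<eta> * (cmod (1 / \<zeta>0))\<^sup>2) / \<epsilon> \<le> m / \<epsilon>"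
      using bd \<epsilon> by (intro divide_right_mono) auto
    moreover have "u1 + b 1 \<le> u0 + b \<zeta>0" using max[OF K1] unfolding V0 V1 by simp
    ultimately have "u1 + (((norm (g (f 1)))\<^sup>2 + \<eta>) / \<epsilon> + 1) \<le> Ub + (m / \<epsilon> + R\<^sup>2)"
      unfolding b_def by simp
    then have "((norm (g (f 1)))\<^sup>2 + \<eta>) / \<epsilon> \<le> m / \<epsilon> + (Ub + R\<^sup>2 - 1 - u1)" by simp
    then have "\<epsilon> * (((norm (g (f 1)))\<^sup>2 + \<eta>) / \<epsilon>) \<le> \<epsilon> * (m / \<epsilon> + (Ub + R\<^sup>2 - 1 - u1))"
      using \<epsilon> by (intro mult_left_mono) auto
    then show ?thesis using \<epsilon> by (simp add: distrib_left[of _ "m / \<epsilon>"])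
  qed
  \<comment> \<open>Now \<epsilon> tends to 0. Its coefficient is a fixed real number because
    \<open>f 1\<close> is not a pole, so that \<open>u1\<close> is finite.\<close>
  have "(norm (g (f 1)))\<^sup>2 + \<eta> \<le> m"
  proof (rule field_le_epsilon)
    fix \<delta> :: real assume \<delta>: "\<delta> > 0"
    define C where "C = \<bar>Ub + R\<^sup>2 - 1 - u1\<bar> + 1"
    have C: "C > 0" by (simp add: C_def)
    have "(norm (g (f 1)))\<^sup>2 + \<eta> \<le> m + (\<delta> / C) * (Ub + R\<^sup>2 - 1 - u1)"
      using ineq[of "\<delta> / C"] \<delta> C by simp
    also have "\<dots> \<le> m + (\<delta> / C) * C"
      using \<delta> C by (intro add_left_mono mult_left_mono) (auto simp: C_def)
    finally show "(norm (g (f 1)))\<^sup>2 + \<eta> \<le> m + \<delta>" using C by simp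
  qed
  then show ?thesis by (simp add: m_def \<eta>_def f_def)
qed

text \<open>Fix a point \<open>y\<close> of \<open>T\<close> near \<open>a\<close> and a closed ball
  about it inside \<open>T\<close>, where \<open>norm g\<close> stays below 1 by compactness. Any
  \<open>x\<close> near \<open>a\<close> lies on a disc centred at \<open>y\<close>, and the three
  circles estimate carries the gain from the small ball to \<open>x\<close>, uniformly in
  \<open>x\<close>.\<close>

lemma psh_pole_bound:
  fixes g :: "(complex, 'n::finite) vec \<Rightarrow> (complex, 'm::finite) vec"
  assumes S: "open S" and psh: "mv_psh_on u S" and T: "T = {x \<in> S. u x \<noteq> -\<infinity>}" "open T"
    and a: "a \<in> S" "a \<in> closure T"
    and cont: "continuous_on T g"
    and hol: "\<And>x v i. (\<lambda>\<zeta>. g (x + \<zeta> *s v) $ i) holomorphic_on {\<zeta>. x + \<zeta> *s v \<in> T}"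
    and g1: "\<And>x. x \<in> T \<Longrightarrow> norm (g x) < 1"
  obtains c e where "c < 1" "e > 0" "\<And>x. x \<in> T \<Longrightarrow> dist x a < e \<Longrightarrow> (norm (g x))\<^sup>2 \<le> c"
proof -
  \<comment> \<open>Below, \<open>norm w < 2 * R0\<close>. The disc is enlarged by the factor 3/2
    and its centre is within \<open>R0\<close> of \<open>a\<close>, so it stays within
    \<open>4 * R0\<close> of \<open>a\<close>.\<close>
  obtain R0 where R0: "R0 > 0" "ball a (4 * R0) \<subseteq> S"
  proof -
    obtain e where "e > 0" "ball a e \<subseteq> S" using S a(1) unfolding open_contains_ball by blast
    then show thesis using that[of "e / 4"] by simp
  qed
  obtain y where y: "y \<in> T" "dist y a < R0"
    using a(2) R0(1) unfolding closure_approachable by blast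
  obtain \<rho>0 where \<rho>0: "\<rho>0 > 0" "cball y \<rho>0 \<subseteq> T"
    using T(2) y(1) unfolding open_contains_cball by blast
  have "\<exists>z\<in>cball y \<rho>0. \<forall>x\<in>cball y \<rho>0. norm (g x) \<le> norm (g z)"
    using \<rho>0 by (intro continuous_attains_sup continuous_intros continuous_on_subset[OF cont]) auto
  then obtain z where z: "z \<in> cball y \<rho>0" "\<And>x. x \<in> cball y \<rho>0 \<Longrightarrow> norm (g x) \<le> norm (g z)"
    by blast
  define c where "c = (norm (g z))\<^sup>2"
  have c: "c < 1" using g1[of z] z(1) \<rho>0(2) by (auto simp: c_def abs_square_less_1)
  \<comment> \<open>Together with \<open>norm w < 2 * R0\<close>, the second entry puts the inner
    circle into the ball of radius \<open>\<rho>0\<close>. The first keeps \<rho> below 1.\<close>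
  define \<rho> where "\<rho> = min (1/2) (\<rho>0 / (2 * R0))"
  have \<rho>: "0 < \<rho>" "\<rho> < 1" using \<rho>0 R0 by (auto simp: \<rho>_def)
  \<comment> \<open>The factor 5/9 is \<open>1 - 1 / R\<^sup>2\<close> for the outer radius
    \<open>R = 3/2\<close>.\<close>
  have bound: "(norm (g x))\<^sup>2 \<le> 1 - (1 - c) * \<rho>\<^sup>2 * (5 / 9)" if x: "x \<in> T" "dist x a < R0" for x
  proof -
    define w where "w = x - y"
    have w: "norm w < 2 * R0"
      using x(2) y(2) dist_triangle2[of x y a] by (simp add: w_def dist_norm)
    have "(norm (g (y + w)))\<^sup>2 + (1 - c) * \<rho>\<^sup>2 \<le> 1 + (1 - c) * \<rho>\<^sup>2 / (3/2)\<^sup>2"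
    proof (rule psh_three_circles[OF psh T cont hol g1])
      show "y + \<zeta> *s w \<in> S" if "cmod \<zeta> \<le> 3/2" for \<zeta>
      proof -
        have "norm (\<zeta> *s w) \<le> 3/2 * norm w"
          unfolding norm_vector_smult using that by (intro mult_right_mono) auto
        then have "dist (y + \<zeta> *s w) a < 4 * R0"
          using w y(2) norm_triangle_ineq[of "y - a" "\<zeta> *s w"] by (simp add: dist_norm algebra_simps)
        then show ?thesis using R0(2) by (auto simp: dist_commute)
      qed
      show "(norm (g (y + \<zeta> *s w)))\<^sup>2 \<le> c" if "cmod \<zeta> = \<rho>" for \<zeta>
      proof -
        have "norm (\<zeta> *s w) \<le> \<rho>0 / (2 * R0) * (2 * R0)"
          unfolding norm_vector_smult using that w \<rho>0 R0 by (intro mult_mono) (auto simp: \<rho>_def)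
        then have "y + \<zeta> *s w \<in> cball y \<rho>0" using R0 by (simp add: dist_norm)
        then show ?thesis unfolding c_def by (intro power_mono z) auto
      qed
      show "y + w \<in> T" using x by (simp add: w_def)
    qed (use \<rho> c in auto)
    then show ?thesis by (simp add: w_def power2_eq_square)
  qed
  have "1 - (1 - c) * \<rho>\<^sup>2 * (5 / 9) < 1" using c \<rho> by simp
  then show thesis using that[OF _ R0(1) bound] by blast
qed

section \<open>Increasing sequences of balls\<close>

lemma hol_map_on_ball_schwarz:
  fixes T :: "(complex, 'n::finite) vec \<Rightarrow> (complex, 'm::finite) vec"
  assumes hol: "hol_map_on T (ball 0 1)" and T0: "T 0 = 0"
    and T1: "\<And>z. norm z < 1 \<Longrightarrow> norm (T z) < 1"
  shows "norm z < 1 \<Longrightarrow> norm (T z) \<le> norm z"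
    and "norm (frechet_derivative T (at 0) u) \<le> norm u"
proof -
  have unit: "\<exists>c e. u = complex_of_real c *s e \<and> c = norm u \<and> norm e = 1" if "u \<noteq> 0"
    for u :: "(complex, 'n) vec"
    using that by (intro exI[of _ "norm u"] exI[of _ "complex_of_real (1 / norm u) *s u"])
      (simp add: norm_vector_smult vector_smult_assoc norm_divide)
  have holl: "(\<lambda>\<zeta>. T (\<zeta> *s e) $ i) holomorphic_on ball 0 1" if "norm e = 1" for e i
    using hol_map_line_holomorphic_on[OF hol, of "ball 0 1" 0 e i] that
    by (simp add: norm_vector_smult)
  have T1': "norm (T (\<zeta> *s e)) < 1" if "norm e = 1" "cmod \<zeta> < 1" for e \<zeta>
    using T1 that by (simp add: norm_vector_smult)
  have T0': "T (0 *s e) = 0" for e by (simp add: T0)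
  show "norm (T z) \<le> norm z" if z: "norm z < 1"
  proof (cases "z = 0")
    case False
    then obtain c e where *: "z = complex_of_real c *s e" "c = norm z" "norm e = 1"
      using unit by blast
    have c: "cmod (complex_of_real c) = norm z" using *(2) by (simp only: norm_of_real abs_norm_cancel)
    then have "cmod (complex_of_real c) < 1" using z by (simp only:)
    from ball_map_schwarz(1)[OF holl[OF *(3)] T0' T1'[OF *(3)] this]
    show ?thesis unfolding c *(1)[symmetric] .
  qed (simp add: T0)
  show "norm (frechet_derivative T (at 0) u) \<le> norm u"
  proof (cases "u = 0")
    case True
    have "linear (frechet_derivative T (at 0))"
      using frechet_derivative_hol_map(1)[OF hol, of 0] has_derivative_linear by auto
    then show ?thesis using True linear_0 by auto
  next
    case False
    then obtain c e where *: "u = complex_of_real c *s e" "c = norm u" "norm e = 1"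
      using unit by blast
    have "((\<lambda>\<zeta>. T (\<zeta> *s e) $ i) has_field_derivative frechet_derivative T (at 0) e $ i) (at 0)" for i
      using hol_map_line_has_field_derivative[of T "frechet_derivative T (at 0)" 0 0 e i]
        frechet_derivative_hol_map[OF hol, of 0] by simp
    then have "(\<chi> i. deriv (\<lambda>\<zeta>. T (\<zeta> *s e) $ i) 0) = frechet_derivative T (at 0) e"
      by (simp add: vec_eq_iff DERIV_imp_deriv)
    then have "norm (frechet_derivative T (at 0) e) \<le> 1"
      using ball_map_schwarz(2)[OF holl[OF *(3)] T0' T1'[OF *(3)]] by simp
    then have "norm (frechet_derivative T (at 0) u) \<le> \<bar>c\<bar>"
      unfolding *(1) using frechet_derivative_hol_map(2)[OF hol, of 0]
      by (simp add: norm_vector_smult mult_left_le)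
    then show ?thesis using *(2) by simp
  qed
qed

lemma hol_map_on_ball_near_identity:
  fixes T :: "(complex, 'n::finite) vec \<Rightarrow> (complex, 'n) vec"
  assumes hol: "hol_map_on T (ball 0 1)" and T0: "T 0 = 0"
    and T1: "\<And>z. norm z < 1 \<Longrightarrow> norm (T z) < 1"
    and d: "\<And>u. norm (frechet_derivative T (at 0) u - u) \<le> \<epsilon> * norm u"
    and z: "norm z \<le> r" "r < 1"
  shows "(norm (T z - z))\<^sup>2 \<le> 4 * \<epsilon> / (1 - r)"
proof -
  have \<epsilon>: "0 \<le> \<epsilon>" using order_trans[OF norm_ge_zero d[of "axis undefined 1"]] by simp
  show ?thesis
  proof (cases "z = 0")
    case True
    then show ?thesis using \<epsilon> z by (simp add: T0)
  next
    case False
    define e where "e = complex_of_real (1 / norm z) *s z"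
    have e: "norm e = 1" and ze: "z = complex_of_real (norm z) *s e"
      using False by (simp_all add: e_def norm_vector_smult vector_smult_assoc norm_divide)
    have holl: "(\<lambda>\<zeta>. T (\<zeta> *s e) $ i) holomorphic_on ball 0 1" for i
      using hol_map_line_holomorphic_on[OF hol, of "ball 0 1" 0 e i] e
      by (simp add: norm_vector_smult)
    have "((\<lambda>\<zeta>. T (\<zeta> *s e) $ i) has_field_derivative frechet_derivative T (at 0) e $ i) (at 0)" for i
      using hol_map_line_has_field_derivative[of T "frechet_derivative T (at 0)" 0 0 e i]
        frechet_derivative_hol_map[OF hol, of 0] by simp
    then have "(\<chi> i. deriv (\<lambda>\<zeta>. T (\<zeta> *s e) $ i) 0) = frechet_derivative T (at 0) e"
      by (simp add: vec_eq_iff DERIV_imp_deriv)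
    then have "norm ((\<chi> i. deriv (\<lambda>\<zeta>. T (\<zeta> *s e) $ i) 0) - e) \<le> \<epsilon>"
      using d[of e] e by simp
    moreover have "norm (T (\<zeta> *s e)) < 1" if "cmod \<zeta> < 1" for \<zeta>
      using T1 that e by (simp add: norm_vector_smult)
    ultimately have "(norm (T z - z))\<^sup>2 \<le> 2 * \<epsilon> * (1 + norm z) / (1 - norm z)"
      using ball_map_near_identity[OF holl _ _ e, of \<epsilon> "of_real (norm z)"] T0 z
      by (simp add: ze[symmetric])
    also have "\<dots> \<le> 2 * \<epsilon> * 2 / (1 - r)"
      using z \<epsilon> by (intro frac_le mult_left_mono) auto
    finally show ?thesis by simp
  qed
qed

text \<open>A solution of \<open>T z = y\<close> is a fixed point of \<open>z - T z + y\<close>,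
  which maps the ball of radius \<open>r\<close> into itself. Brouwer's theorem applies.\<close>

lemma cball_subset_image_near_identity:
  fixes T :: "'a::euclidean_space \<Rightarrow> 'a"
  assumes "continuous_on (cball 0 r) T" and "\<And>z. norm z \<le> r \<Longrightarrow> norm (T z - z) \<le> r - s"
    and "norm y \<le> s" "0 < r"
  obtains z where "norm z \<le> r" "T z = y"
proof -
  have "\<exists>z\<in>cball 0 r. z - T z + y = z"
  proof (rule brouwer_ball[OF \<open>0 < r\<close>])
    show "continuous_on (cball 0 r) (\<lambda>z. z - T z + y)"
      by (intro continuous_intros assms(1))
    show "(\<lambda>z. z - T z + y) \<in> cball 0 r \<rightarrow> cball 0 r"
    proof
      fix z :: 'a assume "z \<in> cball 0 r"
      then have "norm (z - T z) \<le> r - s" using assms(2)[of z] by (simp add: norm_minus_commute)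
      then show "z - T z + y \<in> cball 0 r"
        using assms(3) norm_triangle_ineq[of "z - T z" y] by simp
    qed
  qed auto
  then obtain z where "norm z \<le> r" "z - T z + y = z" by auto
  then show thesis using that[of z] by (simp add: algebra_simps)
qed

section \<open>The transition maps of the exhaustion and their limit\<close>

text \<open>The manifold enters only through the overlap maps \<open>g j (h k z)\<close> between
  subsets of the ball. No charts are involved, and all parametrisations share the centre
  \<open>h 0 0\<close>.\<close>

locale ball_exhaustion =
  fixes M :: "nat \<Rightarrow> 'a set"
    and g :: "nat \<Rightarrow> 'a \<Rightarrow> (complex, 'n::finite) vec"
    and h :: "nat \<Rightarrow> (complex, 'n) vec \<Rightarrow> 'a"
  assumes mono: "j \<le> k \<Longrightarrow> M j \<subseteq> M k"
    and g_ball: "x \<in> M j \<Longrightarrow> norm (g j x) < 1"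
    and hg: "x \<in> M j \<Longrightarrow> h j (g j x) = x"
    and hM: "norm z < 1 \<Longrightarrow> h j z \<in> M j"
    and gh: "norm z < 1 \<Longrightarrow> g j (h j z) = z"
    and base: "h j 0 = h 0 0"
    and open_overlap: "open {z \<in> ball 0 1. h k z \<in> M j}"
    and hol_overlap: "hol_map_on (\<lambda>z. g j (h k z)) {z \<in> ball 0 1. h k z \<in> M j}"
begin

text \<open>For \<open>j \<le> k\<close> this is the inclusion of \<open>M j\<close> in
  \<open>M k\<close>, read in the ball coordinates.\<close>

definition T :: "nat \<Rightarrow> nat \<Rightarrow> (complex, 'n) vec \<Rightarrow> (complex, 'n) vec" where
  "T j k = (\<lambda>z. g k (h j z))"

text \<open>The Kobayashi metric of the ball at 0 is the norm. Hence \<open>norm (A j u)\<close> is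
  the Kobayashi length in \<open>M j\<close> of the vector at the centre with coordinates
  \<open>u\<close> in \<open>M 0\<close>.\<close>

definition A :: "nat \<Rightarrow> (complex, 'n) vec \<Rightarrow> (complex, 'n) vec" where
  "A j = frechet_derivative (T 0 j) (at 0)"

lemma hM_le: "j \<le> k \<Longrightarrow> norm z < 1 \<Longrightarrow> h j z \<in> M k"
  using hM mono by blast

lemma hol_T: "j \<le> k \<Longrightarrow> hol_map_on (T j k) (ball 0 1)"
  unfolding T_def by (rule hol_map_on_subset[OF hol_overlap]) (auto intro: hM_le)

lemma T_0: "T j k 0 = 0"
  using gh[of 0 k] base[of j] base[of k] by (simp add: T_def)

lemma T_ball: "j \<le> k \<Longrightarrow> norm z < 1 \<Longrightarrow> norm (T j k z) < 1"
  unfolding T_def by (intro g_ball hM_le)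

lemma T_g: "x \<in> M j \<Longrightarrow> T j k (g j x) = g k x"
  by (simp add: T_def hg)

text \<open>The Schwarz lemma for \<open>T j k\<close>. Consequently a bound
  \<open>norm (g j x) \<le> r\<close> persists for all later indices.\<close>

lemma norm_g_antimono: "x \<in> M j \<Longrightarrow> j \<le> k \<Longrightarrow> norm (g k x) \<le> norm (g j x)"
  using hol_map_on_ball_schwarz(1)[OF hol_T T_0 T_ball, of j k "g j x"] g_ball T_g by metis

lemma T_has_derivative:
  "j \<le> k \<Longrightarrow> (T j k has_derivative frechet_derivative (T j k) (at 0)) (at 0)"
  by (rule frechet_derivative_hol_map(1)[OF hol_T]) auto

lemma A_bounded_linear: "bounded_linear (A j)"
  unfolding A_def using T_has_derivative[of 0 j] has_derivative_bounded_linear by auto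

lemma norm_A_le: "norm (A j u) \<le> norm u"
  unfolding A_def by (rule hol_map_on_ball_schwarz(2)[OF hol_T T_0 T_ball]) auto

lemma A_chain:
  assumes "j \<le> k"
  shows "A k u = frechet_derivative (T j k) (at 0) (A j u)"
proof -
  have d: "(T j k has_derivative frechet_derivative (T j k) (at 0)) (at (T 0 j 0))"
    using T_has_derivative[OF assms] by (simp add: T_0)
  have "((\<lambda>z. T j k (T 0 j z)) has_derivative
      (\<lambda>u. frechet_derivative (T j k) (at 0) (A j u))) (at 0)"
    unfolding A_def by (rule has_derivative_compose[OF T_has_derivative d]) simp
  then have "(T 0 k has_derivative (\<lambda>u. frechet_derivative (T j k) (at 0) (A j u))) (at 0)"
    by (rule has_derivative_transform_within_open[of _ _ _ _ "ball 0 1"])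
       (auto simp: T_def hg hM_le)
  then show ?thesis
    unfolding A_def[of k] using frechet_derivative_at by metis
qed

text \<open>\<open>T j 0\<close> is controlled only on the overlap, but this is a neighbourhood of
  0, so its derivative there is a left inverse of \<open>A j\<close>.\<close>

lemma A_inj:
  assumes "A j u = 0"
  shows "u = 0"
proof -
  have 0: "0 \<in> {z \<in> ball 0 1. h j z \<in> M 0}" using hM[of 0 0] base[of j] by auto
  then obtain D where "(T j 0 has_derivative D) (at 0)"
    using hol_overlap[of 0 j] unfolding hol_map_on_def T_def by blast
  then have D: "(T j 0 has_derivative D) (at (T 0 j 0))" by (simp add: T_0)
  have "((\<lambda>z. T j 0 (T 0 j z)) has_derivative (\<lambda>u. D (A j u))) (at 0)"
    unfolding A_def by (rule has_derivative_compose[OF T_has_derivative D]) simp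
  then have "((\<lambda>z. z) has_derivative (\<lambda>u. D (A j u))) (at 0)"
    by (rule has_derivative_transform_within_open[of _ _ _ _ "ball 0 1"])
       (auto simp: T_def hg hM_le gh)
  then have "(\<lambda>u. D (A j u)) = (\<lambda>u. u)"
    using has_derivative_unique has_derivative_ident by blast
  then have "D 0 = u" using assms by metis
  moreover have "D 0 = 0" using D has_derivative_linear linear_0 by blast
  ultimately show "u = 0" by simp
qed

lemma A_surj: "surj (A j)"
proof -
  have lin: "linear (A j)" using A_bounded_linear by (rule bounded_linear.linear)
  then have "inj (A j)" using A_inj by (simp add: linear_injective_0)
  with lin show ?thesis by (rule linear_injective_imp_surjective) simp
qed

text \<open>The \<open>A j\<close> have operator norm at most 1, so they subconverge to some
  \<open>L\<close>. Nondegeneracy makes \<open>L\<close> injective and hence bounded below. By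
  \<open>A_chain\<close> the derivative of the transition map sends \<open>A (\<sigma> j) w\<close>
  to \<open>A (\<sigma> k) w\<close>, and both are close to \<open>L w\<close>.\<close>

lemma A_near_identity:
  assumes nondeg: "\<And>u. u \<noteq> 0 \<Longrightarrow> \<exists>\<delta>>0. \<forall>j. \<delta> \<le> norm (A j u)"
  obtains \<sigma> :: "nat \<Rightarrow> nat" where "strict_mono \<sigma>"
    and "\<And>\<epsilon>. \<epsilon> > 0 \<Longrightarrow> \<exists>J. \<forall>j\<ge>J. \<forall>k\<ge>j. \<forall>u.
      norm (frechet_derivative (T (\<sigma> j) (\<sigma> k)) (at 0) u - u) \<le> \<epsilon> * norm u"
proof -
  define B where "B = (\<lambda>j. Blinfun (A j))"
  have B: "blinfun_apply (B j) = A j" for j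
    unfolding B_def by (rule bounded_linear_Blinfun_apply[OF A_bounded_linear])
  have "norm (B j) \<le> 1" for j
    by (rule norm_blinfun_bound) (simp_all add: B norm_A_le)
  then have "\<forall>j. B j \<in> cball 0 1" by simp
  moreover have "seq_compact (cball (0 :: (complex, 'n) vec \<Rightarrow>\<^sub>L (complex, 'n) vec) 1)"
    by (rule compact_imp_seq_compact) simp
  ultimately obtain L \<sigma> where \<sigma>: "strict_mono \<sigma>" and L: "(B \<circ> \<sigma>) \<longlonglongrightarrow> L"
    unfolding seq_compact_def by metis
  have Linj: "u = 0" if "blinfun_apply L u = 0" for u
  proof (rule ccontr)
    assume "u \<noteq> 0"
    then obtain \<delta> where \<delta>: "\<delta> > 0" "\<And>j. \<delta> \<le> norm (A j u)" using nondeg by blast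
    have "(\<lambda>j. norm (blinfun_apply ((B \<circ> \<sigma>) j) u)) \<longlonglongrightarrow> norm (blinfun_apply L u)"
      by (intro tendsto_norm blinfun.tendsto[OF L] tendsto_const)
    then have "\<delta> \<le> norm (blinfun_apply L u)"
      by (rule LIMSEQ_le_const) (use \<delta>(2) in \<open>simp add: B\<close>)
    then show False using \<delta>(1) that by simp
  qed
  have linL: "linear (blinfun_apply L)" by (simp add: blinfun.bounded_linear_right bounded_linear.linear)
  then have "inj (blinfun_apply L)" using Linj by (simp add: linear_injective_0)
  then obtain c where c: "c > 0" "\<And>u. c * norm u \<le> norm (blinfun_apply L u)"
    using linear_inj_bounded_below_pos[OF linL] by blast
  have close: "\<exists>J. \<forall>j\<ge>J. \<forall>u. norm (A (\<sigma> j) u - blinfun_apply L u) \<le> \<epsilon> * norm u" if \<epsilon>: "\<epsilon> > 0" for \<epsilon>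
  proof -
    obtain J where J: "\<And>j. j \<ge> J \<Longrightarrow> norm ((B \<circ> \<sigma>) j - L) < \<epsilon>"
      using LIMSEQ_D[OF L \<epsilon>] by blast
    have "norm (A (\<sigma> j) u - blinfun_apply L u) \<le> \<epsilon> * norm u" if "j \<ge> J" for j u
    proof -
      have "norm (A (\<sigma> j) u - blinfun_apply L u) \<le> norm ((B \<circ> \<sigma>) j - L) * norm u"
        using norm_blinfun[of "(B \<circ> \<sigma>) j - L" u] by (simp add: blinfun.diff_left B)
      also have "\<dots> \<le> \<epsilon> * norm u" using J[OF that] by (intro mult_right_mono) auto
      finally show ?thesis .
    qed
    then show ?thesis by blast
  qed
  have "\<exists>J. \<forall>j\<ge>J. \<forall>k\<ge>j. \<forall>u.
      norm (frechet_derivative (T (\<sigma> j) (\<sigma> k)) (at 0) u - u) \<le> \<epsilon> * norm u" if \<epsilon>: "\<epsilon> > 0" for \<epsilon>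
  proof -
    \<comment> \<open>From \<open>J1\<close> on, \<open>A (\<sigma> j)\<close> is bounded below by
      \<open>c / 2\<close>.\<close>
    obtain J1 where J1: "\<And>j u. j \<ge> J1 \<Longrightarrow> norm (A (\<sigma> j) u - blinfun_apply L u) \<le> c / 2 * norm u"
      using close[of "c / 2"] c(1) by auto
    \<comment> \<open>Two errors of this size add up to
      \<open>\<epsilon> * (c / 2 * norm w)\<close>, and
      \<open>c / 2 * norm w \<le> norm u\<close>.\<close>
    obtain J2 where J2: "\<And>j u. j \<ge> J2 \<Longrightarrow> norm (A (\<sigma> j) u - blinfun_apply L u) \<le> \<epsilon> * c / 4 * norm u"
      using close[of "\<epsilon> * c / 4"] c(1) \<epsilon> by auto
    have "norm (frechet_derivative (T (\<sigma> j) (\<sigma> k)) (at 0) u - u) \<le> \<epsilon> * norm u"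
      if jk: "j \<ge> max J1 J2" "k \<ge> j" for j k u
    proof -
      obtain w where w: "A (\<sigma> j) w = u" using A_surj by (metis surjD)
      have "\<sigma> j \<le> \<sigma> k" using \<sigma> jk(2) by (simp add: strict_mono_less_eq)
      then have "frechet_derivative (T (\<sigma> j) (\<sigma> k)) (at 0) u = A (\<sigma> k) w"
        using A_chain w by metis
      then have "norm (frechet_derivative (T (\<sigma> j) (\<sigma> k)) (at 0) u - u) = norm (A (\<sigma> k) w - A (\<sigma> j) w)"
        by (simp add: w)
      also have "\<dots> \<le> \<epsilon> * c / 4 * norm w + \<epsilon> * c / 4 * norm w"
        using norm_triangle_ineq4[of "A (\<sigma> k) w - blinfun_apply L w" "A (\<sigma> j) w - blinfun_apply L w"]
          J2[of k w] J2[of j w] jk by simp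
      finally have 1: "norm (frechet_derivative (T (\<sigma> j) (\<sigma> k)) (at 0) u - u) \<le> \<epsilon> * (c / 2 * norm w)"
        by (simp add: algebra_simps)
      have "c * norm w \<le> norm (blinfun_apply L w)" by (rule c(2))
      also have "\<dots> \<le> norm u + c / 2 * norm w"
        using J1[of j w] jk norm_triangle_sub[of "blinfun_apply L w" u]
        by (simp add: w norm_minus_commute)
      finally have "c / 2 * norm w \<le> norm u" by simp
      then show ?thesis using 1 \<epsilon> by (meson mult_left_mono order_trans less_imp_le)
    qed
    then show ?thesis by blast
  qed
  then show thesis using that \<sigma> by blast
qed

text \<open>Nearness of the transition maps to the identity is uniform on
  \<open>norm z \<le> r\<close>, so the Cauchy property is uniform on the sets
  \<open>norm (g (\<sigma> j) x) \<le> r\<close>. In the last clause a single \<open>j\<close>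
  serves all \<open>x\<close>: this makes \<open>norm G\<close> an exhaustion.\<close>

lemma limit_map:
  assumes nondeg: "\<And>u. u \<noteq> 0 \<Longrightarrow> \<exists>\<delta>>0. \<forall>j. \<delta> \<le> norm (A j u)"
  obtains \<sigma> :: "nat \<Rightarrow> nat" and G where "strict_mono \<sigma>"
    and "\<And>r \<eta>. r < 1 \<Longrightarrow> \<eta> > 0 \<Longrightarrow> \<exists>J. \<forall>j\<ge>J. \<forall>x\<in>M (\<sigma> j).
           norm (g (\<sigma> j) x) \<le> r \<longrightarrow> norm (g (\<sigma> j) x - G x) \<le> \<eta>"
    and "\<And>j x. x \<in> M (\<sigma> j) \<Longrightarrow> norm (G x) \<le> norm (g (\<sigma> j) x)"
    and "\<And>r. r < 1 \<Longrightarrow> \<exists>j. \<exists>r'<1. \<forall>x\<in>(\<Union>j. M j). norm (G x) \<le> r \<longrightarrow> x \<in> h (\<sigma> j) ` cball 0 r'"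
proof -
  obtain \<sigma> :: "nat \<Rightarrow> nat" where \<sigma>: "strict_mono \<sigma>" and near: "\<And>\<epsilon>. \<epsilon> > 0 \<Longrightarrow> \<exists>J. \<forall>j\<ge>J. \<forall>k\<ge>j. \<forall>u.
      norm (frechet_derivative (T (\<sigma> j) (\<sigma> k)) (at 0) u - u) \<le> \<epsilon> * norm u"
    using A_near_identity[OF nondeg] by blast
  have \<sigma>le: "\<sigma> j \<le> \<sigma> k" if "j \<le> k" for j k using \<sigma> that by (simp add: strict_mono_less_eq)
  have ident: "\<exists>J. \<forall>j\<ge>J. \<forall>k\<ge>j. \<forall>z. norm z \<le> r \<longrightarrow> norm (T (\<sigma> j) (\<sigma> k) z - z) \<le> \<eta>"
    if r: "r < 1" and \<eta>: "\<eta> > 0" for r \<eta>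
  proof -
    \<comment> \<open>Chosen so that
      \<open>4 * \<epsilon> / (1 - r) = \<eta>\<^sup>2\<close>.\<close>
    define \<epsilon> where "\<epsilon> = \<eta>\<^sup>2 * (1 - r) / 4"
    have "\<epsilon> > 0" using r \<eta> by (simp add: \<epsilon>_def)
    then obtain J where J: "\<And>j k u. j \<ge> J \<Longrightarrow> k \<ge> j \<Longrightarrow>
      norm (frechet_derivative (T (\<sigma> j) (\<sigma> k)) (at 0) u - u) \<le> \<epsilon> * norm u"
      using near by metis
    have "norm (T (\<sigma> j) (\<sigma> k) z - z) \<le> \<eta>" if jk: "j \<ge> J" "k \<ge> j" and z: "norm z \<le> r" for j k z
    proof -
      have "(norm (T (\<sigma> j) (\<sigma> k) z - z))\<^sup>2 \<le> 4 * \<epsilon> / (1 - r)"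
        using hol_map_on_ball_near_identity[OF hol_T T_0 T_ball J z r] \<sigma>le jk by blast
      also have "\<dots> = \<eta>\<^sup>2" using r by (simp add: \<epsilon>_def)
      finally show ?thesis using \<eta> by (simp add: power2_le_iff_abs_le)
    qed
    then show ?thesis by blast
  qed
  have cauchy: "\<exists>J. \<forall>j\<ge>J. \<forall>k\<ge>j. \<forall>x\<in>M (\<sigma> j).
      norm (g (\<sigma> j) x) \<le> r \<longrightarrow> norm (g (\<sigma> k) x - g (\<sigma> j) x) \<le> \<eta>"
    if "r < 1" "\<eta> > 0" for r \<eta>
    using ident[OF that] T_g by metis
  define G where "G = (\<lambda>x. lim (\<lambda>j. g (\<sigma> j) x))"
  have ex: "\<exists>j. x \<in> M (\<sigma> j)" if "x \<in> M i" for x i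
    using mono[of i "\<sigma> i"] seq_suble[OF \<sigma>, of i] that by blast
  have lim: "(\<lambda>j. g (\<sigma> j) x) \<longlonglongrightarrow> G x" if x: "x \<in> M i" for x i
  proof -
    obtain j0 where j0: "x \<in> M (\<sigma> j0)" using ex x by blast
    have "Cauchy (\<lambda>j. g (\<sigma> j) x)"
    proof (rule metric_CauchyI)
      fix e :: real assume e: "e > 0"
      obtain J where J: "\<And>j k y. j \<ge> J \<Longrightarrow> k \<ge> j \<Longrightarrow> y \<in> M (\<sigma> j) \<Longrightarrow>
          norm (g (\<sigma> j) y) \<le> norm (g (\<sigma> j0) x) \<Longrightarrow> norm (g (\<sigma> k) y - g (\<sigma> j) y) \<le> e / 2"
        using cauchy[OF g_ball[OF j0], of "e / 2"] e by auto
      have le: "dist (g (\<sigma> m) x) (g (\<sigma> n) x) < e" if "n \<ge> max J j0" "m \<ge> n" for m n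
      proof -
        have "x \<in> M (\<sigma> n)" using mono[OF \<sigma>le[of j0 n]] j0 that by auto
        \<comment> \<open>By monotonicity the radius \<open>norm (g (\<sigma> j0) x) < 1\<close>
          serves for all later indices.\<close>
        moreover have "norm (g (\<sigma> n) x) \<le> norm (g (\<sigma> j0) x)"
          using norm_g_antimono[OF j0 \<sigma>le] that by simp
        ultimately have "norm (g (\<sigma> m) x - g (\<sigma> n) x) \<le> e / 2" using J that by simp
        then show ?thesis using e by (simp add: dist_norm)
      qed
      have "dist (g (\<sigma> m) x) (g (\<sigma> n) x) < e" if "n \<ge> max J j0" "m \<ge> max J j0" for m n
        using le[of n m] le[of m n] that by (metis dist_commute nle_le)
      then show "\<exists>N. \<forall>m\<ge>N. \<forall>n\<ge>N. dist (g (\<sigma> m) x) (g (\<sigma> n) x) < e" by blast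
    qed
    then show ?thesis
      unfolding G_def by (simp add: Cauchy_convergent_iff convergent_LIMSEQ_iff)
  qed
  have unif: "\<exists>J. \<forall>j\<ge>J. \<forall>x\<in>M (\<sigma> j). norm (g (\<sigma> j) x) \<le> r \<longrightarrow> norm (g (\<sigma> j) x - G x) \<le> \<eta>"
    if r: "r < 1" and \<eta>: "\<eta> > 0" for r \<eta>
  proof -
    obtain J where J: "\<And>j k x. j \<ge> J \<Longrightarrow> k \<ge> j \<Longrightarrow> x \<in> M (\<sigma> j) \<Longrightarrow>
          norm (g (\<sigma> j) x) \<le> r \<Longrightarrow> norm (g (\<sigma> k) x - g (\<sigma> j) x) \<le> \<eta>"
      using cauchy[OF r \<eta>] by blast
    have "norm (g (\<sigma> j) x - G x) \<le> \<eta>"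
      if "j \<ge> J" "x \<in> M (\<sigma> j)" "norm (g (\<sigma> j) x) \<le> r" for j x
    proof (rule LIMSEQ_le_const2)
      show "(\<lambda>k. norm (g (\<sigma> j) x - g (\<sigma> k) x)) \<longlonglongrightarrow> norm (g (\<sigma> j) x - G x)"
        by (intro tendsto_intros lim[OF that(2)])
      show "\<exists>N. \<forall>n\<ge>N. norm (g (\<sigma> j) x - g (\<sigma> n) x) \<le> \<eta>"
        using J[OF that(1) _ that(2,3)] by (metis norm_minus_commute)
    qed
    then show ?thesis by blast
  qed
  have Gle: "norm (G x) \<le> norm (g (\<sigma> j) x)" if "x \<in> M (\<sigma> j)" for x j
    by (rule LIMSEQ_le_const2[OF tendsto_norm[OF lim[OF that]]])
       (use norm_g_antimono[OF that] \<sigma>le in blast)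
  have compact: "\<exists>j. \<exists>r'<1. \<forall>x\<in>(\<Union>j. M j). norm (G x) \<le> r \<longrightarrow> x \<in> h (\<sigma> j) ` cball 0 r'"
    if "r < 1" for r
  proof -
    \<comment> \<open>\<open>r\<close> may be negative. The radii satisfy
      \<open>s < s' < r' < 1\<close>: the gap \<open>r' - s'\<close> is the error allowed to the
      transition maps, the gap below \<open>s'\<close> makes room for passing from \<open>G\<close>
      to \<open>g (\<sigma> k)\<close>.\<close>
    define s where "s = max r 0"
    define r' where "r' = (s + 1) / 2"
    define s' where "s' = (s + r') / 2"
    have s: "r \<le> s" "s < s'" "s' < r'" "r' < 1" "0 < r'"
      using that by (auto simp: s_def r'_def s'_def)
    obtain J where J: "\<And>k z. k \<ge> J \<Longrightarrow> norm z \<le> r' \<Longrightarrow> norm (T (\<sigma> J) (\<sigma> k) z - z) \<le> r' - s'"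
      using ident[OF s(4), of "r' - s'"] s(3) by auto
    have "x \<in> h (\<sigma> J) ` cball 0 r'" if x: "x \<in> M i" "norm (G x) \<le> r" for x i
    proof -
      obtain j0 where j0: "x \<in> M (\<sigma> j0)" using ex x(1) by blast
      have "(\<lambda>j. norm (g (\<sigma> j) x)) \<longlonglongrightarrow> norm (G x)" by (rule tendsto_norm[OF lim[OF x(1)]])
      moreover have "norm (G x) < s'" using x(2) s by linarith
      ultimately have "eventually (\<lambda>j. norm (g (\<sigma> j) x) < s') sequentially" by (rule order_tendstoD)
      \<comment> \<open>\<open>k\<close> depends on \<open>x\<close>, but \<open>J\<close> does not.
        The point \<open>g (\<sigma> k) x\<close> is hit by
        \<open>T (\<sigma> J) (\<sigma> k)\<close> from within radius \<open>r'\<close>, and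
        applying \<open>h (\<sigma> k)\<close> shows that \<open>x\<close> comes from the same point
        under \<open>h (\<sigma> J)\<close>.\<close>
      then obtain k where k: "k \<ge> max J j0" "norm (g (\<sigma> k) x) < s'"
        unfolding eventually_sequentially by (meson max.cobounded2 max.cobounded1 order_trans nle_le)
      have xk: "x \<in> M (\<sigma> k)" using mono[OF \<sigma>le[of j0 k]] j0 k by auto
      have "continuous_on (cball 0 r') (T (\<sigma> J) (\<sigma> k))"
        using hol_map_on_imp_continuous_on[OF hol_T[OF \<sigma>le[of J k]]] k(1) s(4)
        by (auto elim!: continuous_on_subset)
      then obtain z where z: "norm z \<le> r'" "T (\<sigma> J) (\<sigma> k) z = g (\<sigma> k) x"
        using cball_subset_image_near_identity[of r' "T (\<sigma> J) (\<sigma> k)" s' "g (\<sigma> k) x"] J k s by auto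
      then have z1: "norm z < 1" using s by simp
      have "h (\<sigma> k) (g (\<sigma> k) (h (\<sigma> J) z)) = h (\<sigma> J) z"
        using hg hM_le[OF \<sigma>le[of J k] z1] k(1) by simp
      then have "h (\<sigma> J) z = x" using z(2) hg[OF xk] by (simp add: T_def)
      then show ?thesis using z(1) by auto
    qed
    then show ?thesis using s(4) by blast
  qed
  show thesis using that[OF \<sigma> unif Gle compact] by blast
qed

end

section \<open>Complex manifolds\<close>

locale complex_mfd =
  fixes X :: "'a topology" and A :: "('a, 'n::finite) chart set"
  assumes manifold: "complex_manifold X A"
begin

lemma Hausdorff: "Hausdorff_space X"
  using manifold by (simp add: complex_manifold_def)

lemma chart:
  assumes "(U, \<phi>) \<in> A"
  shows "openin X U" and "open (\<phi> ` U)"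
    and "homeomorphic_map (subtopology X U) (top_of_set (\<phi> ` U)) \<phi>"
  using manifold assms unfolding complex_manifold_def complex_chart_def by auto

lemma chart_subset: "(U, \<phi>) \<in> A \<Longrightarrow> U \<subseteq> topspace X"
  using chart(1) openin_subset by blast

lemma obtain_chart:
  assumes "x \<in> topspace X"
  obtains U \<phi> where "(U, \<phi>) \<in> A" "x \<in> U"
  using manifold assms unfolding complex_manifold_def by auto

lemma chart_inj: "(U, \<phi>) \<in> A \<Longrightarrow> inj_on \<phi> U"
  using homeomorphic_imp_injective_map[OF chart(3)] chart_subset
  by (simp add: inf.absorb2)

lemma chart_inv: "(U, \<phi>) \<in> A \<Longrightarrow> x \<in> U \<Longrightarrow> inv_into U \<phi> (\<phi> x) = x"
  using chart_inj by simp

lemma chart_inv_continuous: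
  assumes "(U, \<phi>) \<in> A"
  shows "continuous_map (top_of_set (\<phi> ` U)) X (inv_into U \<phi>)"
proof -
  obtain \<psi> where \<psi>: "homeomorphic_maps (subtopology X U) (top_of_set (\<phi> ` U)) \<phi> \<psi>"
    using chart(3)[OF assms] homeomorphic_map_maps by blast
  then have cont: "continuous_map (top_of_set (\<phi> ` U)) X \<psi>"
    unfolding homeomorphic_maps_def by (simp add: continuous_map_in_subtopology)
  have eq: "\<psi> z = inv_into U \<phi> z" if "z \<in> \<phi> ` U" for z
    using \<psi> that chart_inv[OF assms] chart_subset[OF assms]
    unfolding homeomorphic_maps_def by (auto simp: subset_iff)
  show ?thesis
    by (rule continuous_map_eq[OF cont]) (simp add: eq)
qed

lemma open_chart_image:
  assumes "(U, \<phi>) \<in> A" "openin X W"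
  shows "open (\<phi> ` (U \<inter> W))"
proof -
  have "openin (subtopology X U) (U \<inter> W)" using assms(2) by (rule openin_subtopology_Int2)
  then have "openin (top_of_set (\<phi> ` U)) (\<phi> ` (U \<inter> W))"
    using homeomorphic_imp_open_map[OF chart(3)[OF assms(1)]] unfolding open_map_def by blast
  then show ?thesis using chart(2)[OF assms(1)] openin_open_trans by blast
qed

lemma openin_chart_preimage:
  assumes "(U, \<phi>) \<in> A" "open Z"
  shows "openin X {x \<in> U. \<phi> x \<in> Z}"
proof -
  have "continuous_map (subtopology X U) euclidean \<phi>"
    using homeomorphic_imp_continuous_map[OF chart(3)[OF assms(1)]]
    by (simp add: continuous_map_in_subtopology)
  then have "openin (subtopology X U) {x \<in> topspace (subtopology X U). \<phi> x \<in> Z}"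
    by (rule openin_continuous_map_preimage) (simp add: assms(2))
  moreover have "topspace (subtopology X U) = U"
    using chart_subset[OF assms(1)] by (simp add: inf.absorb2)
  ultimately show ?thesis
    using openin_trans_full[OF _ chart(1)[OF assms(1)]] by (simp only:)
qed

lemma hol_map_on_transition:
  assumes "(U, \<phi>) \<in> A" "(V, \<psi>) \<in> A"
  shows "hol_map_on (\<lambda>z. \<psi> (inv_into U \<phi> z)) (\<phi> ` (U \<inter> V))"
proof -
  have "mv_holomorphic_on (\<lambda>z. transition_map (U, \<phi>) (V, \<psi>) z $ i) (\<phi> ` (U \<inter> V))" for i
    using manifold assms unfolding complex_manifold_def by (metis fst_conv snd_conv)
  then show ?thesis
    by (simp add: hol_map_on_iff transition_map_def)
qed

section \<open>Holomorphic maps from and to the ball\<close>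

definition mfd_map :: "'a set \<Rightarrow> ('a \<Rightarrow> (complex, 'n) vec) \<Rightarrow> bool" where
  "mfd_map W g \<longleftrightarrow> (\<forall>(U, \<phi>)\<in>A. hol_map_on (\<lambda>z. g (inv_into U \<phi> z)) (\<phi> ` (U \<inter> W)))"

definition ball_param :: "((complex, 'n) vec \<Rightarrow> 'a) \<Rightarrow> bool" where
  "ball_param h \<longleftrightarrow> continuous_map (top_of_set (ball 0 1)) X h \<and>
     (\<forall>(U, \<phi>)\<in>A. hol_map_on (\<lambda>z. \<phi> (h z)) {z \<in> ball 0 1. h z \<in> U})"

lemma ball_param_chart:
  "ball_param h \<Longrightarrow> (U, \<phi>) \<in> A \<Longrightarrow> hol_map_on (\<lambda>z. \<phi> (h z)) {z \<in> ball 0 1. h z \<in> U}"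
  unfolding ball_param_def by blast

lemma mfd_map_chart:
  "mfd_map W g \<Longrightarrow> (U, \<phi>) \<in> A \<Longrightarrow> hol_map_on (\<lambda>z. g (inv_into U \<phi> z)) (\<phi> ` (U \<inter> W))"
  unfolding mfd_map_def by blast

lemma ball_param_topspace: "ball_param h \<Longrightarrow> norm z < 1 \<Longrightarrow> h z \<in> topspace X"
  unfolding ball_param_def continuous_map_def by (auto simp: Pi_iff)

lemma open_ball_param_preimage:
  assumes "ball_param h" "openin X W"
  shows "open {z \<in> ball 0 1. h z \<in> W}"
proof -
  have "openin (top_of_set (ball 0 1)) {z \<in> topspace (top_of_set (ball 0 1)). h z \<in> W}"
    using assms by (intro openin_continuous_map_preimage) (auto simp: ball_param_def)
  then show ?thesis
    by (auto intro: openin_open_trans)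
qed

lemma hol_map_on_overlap:
  assumes h: "ball_param h" and g: "mfd_map W g" and W: "openin X W"
  shows "hol_map_on (\<lambda>z. g (h z)) {z \<in> ball 0 1. h z \<in> W}"
proof (rule hol_map_on_local)
  fix z assume z: "z \<in> {z \<in> ball 0 1. h z \<in> W}"
  then obtain U \<phi> where U: "(U, \<phi>) \<in> A" "h z \<in> U"
    using obtain_chart[of "h z"] ball_param_topspace[OF h] by auto
  define N where "N = {z \<in> ball 0 1. h z \<in> U \<inter> W}"
  have "openin X (U \<inter> W)" using chart(1)[OF U(1)] W by blast
  then have N: "open N" unfolding N_def by (rule open_ball_param_preimage[OF h])
  have "hol_map_on (\<lambda>z. g (inv_into U \<phi> (\<phi> (h z)))) N"
  proof (rule hol_map_on_compose[where F = "\<lambda>z. \<phi> (h z)" and T = "\<phi> ` (U \<inter> W)"])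
    show "hol_map_on (\<lambda>z. \<phi> (h z)) N"
      using ball_param_chart[OF h U(1)] by (rule hol_map_on_subset) (auto simp: N_def)
    show "hol_map_on (\<lambda>z. g (inv_into U \<phi> z)) (\<phi> ` (U \<inter> W))" by (rule mfd_map_chart[OF g U(1)])
  qed (auto simp: N_def)
  then have "hol_map_on (\<lambda>z. g (h z)) N"
    by (rule hol_map_on_cong_open[OF N, rotated]) (simp add: N_def chart_inv[OF U(1)])
  then show "\<exists>N. z \<in> N \<and> hol_map_on (\<lambda>z. g (h z)) N"
    using z U(2) by (intro exI[of _ N] conjI) (simp_all add: N_def)
qed

text \<open>Both maps are composed with the automorphisms from \<open>ball_transitive\<close> that
  exchange \<open>g p\<close> and 0.\<close>

lemma biholomorphic_to_ball_normalized:
  assumes "biholomorphic_to_ball X A W" "p \<in> W"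
  obtains g h where "mfd_map W g" "ball_param h"
    "\<And>x. x \<in> W \<Longrightarrow> norm (g x) < 1" "\<And>x. x \<in> W \<Longrightarrow> h (g x) = x"
    "\<And>z. norm z < 1 \<Longrightarrow> h z \<in> W" "\<And>z. norm z < 1 \<Longrightarrow> g (h z) = z"
    "h 0 = p"
proof -
  obtain g :: "'a \<Rightarrow> (complex, 'n) vec" and h where
    g: "\<forall>i. mfd_holomorphic_on A W (\<lambda>x. g x $ i)"
    and h: "continuous_map (top_of_set (ball 0 1)) X h"
      "\<forall>(U, \<phi>)\<in>A. \<forall>i. mv_holomorphic_on (\<lambda>z. \<phi> (h z) $ i) {z \<in> ball 0 1. h z \<in> U}"
    and gh: "\<forall>x\<in>W. g x \<in> ball 0 1 \<and> h (g x) = x" "\<forall>z\<in>ball 0 1. h z \<in> W \<and> g (h z) = z"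
    using assms(1) unfolding biholomorphic_to_ball_def by blast
  have mg: "hol_map_on (\<lambda>z. g (inv_into U \<phi> z)) (\<phi> ` (U \<inter> W))" if "(U, \<phi>) \<in> A" for U \<phi>
    using g that unfolding mfd_holomorphic_on_def hol_map_on_iff by (auto simp: comp_def)
  have mh: "hol_map_on (\<lambda>z. \<phi> (h z)) {z \<in> ball 0 1. h z \<in> U}" if "(U, \<phi>) \<in> A" for U \<phi>
    using h(2) that unfolding hol_map_on_iff by auto
  have "norm (g p) < 1" using gh(1) assms(2) by auto
  then obtain \<psi> \<psi>' :: "(complex, 'n) vec \<Rightarrow> (complex, 'n) vec"
    where \<psi>: "hol_map_on \<psi> (ball 0 1)" "hol_map_on \<psi>' (ball 0 1)"
    "\<And>z. z \<in> ball 0 1 \<Longrightarrow> \<psi> z \<in> ball 0 1" "\<And>z. z \<in> ball 0 1 \<Longrightarrow> \<psi>' z \<in> ball 0 1"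
    "\<And>z. z \<in> ball 0 1 \<Longrightarrow> \<psi>' (\<psi> z) = z" "\<And>z. z \<in> ball 0 1 \<Longrightarrow> \<psi> (\<psi>' z) = z"
    "\<psi> (g p) = 0" "\<psi>' 0 = g p"
    using ball_transitive by blast
  show thesis
  proof (rule that[of "\<lambda>x. \<psi> (g x)" "\<lambda>z. h (\<psi>' z)"])
    have "hol_map_on (\<lambda>z. \<psi> (g (inv_into U \<phi> z))) (\<phi> ` (U \<inter> W))" if "(U, \<phi>) \<in> A" for U \<phi>
    proof (rule hol_map_on_compose[OF mg[OF that] \<psi>(1)])
      show "(\<lambda>z. g (inv_into U \<phi> z)) ` \<phi> ` (U \<inter> W) \<subseteq> ball 0 1"
        using gh(1) chart_inv[OF that] by auto
    qed
    then show "mfd_map W (\<lambda>x. \<psi> (g x))" unfolding mfd_map_def by blast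
    have "hol_map_on (\<lambda>z. \<phi> (h (\<psi>' z))) {z \<in> ball 0 1. h (\<psi>' z) \<in> U}" if "(U, \<phi>) \<in> A" for U \<phi>
      by (rule hol_map_on_compose[OF hol_map_on_subset[OF \<psi>(2)] mh[OF that]]) (use \<psi>(4) in auto)
    moreover have "continuous_map (top_of_set (ball 0 1)) X (h \<circ> \<psi>')"
      by (rule continuous_map_compose[OF _ h(1)])
         (use hol_map_on_imp_continuous_on[OF \<psi>(2)] \<psi>(4) in auto)
    ultimately show "ball_param (\<lambda>z. h (\<psi>' z))"
      unfolding ball_param_def by (auto simp: comp_def)
  qed (use gh \<psi> assms(2) in auto)
qed

section \<open>Tangent vectors and discs coming from the ball\<close>

text \<open>The differential of \<open>h\<close> at 0, with values encoded as in
  \<open>tangent_space\<close>.\<close>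

definition push :: "((complex, 'n) vec \<Rightarrow> 'a) \<Rightarrow> (complex, 'n) vec \<Rightarrow> ('a, 'n) tangent" where
  "push h w = (\<lambda>c. if c \<in> A \<and> h 0 \<in> fst c
     then frechet_derivative (\<lambda>z. snd c (h z)) (at 0) w else 0)"

lemma ball_param_has_derivative:
  assumes "ball_param h" "c \<in> A" "h 0 \<in> fst c"
  shows "((\<lambda>z. snd c (h z)) has_derivative (\<lambda>w. push h w c)) (at 0)"
    and "push h (k *s w) c = k *s push h w c"
  using assms frechet_derivative_hol_map[OF ball_param_chart[OF assms(1), of "fst c" "snd c"], of 0]
  by (simp_all add: push_def)

lemma push_smult: "ball_param h \<Longrightarrow> push h (k *s w) = tangent_scale k (push h w)"
  unfolding tangent_scale_def fun_eq_iff
  using ball_param_has_derivative(2) by (metis push_def vector_smult_rzero)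

lemma push_in_tangent_space:
  assumes h: "ball_param h"
  shows "push h w \<in> tangent_space A (h 0)"
  unfolding tangent_space_def
proof (intro CollectI conjI allI ballI impI)
  show "push h w c = 0" if "\<not> (c \<in> A \<and> h 0 \<in> fst c)" for c
    using that by (auto simp: push_def)
  fix c d assume c: "c \<in> A" and d: "d \<in> A" and 0: "h 0 \<in> fst c \<and> h 0 \<in> fst d"
  have cA: "(fst c, snd c) \<in> A" and dA: "(fst d, snd d) \<in> A" using c d by auto
  have hol: "hol_map_on (transition_map c d) (snd c ` (fst c \<inter> fst d))"
    using hol_map_on_transition[OF cA dA] by (simp add: transition_map_def comp_def)
  have dt: "(transition_map c d has_derivative frechet_derivative (transition_map c d) (at (snd c (h 0))))
      (at (snd c (h 0)))"
    using frechet_derivative_hol_map(1)[OF hol] 0 by auto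
  have "((\<lambda>z. transition_map c d (snd c (h z))) has_derivative
      (\<lambda>w. frechet_derivative (transition_map c d) (at (snd c (h 0))) (push h w c))) (at 0)"
    using has_derivative_compose[OF ball_param_has_derivative(1)[OF h c] dt] 0 by auto
  moreover have "open {z \<in> ball 0 1. h z \<in> fst c}"
    using open_ball_param_preimage[OF h] chart(1)[OF cA] by blast
  ultimately have "((\<lambda>z. snd d (h z)) has_derivative
      (\<lambda>w. frechet_derivative (transition_map c d) (at (snd c (h 0))) (push h w c))) (at 0)"
    by (rule has_derivative_transform_within_open)
       (use 0 chart_inv[OF cA] in \<open>auto simp: transition_map_def\<close>)
  then show "push h w d = frechet_derivative (transition_map c d) (at (snd c (h 0))) (push h w c)"
    using has_derivative_unique[OF ball_param_has_derivative(1)[OF h d]] 0 by metis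
qed

lemma push_compose:
  assumes h: "ball_param h" and h': "ball_param h'"
    and T: "(T has_derivative D) (at 0)" "T 0 = 0"
    and eq: "\<And>z. norm z < 1 \<Longrightarrow> h' (T z) = h z"
  shows "push h w = push h' (D w)"
proof
  fix c
  have h0: "h 0 = h' 0" using eq[of 0] T(2) by simp
  show "push h w c = push h' (D w) c"
  proof (cases "c \<in> A \<and> h 0 \<in> fst c")
    case True
    have "((\<lambda>z. snd c (h' z)) has_derivative (\<lambda>w. push h' w c)) (at (T 0))"
      using ball_param_has_derivative(1)[OF h'] True h0 T(2) by simp
    then have "((\<lambda>z. snd c (h' (T z))) has_derivative (\<lambda>w. push h' (D w) c)) (at 0)"
      using has_derivative_compose[OF T(1)] by blast
    then have "((\<lambda>z. snd c (h z)) has_derivative (\<lambda>w. push h' (D w) c)) (at 0)"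
      by (rule has_derivative_transform_within_open[of _ _ _ _ "ball 0 1"]) (auto simp: eq)
    then show ?thesis
      using has_derivative_unique[OF ball_param_has_derivative(1)[OF h]] True by metis
  qed (auto simp: push_def h0)
qed

lemma push_eq_0:
  assumes h: "ball_param h" and g: "mfd_map W g" and W: "openin X W" "h 0 \<in> W"
    and gh: "\<And>z. norm z < 1 \<Longrightarrow> g (h z) = z" and 0: "push h w = 0"
  shows "w = 0"
proof -
  obtain U \<phi> where U: "(U, \<phi>) \<in> A" "h 0 \<in> U"
    using obtain_chart[OF ball_param_topspace[OF h]] by (metis norm_zero zero_less_one)
  have "\<phi> (h 0) \<in> \<phi> ` (U \<inter> W)" using U W by blast
  then obtain D where D: "((\<lambda>z. g (inv_into U \<phi> z)) has_derivative D) (at (\<phi> (h 0)))"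
    using mfd_map_chart[OF g U(1)] unfolding hol_map_on_def by blast
  have "((\<lambda>z. \<phi> (h z)) has_derivative (\<lambda>w. push h w (U, \<phi>))) (at 0)"
    using ball_param_has_derivative(1)[OF h U(1)] U(2) by simp
  then have "((\<lambda>z. g (inv_into U \<phi> (\<phi> (h z)))) has_derivative (\<lambda>w. D (push h w (U, \<phi>)))) (at 0)"
    using has_derivative_compose D by blast
  moreover have "open {z \<in> ball 0 1. h z \<in> U}"
    using open_ball_param_preimage[OF h] chart(1)[OF U(1)] by blast
  ultimately have "((\<lambda>z. z) has_derivative (\<lambda>w. D (push h w (U, \<phi>)))) (at 0)"
    by (rule has_derivative_transform_within_open)
       (use U chart_inv[OF U(1)] gh in auto)
  then have "(\<lambda>w. D (push h w (U, \<phi>))) = (\<lambda>w. w)"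
    using has_derivative_unique has_derivative_ident by blast
  then have "D (push h w (U, \<phi>)) = w" by metis
  moreover have "D 0 = 0" using D has_derivative_linear linear_0 by blast
  ultimately show "w = 0" by (simp add: 0)
qed

lemma disc_velocity_ball_param:
  assumes h: "ball_param h"
  shows "disc_velocity A (\<lambda>\<zeta>. h (\<zeta> *s w)) = push h w"
proof
  fix c
  show "disc_velocity A (\<lambda>\<zeta>. h (\<zeta> *s w)) c = push h w c"
  proof (cases "c \<in> A \<and> h 0 \<in> fst c")
    case True
    have "((\<lambda>\<zeta>. snd c (h (\<zeta> *s w)) $ i) has_field_derivative push h w c $ i) (at 0)" for i
      using hol_map_line_has_field_derivative[of "\<lambda>z. snd c (h z)" "\<lambda>w. push h w c" 0 0 w i]
        ball_param_has_derivative[OF h] True by simp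
    then show ?thesis
      using True by (simp add: disc_velocity_def vec_eq_iff DERIV_imp_deriv)
  qed (auto simp: disc_velocity_def push_def)
qed

text \<open>Radial discs of the ball are the competitors in the Kobayashi metric. By
  \<open>disc_velocity_ball_param\<close> their velocity is \<open>push h w\<close>.\<close>

lemma holomorphic_disc_ball_param:
  assumes h: "ball_param h" and w: "norm w = 1" and M: "\<And>z. norm z < 1 \<Longrightarrow> h z \<in> M"
  shows "holomorphic_disc X A M (\<lambda>\<zeta>. h (\<zeta> *s w))"
  unfolding holomorphic_disc_def
proof (intro conjI)
  have "continuous_on (ball 0 1) (\<lambda>\<zeta>. \<zeta> *s w)"
    using continuous_on_line[of "ball 0 1" 0 w] by simp
  then have "continuous_map (top_of_set (ball 0 1)) X (h \<circ> (\<lambda>\<zeta>. \<zeta> *s w))"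
    using h w unfolding ball_param_def
    by (intro continuous_map_compose[of _ "top_of_set (ball 0 1)"]) (auto simp: norm_vector_smult)
  then show "continuous_map (top_of_set (ball 0 1)) X (\<lambda>\<zeta>. h (\<zeta> *s w))" by (simp add: comp_def)
  show "(\<lambda>\<zeta>. h (\<zeta> *s w)) ` ball 0 1 \<subseteq> M" using M w by (auto simp: norm_vector_smult)
  have "(\<lambda>\<zeta>. \<phi> (h (\<zeta> *s w)) $ i) holomorphic_on {\<zeta> \<in> ball 0 1. h (\<zeta> *s w) \<in> U}"
    if "(U, \<phi>) \<in> A" for U \<phi> i
    using hol_map_line_holomorphic_on[OF ball_param_chart[OF h that],
        of "{\<zeta> \<in> ball 0 1. h (\<zeta> *s w) \<in> U}" 0 w i] w
    by (auto simp: norm_vector_smult)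
  then show "\<forall>(U, \<phi>)\<in>A. \<forall>i. (\<lambda>\<zeta>. \<phi> (h (\<zeta> *s w)) $ i) holomorphic_on {\<zeta> \<in> ball 0 1. h (\<zeta> *s w) \<in> U}"
    by blast
qed

end

section \<open>Degeneracy of the Kobayashi metric\<close>

text \<open>Continuity together with holomorphy along complex lines is what
  \<open>psh_pole_bound\<close> asks for. The latter follows from Weierstrass' theorem in one
  variable.\<close>

lemma locally_uniform_limit_hol_map:
  fixes F :: "(complex, 'n::finite) vec \<Rightarrow> (complex, 'm::finite) vec"
  assumes lim: "\<And>z. z \<in> S \<Longrightarrow> \<exists>N j0. open N \<and> z \<in> N \<and> N \<subseteq> S \<and>
      (\<forall>j\<ge>j0. hol_map_on (f j) N) \<and> uniform_limit N f F sequentially"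
  shows "continuous_on S F"
    and "(\<lambda>\<zeta>. F (x + \<zeta> *s v) $ i) holomorphic_on {\<zeta>. x + \<zeta> *s v \<in> S}"
proof -
  show "continuous_on S F"
    unfolding continuous_on_eq_continuous_within
  proof
    fix z assume "z \<in> S"
    then obtain N j0 where N: "open N" "z \<in> N" "\<forall>j\<ge>j0. hol_map_on (f j) N"
      "uniform_limit N f F sequentially" using lim by blast
    have "continuous_on N F"
    proof (rule uniform_limit_theorem[OF _ N(4)])
      show "\<forall>\<^sub>F n in sequentially. continuous_on N (f n)"
        unfolding eventually_sequentially using N(3) hol_map_on_imp_continuous_on by blast
    qed simp
    then have "isCont F z" using N(1,2) by (simp add: continuous_on_eq_continuous_at)
    then show "continuous (at z within S) F" by (rule continuous_at_imp_continuous_at_within)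
  qed
  show "(\<lambda>\<zeta>. F (x + \<zeta> *s v) $ i) holomorphic_on {\<zeta>. x + \<zeta> *s v \<in> S}"
    unfolding holomorphic_on_def
  proof
    fix \<zeta> assume "\<zeta> \<in> {\<zeta>. x + \<zeta> *s v \<in> S}"
    then obtain N j0 where N: "open N" "x + \<zeta> *s v \<in> N" "\<forall>j\<ge>j0. hol_map_on (f j) N"
      "uniform_limit N f F sequentially" using lim by blast
    define D where "D = {\<zeta>. x + \<zeta> *s v \<in> N}"
    have D: "open D" unfolding D_def by (rule open_line_preimage[OF N(1)])
    \<comment> \<open>The shift by \<open>j0\<close> makes every member of the sequence holomorphic,
      as the convergence theorem requires.\<close>
    have ul: "uniform_limit D (\<lambda>n \<zeta>. f (n + j0) (x + \<zeta> *s v) $ i) (\<lambda>\<zeta>. F (x + \<zeta> *s v) $ i) sequentially"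
      unfolding uniform_limit_iff
    proof (intro allI impI)
      fix e :: real assume "e > 0"
      then have "\<forall>\<^sub>F n in sequentially. \<forall>y\<in>N. dist (f n y) (F y) < e"
        using N(4) unfolding uniform_limit_iff by blast
      then have "\<forall>\<^sub>F n in sequentially. \<forall>y\<in>N. dist (f (n + j0) y) (F y) < e"
        by (rule eventually_sequentially_seg[THEN iffD2])
      then show "\<forall>\<^sub>F n in sequentially. \<forall>\<zeta>\<in>D. dist (f (n + j0) (x + \<zeta> *s v) $ i) (F (x + \<zeta> *s v) $ i) < e"
        by (rule eventually_mono) (auto simp: D_def intro: le_less_trans[OF dist_vec_nth_le])
    qed
    have "(\<lambda>\<zeta>. F (x + \<zeta> *s v) $ i) holomorphic_on D"
    proof (rule holomorphic_uniform_sequence[OF D])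
      show "(\<lambda>\<zeta>. f (n + j0) (x + \<zeta> *s v) $ i) holomorphic_on D" for n
        by (rule hol_map_line_holomorphic_on[of _ N]) (use N(3) in \<open>auto simp: D_def\<close>)
      show "\<exists>d>0. cball \<xi> d \<subseteq> D \<and> uniform_limit (cball \<xi> d)
          (\<lambda>n \<zeta>. f (n + j0) (x + \<zeta> *s v) $ i) (\<lambda>\<zeta>. F (x + \<zeta> *s v) $ i) sequentially" if "\<xi> \<in> D" for \<xi>
        using D that ul uniform_limit_on_subset unfolding open_contains_cball by blast
    qed
    then have "(\<lambda>\<zeta>. F (x + \<zeta> *s v) $ i) field_differentiable at \<zeta>"
      using D N(2) by (simp add: D_def holomorphic_on_imp_differentiable_at)
    then show "(\<lambda>\<zeta>. F (x + \<zeta> *s v) $ i) field_differentiable at \<zeta> within {\<zeta>. x + \<zeta> *s v \<in> S}"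
      by (rule field_differentiable_at_within)
  qed
qed

context complex_mfd
begin

text \<open>Spelled out by discs instead of a vanishing \<open>kobayashi_metric\<close>: a real
  \<open>Inf\<close> also has a value on the empty set, and the discs themselves are needed to
  refute hyperbolicity.\<close>

definition degenerate_vector :: "'a set \<Rightarrow> 'a \<Rightarrow> ('a, 'n) tangent \<Rightarrow> bool" where
  "degenerate_vector M p v \<longleftrightarrow> v \<in> tangent_space A p \<and> v \<noteq> 0 \<and>
     (\<forall>\<epsilon>>0. \<exists>r f. 0 < r \<and> r < \<epsilon> \<and> holomorphic_disc X A M f \<and> f 0 = p \<and>
        v = tangent_scale (complex_of_real r) (disc_velocity A f))"

text \<open>If \<open>E.A j u\<close> gets arbitrarily small for some nonzero \<open>u\<close>, then
  \<open>push (h 0) u\<close> is degenerate. Otherwise \<open>limit_map\<close> applies.\<close>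

lemma degenerate_or_limit:
  assumes op: "\<And>j. openin X (Mj j)" and bih: "\<And>j. biholomorphic_to_ball X A (Mj j)"
    and inc: "incseq Mj" and M: "M = (\<Union>j. Mj j)" and p: "p \<in> M"
    and nondeg: "\<nexists>v. degenerate_vector M p v"
  obtains N g G where "\<And>j. openin X (N j)" "incseq N" "M = (\<Union>j. N j)" "\<And>j. mfd_map (N j) (g j)"
    and "\<And>j x. x \<in> N j \<Longrightarrow> norm (g j x) < 1"
    and "\<And>j k x. x \<in> N j \<Longrightarrow> j \<le> k \<Longrightarrow> norm (g k x) \<le> norm (g j x)"
    and "\<And>j x. x \<in> N j \<Longrightarrow> norm (G x) \<le> norm (g j x)"
    and "\<And>r \<eta>. r < 1 \<Longrightarrow> \<eta> > 0 \<Longrightarrow> \<exists>J. \<forall>j\<ge>J. \<forall>x\<in>N j.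
           norm (g j x) \<le> r \<longrightarrow> norm (g j x - G x) \<le> \<eta>"
    and "\<And>r. r < 1 \<Longrightarrow> \<exists>K. compactin X K \<and> K \<subseteq> M \<and> (\<forall>x\<in>M. norm (G x) \<le> r \<longrightarrow> x \<in> K)"
proof -
  obtain i0 where i0: "p \<in> Mj i0" using p M by blast
  \<comment> \<open>Dropping the first \<open>i0\<close> sets puts \<open>p\<close> into all of
    them.\<close>
  define M' where "M' = (\<lambda>j. Mj (j + i0))"
  have incM: "Mj i \<subseteq> Mj j" if "i \<le> j" for i j using inc that by (rule incseqD)
  have mono: "M' j \<subseteq> M' k" if "j \<le> k" for j k using incM that by (simp add: M'_def)
  have opM: "openin X (M' j)" for j by (simp add: M'_def op)
  have UM: "M = (\<Union>j. M' j)"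
  proof
    show "M \<subseteq> (\<Union>j. M' j)"
    proof
      fix x assume "x \<in> M"
      then obtain i where "x \<in> Mj i" using M by blast
      then have "x \<in> M' i" using incM[of i "i + i0"] by (auto simp: M'_def)
      then show "x \<in> (\<Union>j. M' j)" by blast
    qed
  qed (auto simp: M'_def M)
  let ?P = "\<lambda>j g h. mfd_map (M' j) g \<and> ball_param h \<and>
    (\<forall>x\<in>M' j. norm (g x) < 1 \<and> h (g x) = x) \<and>
    (\<forall>z. norm z < 1 \<longrightarrow> h z \<in> M' j \<and> g (h z) = z) \<and> h 0 = p"
  have "\<forall>j. \<exists>g h. ?P j g h"
  proof
    fix j
    have "p \<in> M' j" using i0 incM[of i0 "j + i0"] by (auto simp: M'_def)
    then show "\<exists>g h. ?P j g h"
      using biholomorphic_to_ball_normalized[of "M' j" p] bih[of "j + i0"]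
      unfolding M'_def by (metis (no_types, lifting))
  qed
  then obtain g h where P: "\<And>j. ?P j (g j) (h j)" by metis
  have g: "mfd_map (M' j) (g j)" and h: "ball_param (h j)" and h0: "h j 0 = p" for j
    using P by auto
  interpret E: ball_exhaustion M' g h
  proof
    show "open {z \<in> ball 0 1. h k z \<in> M' j}" for j k
      by (rule open_ball_param_preimage[OF h opM])
    show "hol_map_on (\<lambda>z. g j (h k z)) {z \<in> ball 0 1. h k z \<in> M' j}" for j k
      by (rule hol_map_on_overlap[OF h g opM])
  qed (use P mono in auto)
  have nd: "\<exists>\<delta>>0. \<forall>j. \<delta> \<le> norm (E.A j u)" if u: "u \<noteq> 0" for u
  proof (rule ccontr)
    assume "\<not> ?thesis"
    then have small: "\<exists>j. norm (E.A j u) < \<delta>" if "\<delta> > 0" for \<delta> using that by (meson not_less)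
    define v where "v = push (h 0) u"
    have "v \<in> tangent_space A p" using push_in_tangent_space[OF h, of 0 u] by (simp add: v_def h0)
    moreover have "v \<noteq> 0"
      using push_eq_0[OF h g opM, of 0 0 u] P[of 0] u i0 by (auto simp: v_def M'_def)
    moreover have "\<exists>r f. 0 < r \<and> r < \<epsilon> \<and> holomorphic_disc X A M f \<and> f 0 = p \<and>
        v = tangent_scale (complex_of_real r) (disc_velocity A f)" if \<epsilon>: "\<epsilon> > 0" for \<epsilon>
    proof -
      obtain j where j: "norm (E.A j u) < \<epsilon>" using small[OF \<epsilon>] by blast
      \<comment> \<open>In the coordinates of \<open>M' j\<close> the vector \<open>v\<close> is
        \<open>E.A j u\<close>, so a radial disc of that ball realises it with factor
        \<open>r\<close>.\<close>
      define r where "r = norm (E.A j u)"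
      have r: "r > 0" using E.A_inj u by (auto simp: r_def)
      define w where "w = complex_of_real (1 / r) *s E.A j u"
      have w: "norm w = 1" "complex_of_real r *s w = E.A j u"
        using r by (simp_all add: w_def norm_vector_smult r_def vector_smult_assoc norm_divide)
      have "v = push (h j) (E.A j u)"
        unfolding v_def
      proof (rule push_compose[where T = "E.T 0 j" and D = "E.A j", OF h h _ E.T_0])
        show "(E.T 0 j has_derivative E.A j) (at 0)"
          unfolding E.A_def by (rule E.T_has_derivative) simp
        show "h j (E.T 0 j z) = h 0 z" if "norm z < 1" for z
          using E.hg[OF E.hM_le[of 0 j z]] that by (simp add: E.T_def)
      qed
      also have "\<dots> = tangent_scale (complex_of_real r) (disc_velocity A (\<lambda>\<zeta>. h j (\<zeta> *s w)))"
        unfolding disc_velocity_ball_param[OF h] push_smult[OF h, symmetric] w(2) ..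
      finally have "v = tangent_scale (complex_of_real r) (disc_velocity A (\<lambda>\<zeta>. h j (\<zeta> *s w)))" .
      moreover have "holomorphic_disc X A M (\<lambda>\<zeta>. h j (\<zeta> *s w))"
        by (rule holomorphic_disc_ball_param[OF h w(1)]) (use P UM in blast)
      ultimately show ?thesis
        using r j h0 by (intro exI[of _ r] exI[of _ "\<lambda>\<zeta>. h j (\<zeta> *s w)"]) (auto simp: r_def)
    qed
    ultimately show False using nondeg unfolding degenerate_vector_def by blast
  qed
  show thesis
  proof (rule E.limit_map[OF nd])
    fix \<sigma> :: "nat \<Rightarrow> nat" and G
    assume \<sigma>: "strict_mono \<sigma>"
    assume unif: "\<And>r \<eta>. r < 1 \<Longrightarrow> \<eta> > 0 \<Longrightarrow> \<exists>J. \<forall>j\<ge>J. \<forall>x\<in>M' (\<sigma> j).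
           norm (g (\<sigma> j) x) \<le> r \<longrightarrow> norm (g (\<sigma> j) x - G x) \<le> \<eta>"
    assume Gle: "\<And>j x. x \<in> M' (\<sigma> j) \<Longrightarrow> norm (G x) \<le> norm (g (\<sigma> j) x)"
    assume comp: "\<And>r. r < 1 \<Longrightarrow> \<exists>j. \<exists>r'<1. \<forall>x\<in>(\<Union>j. M' j). norm (G x) \<le> r \<longrightarrow> x \<in> h (\<sigma> j) ` cball 0 r'"
    have \<sigma>le: "\<sigma> j \<le> \<sigma> k" if "j \<le> k" for j k using \<sigma> that by (simp add: strict_mono_less_eq)
    show thesis
    proof (rule that[of "\<lambda>j. M' (\<sigma> j)" "\<lambda>j. g (\<sigma> j)" G])
      show "incseq (\<lambda>j. M' (\<sigma> j))" unfolding incseq_def using mono \<sigma>le by blast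
      show "M = (\<Union>j. M' (\<sigma> j))"
      proof
        show "M \<subseteq> (\<Union>j. M' (\<sigma> j))" using UM mono[OF seq_suble[OF \<sigma>]] by blast
      qed (use UM in blast)
      show "\<exists>K. compactin X K \<and> K \<subseteq> M \<and> (\<forall>x\<in>M. norm (G x) \<le> r \<longrightarrow> x \<in> K)" if r: "r < 1" for r
      proof -
        obtain j r' where j: "r' < 1" "\<forall>x\<in>M. norm (G x) \<le> r \<longrightarrow> x \<in> h (\<sigma> j) ` cball 0 r'"
          using comp[OF r] UM by blast
        have sub: "cball 0 r' \<subseteq> ball (0 :: (complex, 'n) vec) 1" using j(1) by auto
        then have "compactin (top_of_set (ball 0 1)) (cball (0 :: (complex, 'n) vec) r')"
          by (simp add: compactin_subtopology)
        then have "compactin X (h (\<sigma> j) ` cball 0 r')"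
          using h[of "\<sigma> j"] unfolding ball_param_def by (auto intro: image_compactin)
        moreover have "h (\<sigma> j) ` cball 0 r' \<subseteq> M"
        proof
          fix x assume "x \<in> h (\<sigma> j) ` cball 0 r'"
          then obtain z where "x = h (\<sigma> j) z" "norm z < 1" using j(1) by auto
          then have "x \<in> M' (\<sigma> j)" using E.hM by simp
          then show "x \<in> M" using UM by blast
        qed
        ultimately show ?thesis using j(2) by blast
      qed
      show "\<exists>J. \<forall>j\<ge>J. \<forall>x\<in>M' (\<sigma> j). norm (g (\<sigma> j) x) \<le> r \<longrightarrow> norm (g (\<sigma> j) x - G x) \<le> \<eta>"
        if "r < 1" "\<eta> > 0" for r \<eta> by (rule unif[OF that])
      show "norm (g (\<sigma> k) x) \<le> norm (g (\<sigma> j) x)" if "x \<in> M' (\<sigma> j)" "j \<le> k" for j k x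
        by (rule E.norm_g_antimono[OF that(1) \<sigma>le[OF that(2)]])
    qed (use opM g P Gle in auto)
  qed
qed

text \<open>Otherwise \<open>P\<close> is open as well as closed and contains the component of any
  of its points, where \<open>u\<close> would be -\<infinity> throughout.\<close>

lemma pluripolar_boundary_point:
  assumes P: "closedin X P" "P \<noteq> {}" and pp: "complete_pluripolar X A P"
  obtains p where "p \<in> P" "\<And>Q. openin X Q \<Longrightarrow> p \<in> Q \<Longrightarrow> \<exists>x\<in>Q. x \<in> topspace X - P"
proof (rule ccontr)
  note wit = that
  assume no: "\<not> thesis"
  have "openin X P"
  proof (subst openin_subopen, intro ballI)
    fix p assume p: "p \<in> P"
    have "\<not> (\<forall>Q. openin X Q \<longrightarrow> p \<in> Q \<longrightarrow> (\<exists>x\<in>Q. x \<in> topspace X - P))"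
    proof
      assume "\<forall>Q. openin X Q \<longrightarrow> p \<in> Q \<longrightarrow> (\<exists>x\<in>Q. x \<in> topspace X - P)"
      then have thesis by (intro wit[OF p]) simp
      then show False using no by contradiction
    qed
    then obtain O' where O': "openin X O'" "p \<in> O'" "\<forall>x\<in>O'. x \<notin> topspace X - P"
      by meson
    then have "O' \<subseteq> P" using openin_subset by blast
    then show "\<exists>T. openin X T \<and> p \<in> T \<and> T \<subseteq> P" using O' by blast
  qed
  obtain q where q: "q \<in> P" using P(2) by blast
  then have qX: "q \<in> topspace X" using P(1) closedin_subset by blast
  obtain u where "mfd_psh_on A (topspace X) u \<and>
      (\<forall>C\<in>connected_components_of X. \<exists>x\<in>C. u x \<noteq> -\<infinity>) \<and> P = {x \<in> topspace X. u x = -\<infinity>}"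
    using pp unfolding complete_pluripolar_def by (rule exE)
  note u = conjunct1[OF conjunct2[OF this]] conjunct2[OF conjunct2[OF this]]
  define C where "C = connected_component_of_set X q"
  have "C \<in> connected_components_of X" using qX by (auto simp: C_def connected_components_of_def)
  then obtain x where x: "x \<in> C" "u x \<noteq> -\<infinity>" using u(1) by blast
  have "connectedin X C" by (simp add: C_def connectedin_connected_component_of)
  then have "C \<subseteq> P \<or> disjnt C P" using P(1) \<open>openin X P\<close> by (rule connectedin_clopen_cases)
  moreover have "q \<in> C" using qX by (simp add: C_def connected_component_of_refl)
  ultimately show False using q x u(2) by (auto simp: disjnt_def)
qed

lemma exists_degenerate_vector:
  assumes op: "\<And>j. openin X (Mj j)" and bih: "\<And>j. biholomorphic_to_ball X A (Mj j)"
    and inc: "incseq Mj" and M: "M = (\<Union>j. Mj j)"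
    and P: "closedin X P" "complete_pluripolar X A P" "P \<noteq> {}" and MP: "M = topspace X - P"
    and p: "p \<in> M"
  shows "\<exists>v. degenerate_vector M p v"
proof (rule ccontr)
  assume "\<not> ?thesis"
  then obtain N g G where N: "\<And>j. openin X (N j)" "incseq N" "M = (\<Union>j. N j)"
    and g: "\<And>j. mfd_map (N j) (g j)"
    and g1: "\<And>j x. x \<in> N j \<Longrightarrow> norm (g j x) < 1"
    and ganti: "\<And>j k x. x \<in> N j \<Longrightarrow> j \<le> k \<Longrightarrow> norm (g k x) \<le> norm (g j x)"
    and Gle: "\<And>j x. x \<in> N j \<Longrightarrow> norm (G x) \<le> norm (g j x)"
    and unif: "\<And>r \<eta>. r < 1 \<Longrightarrow> \<eta> > 0 \<Longrightarrow> \<exists>J. \<forall>j\<ge>J. \<forall>x\<in>N j.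
           norm (g j x) \<le> r \<longrightarrow> norm (g j x - G x) \<le> \<eta>"
    and comp: "\<And>r. r < 1 \<Longrightarrow> \<exists>K. compactin X K \<and> K \<subseteq> M \<and> (\<forall>x\<in>M. norm (G x) \<le> r \<longrightarrow> x \<in> K)"
    using degenerate_or_limit[OF op bih inc M p] by blast
  have opM: "openin X M" unfolding M using op by blast
  obtain q where q: "q \<in> P" and nb: "\<And>O'. openin X O' \<Longrightarrow> q \<in> O' \<Longrightarrow> \<exists>x\<in>O'. x \<in> M"
    using pluripolar_boundary_point[OF P(1,3,2)] MP by metis
  have "q \<in> topspace X" using q P(1) closedin_subset by blast
  then obtain U \<phi> where U: "(U, \<phi>) \<in> A" "q \<in> U" by (rule obtain_chart)
  define \<psi> where "\<psi> = inv_into U \<phi>"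
  have \<psi>: "\<psi> (\<phi> x) = x" if "x \<in> U" for x using chart_inv[OF U(1) that] by (simp add: \<psi>_def)
  obtain u where "mfd_psh_on A (topspace X) u \<and>
      (\<forall>C\<in>connected_components_of X. \<exists>x\<in>C. u x \<noteq> -\<infinity>) \<and> P = {x \<in> topspace X. u x = -\<infinity>}"
    using P(2) unfolding complete_pluripolar_def by (rule exE)
  note u = conjunct1[OF this] conjunct2[OF conjunct2[OF this]]
  have UX: "U \<inter> topspace X = U" using chart_subset[OF U(1)] by blast
  have psh: "mv_psh_on (\<lambda>z. u (\<psi> z)) (\<phi> ` U)"
    using u(1) U(1) UX unfolding mfd_psh_on_def \<psi>_def by (auto simp: comp_def)
  define S where "S = \<phi> ` (U \<inter> M)"
  have S: "S = {z \<in> \<phi> ` U. u (\<psi> z) \<noteq> -\<infinity>}"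
    using \<psi> UX unfolding S_def MP u(2) by auto
  have "open S" unfolding S_def by (rule open_chart_image[OF U(1) opM])
  have clo: "\<phi> q \<in> closure S"
    unfolding closure_approachable
  proof (intro allI impI)
    fix e :: real assume "e > 0"
    then have "q \<in> {x \<in> U. \<phi> x \<in> ball (\<phi> q) e}" using U(2) by simp
    then obtain x where "x \<in> U" "\<phi> x \<in> ball (\<phi> q) e" "x \<in> M"
      using nb[OF openin_chart_preimage[OF U(1) open_ball]] by blast
    then show "\<exists>y\<in>S. dist y (\<phi> q) < e" by (auto simp: S_def dist_commute)
  qed
  have lim: "\<exists>W j0. open W \<and> z \<in> W \<and> W \<subseteq> S \<and> (\<forall>j\<ge>j0. hol_map_on (\<lambda>z. g j (\<psi> z)) W) \<and>
      uniform_limit W (\<lambda>j z. g j (\<psi> z)) (\<lambda>z. G (\<psi> z)) sequentially" if z: "z \<in> S" for z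
  proof -
    obtain x0 where x0: "z = \<phi> x0" "x0 \<in> U" "x0 \<in> M" using z unfolding S_def by blast
    then obtain j0 where j0: "x0 \<in> N j0" using N(3) by blast
    obtain r where r: "norm (g j0 x0) < r" "r < 1" using dense[OF g1[OF j0]] by blast
    \<comment> \<open>On \<open>W\<close> all later \<open>g j\<close> have norm at most
      \<open>r\<close>, again by monotonicity, so the estimate \<open>unif\<close> for this one
      radius gives uniform convergence.\<close>
    define W where "W = \<phi> ` (U \<inter> N j0) \<inter> (\<lambda>z. g j0 (\<psi> z)) -` ball 0 r"
    have holW: "hol_map_on (\<lambda>z. g j (\<psi> z)) (\<phi> ` (U \<inter> N j0))" if "j \<ge> j0" for j
      using mfd_map_chart[OF g U(1), of j] incseqD[OF N(2) that]
      unfolding \<psi>_def by (auto elim!: hol_map_on_subset)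
    have "open W"
      unfolding W_def
      by (rule continuous_open_preimage[OF hol_map_on_imp_continuous_on[OF holW[OF order_refl]]
            open_chart_image[OF U(1) N(1)] open_ball])
    moreover have "z \<in> W" using x0 j0 r(1) \<psi> by (auto simp: W_def)
    moreover have "W \<subseteq> S" using N(3) by (auto simp: W_def S_def)
    moreover have "hol_map_on (\<lambda>z. g j (\<psi> z)) W" if "j \<ge> j0" for j
      using holW[OF that] by (rule hol_map_on_subset) (auto simp: W_def)
    moreover have "uniform_limit W (\<lambda>j z. g j (\<psi> z)) (\<lambda>z. G (\<psi> z)) sequentially"
      unfolding uniform_limit_iff
    proof (intro allI impI)
      fix e :: real assume e: "e > 0"
      then obtain J where J: "\<And>j x. j \<ge> J \<Longrightarrow> x \<in> N j \<Longrightarrow> norm (g j x) \<le> r \<Longrightarrow> norm (g j x - G x) \<le> e / 2"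
        using unif[OF r(2), of "e / 2"] by auto
      have "dist (g j (\<psi> y)) (G (\<psi> y)) < e" if j: "j \<ge> max J j0" and y: "y \<in> W" for j y
      proof -
        obtain x where x: "\<psi> y = x" "x \<in> N j0" "norm (g j0 x) < r"
          using y \<psi> by (auto simp: W_def)
        have "x \<in> N j" using x(2) incseqD[OF N(2), of j0 j] j by auto
        moreover have "norm (g j x) \<le> r" using ganti[OF x(2), of j] x(3) j by simp
        ultimately have "norm (g j x - G x) \<le> e / 2" using J j by simp
        then show ?thesis using e x(1) by (simp add: dist_norm)
      qed
      then show "\<forall>\<^sub>F n in sequentially. \<forall>y\<in>W. dist (g n (\<psi> y)) (G (\<psi> y)) < e"
        unfolding eventually_sequentially by blast
    qed
    ultimately show ?thesis by blast
  qed
  have G1: "norm (G (\<psi> z)) < 1" if z: "z \<in> S" for z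
  proof -
    obtain x where "\<psi> z = x" "x \<in> M" using z \<psi> by (auto simp: S_def)
    then show ?thesis using N(3) Gle g1 by (metis UN_E order_le_less_trans)
  qed
  obtain c e where c: "c < 1" "e > 0"
    and bound: "\<And>z. z \<in> S \<Longrightarrow> dist z (\<phi> q) < e \<Longrightarrow> (norm (G (\<psi> z)))\<^sup>2 \<le> c"
    using psh_pole_bound[OF chart(2)[OF U(1)] psh S \<open>open S\<close> _ clo
        locally_uniform_limit_hol_map(1)[OF lim] locally_uniform_limit_hol_map(2)[OF lim] G1] U(2)
    by blast
  \<comment> \<open>\<open>c\<close> may be negative, so the square root is taken of
    \<open>max c 0\<close>.\<close>
  obtain r where r: "r < 1" "r \<ge> 0" "c \<le> r\<^sup>2"
  proof
    show "sqrt (max c 0) < 1" using c(1) by simp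
    show "c \<le> (sqrt (max c 0))\<^sup>2" by simp
  qed simp
  obtain K where K: "compactin X K" "K \<subseteq> M" "\<forall>x\<in>M. norm (G x) \<le> r \<longrightarrow> x \<in> K"
    using comp[OF r(1)] by blast
  \<comment> \<open>\<open>K\<close> is closed and lies in \<open>M\<close>, so it misses a
    neighbourhood of \<open>q\<close>. But the points of \<open>M\<close> close to \<open>q\<close>
    satisfy \<open>norm (G x) \<le> r\<close> and belong to \<open>K\<close>.\<close>
  have "closedin X K" by (rule compactin_imp_closedin[OF Hausdorff K(1)])
  then have "openin X ({x \<in> U. \<phi> x \<in> ball (\<phi> q) e} - K)"
    using openin_chart_preimage[OF U(1) open_ball] by (rule openin_diff[rotated])
  moreover have "q \<in> {x \<in> U. \<phi> x \<in> ball (\<phi> q) e} - K" using U(2) c(2) K(2) q MP by auto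
  ultimately have "\<exists>x\<in>{x \<in> U. \<phi> x \<in> ball (\<phi> q) e} - K. x \<in> M" by (rule nb)
  then obtain x where x: "x \<in> U" "\<phi> x \<in> ball (\<phi> q) e" "x \<notin> K" "x \<in> M" by blast
  have "\<phi> x \<in> S" using x(1,4) by (simp add: S_def)
  moreover have "dist (\<phi> x) (\<phi> q) < e" using x(2) by (simp add: dist_commute)
  ultimately have "(norm (G (\<psi> (\<phi> x))))\<^sup>2 \<le> c" by (rule bound)
  then have "(norm (G x))\<^sup>2 \<le> r\<^sup>2" using r(3) \<psi>[OF x(1)] by simp
  then have "norm (G x) \<le> r" using r(2) by (rule power2_le_imp_le)
  then show False using K(3) x by blast
qed

section \<open>The corank\<close>

text \<open>\<open>vector_space.dim\<close> is the cardinality of a basis and would be 0 for an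
  infinite one. A positive corank therefore needs finite dimension.\<close>

lemma tangent_space_finite_span:
  assumes "p \<in> topspace X"
  obtains W where "finite W" "tangent_space A p \<subseteq> module.span tangent_scale W"
proof -
  interpret tv: vector_space "tangent_scale :: complex \<Rightarrow> ('a, 'n) tangent \<Rightarrow> ('a, 'n) tangent"
    by (rule vector_space_tangent_scale)
  obtain U \<phi> where U: "(U, \<phi>) \<in> A" "p \<in> U" using assms by (rule obtain_chart)
  define D where "D = (\<lambda>d. frechet_derivative (transition_map (U, \<phi>) d) (at (\<phi> p)))"
  \<comment> \<open>The coordinate vector fields of the chart \<open>(U, \<phi>)\<close> at
    \<open>p\<close>, expressed in all charts.\<close>
  define t where "t = (\<lambda>i c. if c \<in> A \<and> p \<in> fst c then D c (axis i 1) else 0)"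
  have D: "D d x = (\<Sum>i\<in>UNIV. x $ i *s D d (axis i 1))" if d: "d \<in> A" "p \<in> fst d" for d x
  proof -
    have dA: "(fst d, snd d) \<in> A" using d by simp
    have "hol_map_on (transition_map (U, \<phi>) d) (\<phi> ` (U \<inter> fst d))"
      using hol_map_on_transition[OF U(1) dA] by (simp add: transition_map_def comp_def)
    moreover have "\<phi> p \<in> \<phi> ` (U \<inter> fst d)" using U(2) d(2) by blast
    ultimately have lin: "linear (D d)" and s: "D d (k *s y) = k *s D d y" for k y
      unfolding D_def using frechet_derivative_hol_map has_derivative_linear by blast+
    have "x = (\<Sum>i\<in>UNIV. x $ i *s axis i 1)"
      by (simp add: basis_expansion)
    then have "D d x = D d (\<Sum>i\<in>UNIV. x $ i *s axis i 1)" by simp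
    also have "\<dots> = (\<Sum>i\<in>UNIV. D d (x $ i *s axis i 1))" by (rule linear_sum[OF lin])
    finally show ?thesis by (simp add: s)
  qed
  have app: "(\<Sum>i\<in>I. f i) c = (\<Sum>i\<in>I. f i c)" for f :: "'n \<Rightarrow> ('a, 'n) tangent" and I c
    by (induction I rule: infinite_finite_induct) auto
  have span: "v \<in> tv.span (range t)" if v: "v \<in> tangent_space A p" for v
  proof -
    have "v = (\<Sum>i\<in>UNIV. tangent_scale (v (U, \<phi>) $ i) (t i))"
    proof
      fix c
      show "v c = (\<Sum>i\<in>UNIV. tangent_scale (v (U, \<phi>) $ i) (t i)) c"
      proof (cases "c \<in> A \<and> p \<in> fst c")
        case True
        have "\<forall>c\<in>A. \<forall>d\<in>A. p \<in> fst c \<and> p \<in> fst d \<longrightarrow>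
            v d = frechet_derivative (transition_map c d) (at (snd c p)) (v c)"
          using v unfolding tangent_space_def mem_Collect_eq by (elim conjE)
        then have "v c = D c (v (U, \<phi>))"
          using U True unfolding D_def by fastforce
        then show ?thesis using True D[of c "v (U, \<phi>)"] by (simp add: app tangent_scale_def t_def)
      next
        case False
        then have "v c = 0" using v unfolding tangent_space_def by blast
        then show ?thesis using False by (auto simp: app tangent_scale_def t_def)
      qed
    qed
    then show ?thesis
      using tv.span_sum[of UNIV "\<lambda>i. tangent_scale (v (U, \<phi>) $ i) (t i)" "range t"]
        tv.span_scale[OF tv.span_base] by simp
  qed
  show thesis by (rule that[of "range t"]) (use span in auto)
qed

lemma degenerate_vector_corank:
  assumes v: "degenerate_vector M p v" and p: "p \<in> topspace X"
  shows "1 \<le> kobayashi_corank X A M p"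
proof -
  interpret tv: vector_space "tangent_scale :: complex \<Rightarrow> ('a, 'n) tangent \<Rightarrow> ('a, 'n) tangent"
    by (rule vector_space_tangent_scale)
  define V where "V = {v \<in> tangent_space A p. kobayashi_metric X A M p v = 0}"
  define S where "S = {r. 0 < r \<and> (\<exists>f. holomorphic_disc X A M f \<and> f 0 = p \<and>
                          v = tangent_scale (complex_of_real r) (disc_velocity A f))}"
  have S: "\<exists>r\<in>S. r < \<epsilon>" if "\<epsilon> > 0" for \<epsilon>
    using v that unfolding degenerate_vector_def S_def by blast
  have "S \<noteq> {}" using S[of 1] by auto
  have bdd: "bdd_below S" by (rule bdd_belowI[of _ 0]) (auto simp: S_def)
  have "0 \<le> Inf S" using \<open>S \<noteq> {}\<close> by (intro cInf_greatest) (auto simp: S_def)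
  moreover have "Inf S \<le> 0"
  proof (rule ccontr)
    assume "\<not> Inf S \<le> 0"
    then obtain r where "r \<in> S" "r < Inf S" using S[of "Inf S"] by auto
    then show False using cInf_lower[OF _ bdd, of r] by simp
  qed
  ultimately have "kobayashi_metric X A M p v = 0" by (simp add: kobayashi_metric_def S_def)
  then have vV: "v \<in> V" using v by (simp add: V_def degenerate_vector_def)
  \<comment> \<open>\<open>tv.dim V\<close> counts a maximal independent subset of \<open>V\<close>.
    It is nonempty because \<open>V\<close> contains the nonzero vector \<open>v\<close>.\<close>
  obtain B where B: "B \<subseteq> V" "tv.independent B" "V \<subseteq> tv.span B" "card B = tv.dim V"
    by (rule tv.basis_exists)
  obtain W where W: "finite W" "tangent_space A p \<subseteq> tv.span W"
    using tangent_space_finite_span[OF p] by blast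
  have "B \<subseteq> tv.span W" using B(1) W(2) by (auto simp: V_def)
  then have "finite B" using tv.independent_span_bound[OF W(1) B(2)] by blast
  moreover have "B \<noteq> {}" using B(3) vV v by (auto simp: degenerate_vector_def)
  ultimately have "1 \<le> card B" by (simp add: Suc_le_eq card_gt_0_iff)
  then show ?thesis using B(4) by (simp add: kobayashi_corank_def V_def)
qed

section \<open>Failure of hyperbolicity\<close>

lemma holomorphic_disc_chart:
  assumes U: "(U, \<phi>) \<in> A" and sub: "\<And>\<xi>. cmod \<xi> < 1 \<Longrightarrow> y + \<xi> *s w \<in> \<phi> ` (U \<inter> M)"
  shows "holomorphic_disc X A M (\<lambda>\<xi>. inv_into U \<phi> (y + \<xi> *s w))"
  unfolding holomorphic_disc_def
proof (intro conjI)
  have sub': "\<exists>x\<in>U \<inter> M. y + \<xi> *s w = \<phi> x \<and> inv_into U \<phi> (y + \<xi> *s w) = x" if "cmod \<xi> < 1" for \<xi>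
    using sub[OF that] chart_inv[OF U] by auto
  have inU: "y + \<xi> *s w \<in> \<phi> ` U" if "cmod \<xi> < 1" for \<xi> using sub[OF that] by blast
  have "continuous_map (top_of_set (ball 0 1)) X (inv_into U \<phi> \<circ> (\<lambda>\<xi>. y + \<xi> *s w))"
    by (rule continuous_map_compose[OF _ chart_inv_continuous[OF U]])
       (use inU continuous_on_line[of "ball 0 1" y w] in auto)
  then show "continuous_map (top_of_set (ball 0 1)) X (\<lambda>\<xi>. inv_into U \<phi> (y + \<xi> *s w))"
    by (simp add: comp_def)
  show "(\<lambda>\<xi>. inv_into U \<phi> (y + \<xi> *s w)) ` ball 0 1 \<subseteq> M" using sub' by force
  have "(\<lambda>\<xi>. \<psi> (inv_into U \<phi> (y + \<xi> *s w)) $ i) holomorphic_on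
      {\<xi> \<in> ball 0 1. inv_into U \<phi> (y + \<xi> *s w) \<in> V}" if V: "(V, \<psi>) \<in> A" for V \<psi> i
    by (rule hol_map_line_holomorphic_on[OF hol_map_on_transition[OF U V]]) (use sub' in force)
  then show "\<forall>(V, \<psi>)\<in>A. \<forall>i. (\<lambda>\<xi>. \<psi> (inv_into U \<phi> (y + \<xi> *s w)) $ i) holomorphic_on
      {\<xi> \<in> ball 0 1. inv_into U \<phi> (y + \<xi> *s w) \<in> V}" by blast
qed

end

text \<open>A chain of length two: the first disc runs from its centre \<open>p\<close> to the
  meeting point, the second from there back to its centre \<open>q\<close>. The Poincare distance of
  a point from 0 is the \<open>artanh\<close> of its modulus.\<close>

lemma kobayashi_dist_two_discs:
  assumes "holomorphic_disc X A M f" "holomorphic_disc X A M f'"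
    and "cmod \<zeta> < 1" "cmod b < 1" "f 0 = p" "f \<zeta> = f' b" "f' 0 = q"
  shows "kobayashi_dist X A M p q \<le> ereal (artanh (cmod \<zeta>) + artanh (cmod b))"
  unfolding kobayashi_dist_def
proof (rule Inf_lower, intro CollectI exI conjI)
  let ?x = "\<lambda>i::nat. if i = 0 then p else if i = 1 then f \<zeta> else q"
  let ?f = "\<lambda>i::nat. if i = 0 then f else f'"
  let ?a = "\<lambda>i::nat. if i = 0 then 0 else b"
  let ?b = "\<lambda>i::nat. if i = 0 then \<zeta> else 0"
  show "ereal (artanh (cmod \<zeta>) + artanh (cmod b)) = ereal (\<Sum>i<2. poincare_dist (?a i) (?b i))"
    by (simp add: numeral_2_eq_2 poincare_dist_def)
  show "?x 0 = p" "?x 2 = q" by auto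
  show "\<forall>i<2. holomorphic_disc X A M (?f i) \<and> ?a i \<in> ball 0 1 \<and> ?b i \<in> ball 0 1 \<and>
      ?f i (?a i) = ?x i \<and> ?f i (?b i) = ?x (Suc i)"
    using assms by (auto simp: less_2_cases_iff)
qed

context complex_mfd
begin

text \<open>Cauchy's inequality bounds the velocity of a disc that keeps the radius \<open>t\<close>
  inside a coordinate ball. A degenerate vector admits discs of larger velocity, and by
  connectedness these meet the sphere.\<close>

lemma degenerate_vector_escape:
  assumes v: "degenerate_vector M p v" and U: "(U, \<phi>) \<in> A" "p \<in> U" and i: "v (U, \<phi>) $ i \<noteq> 0"
    and R: "0 < R" "cball (\<phi> p) R \<subseteq> \<phi> ` U" and t: "0 < t" "t < 1"
  obtains f \<zeta> where "holomorphic_disc X A M f" "f 0 = p" "cmod \<zeta> < t" "f \<zeta> \<in> U"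
    "\<phi> (f \<zeta>) \<in> sphere (\<phi> p) R"
proof -
  \<comment> \<open>Cauchy's inequality on the circle of radius \<open>t / 2\<close> will give
    \<open>cmod (v (U, \<phi>) $ i) \<le> r * (2 * R / t)\<close>, which is impossible for
    \<open>r < \<epsilon>\<close>.\<close>
  define \<epsilon> where "\<epsilon> = cmod (v (U, \<phi>) $ i) * t / (2 * R)"
  have "\<epsilon> > 0" using i R t by (simp add: \<epsilon>_def)
  then obtain r f where r: "0 < r" "r < \<epsilon>" and f: "holomorphic_disc X A M f" "f 0 = p"
    and vf: "v = tangent_scale (complex_of_real r) (disc_velocity A f)"
    using v unfolding degenerate_vector_def by blast
  have cf: "continuous_map (top_of_set (ball 0 1)) X f"
    and hf: "(\<lambda>\<zeta>. \<phi> (f \<zeta>) $ i) holomorphic_on {\<zeta> \<in> ball 0 1. f \<zeta> \<in> U}"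
    using f(1) U(1) unfolding holomorphic_disc_def by auto
  define W where "W = {x \<in> U. \<phi> x \<in> ball (\<phi> p) R}"
  define K where "K = inv_into U \<phi> ` cball (\<phi> p) R"
  have W: "openin X W" unfolding W_def by (rule openin_chart_preimage[OF U(1) open_ball])
  have "compactin (top_of_set (\<phi> ` U)) (cball (\<phi> p) R)" using R(2) by (simp add: compactin_subtopology)
  then have "compactin X K"
    unfolding K_def by (rule image_compactin[OF _ chart_inv_continuous[OF U(1)]])
  then have K: "closedin X K" by (rule compactin_imp_closedin[OF Hausdorff])
  have KU: "x \<in> U \<and> \<phi> x \<in> cball (\<phi> p) R" if "x \<in> K" for x
    using that R(2) inv_into_into[of _ \<phi> U] f_inv_into_f[of _ \<phi> U] unfolding K_def by (auto simp: subset_iff)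
  have "\<exists>\<zeta>. cmod \<zeta> < t \<and> f \<zeta> \<in> U \<and> \<phi> (f \<zeta>) \<in> sphere (\<phi> p) R"
  proof (rule ccontr)
    assume no: "\<not> ?thesis"
    have open_pre: "open {\<zeta> \<in> ball 0 1. f \<zeta> \<in> O'}" if "openin X O'" for O'
    proof -
      have "openin (top_of_set (ball 0 1)) {\<zeta> \<in> topspace (top_of_set (ball 0 1)). f \<zeta> \<in> O'}"
        by (rule openin_continuous_map_preimage[OF cf that])
      then show ?thesis by (auto intro: openin_open_trans)
    qed
    let ?S = "{\<zeta> \<in> ball 0 1. f \<zeta> \<in> W}" and ?S' = "{\<zeta> \<in> ball 0 1. f \<zeta> \<in> topspace X - K}"
    have WK: "W \<subseteq> K"
    proof
      fix x assume "x \<in> W"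
      then have "x = inv_into U \<phi> (\<phi> x)" "\<phi> x \<in> cball (\<phi> p) R"
        using chart_inv[OF U(1)] by (auto simp: W_def)
      then show "x \<in> K" unfolding K_def by blast
    qed
    have fX: "f \<zeta> \<in> topspace X" if "cmod \<zeta> < 1" for \<zeta>
      using cf that unfolding continuous_map_def by (auto simp: Pi_iff)
    have cover: "ball 0 t \<subseteq> ?S \<union> ?S'"
    proof
      fix \<zeta> :: complex assume "\<zeta> \<in> ball 0 t"
      then have \<zeta>: "cmod \<zeta> < t" "cmod \<zeta> < 1" using t by auto
      have "f \<zeta> \<in> W" if "f \<zeta> \<in> K"
        using KU[OF that] no \<zeta>(1) by (auto simp: W_def less_le)
      then show "\<zeta> \<in> ?S \<union> ?S'" using \<zeta> fX by auto
    qed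
    \<comment> \<open>A disc avoiding the sphere is split into the preimages of the open coordinate
      ball \<open>W\<close> and of the complement of the closed one \<open>K\<close>.
      \<open>K\<close> is closed in \<open>X\<close> because it is compact and \<open>X\<close> is
      Hausdorff.\<close>
    have "?S \<inter> ball 0 t = {} \<or> ?S' \<inter> ball 0 t = {}"
      by (rule connectedD[OF _ open_pre[OF W] open_pre[OF openin_diff[OF openin_topspace K]] _ cover])
         (use WK in auto)
    moreover have "0 \<in> ?S \<inter> ball 0 t" using f(2) U(2) R(1) t by (simp add: W_def)
    ultimately have "?S' \<inter> ball 0 t = {}" by blast
    then have "ball 0 t \<subseteq> ?S" using cover by blast
    then have inW: "f \<zeta> \<in> W" if "cmod \<zeta> < t" for \<zeta> using that by (auto simp: subset_iff)
    define F where "F = (\<lambda>\<zeta>. \<phi> (f \<zeta>) $ i - \<phi> p $ i)"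
    have holF: "F holomorphic_on ball 0 t"
      unfolding F_def
      by (intro holomorphic_intros holomorphic_on_subset[OF hf]) (use inW t in \<open>auto simp: W_def\<close>)
    have "norm ((deriv ^^ 1) F 0) \<le> fact 1 * R / (t / 2) ^ 1"
    proof (rule Cauchy_inequality)
      show "F holomorphic_on ball 0 (t / 2)" using holF by (rule holomorphic_on_subset) (use t in auto)
      show "continuous_on (cball 0 (t / 2)) F"
        using holomorphic_on_imp_continuous_on[OF holF] by (rule continuous_on_subset) (use t in auto)
      show "norm (F x) \<le> R" if "norm (0 - x) = t / 2" for x
      proof -
        have "f x \<in> W" using inW that t by simp
        then have "norm (\<phi> (f x) - \<phi> p) < R" by (simp add: W_def dist_norm norm_minus_commute)
        then show ?thesis using Finite_Cartesian_Product.norm_nth_le[of "\<phi> (f x) - \<phi> p" i]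
          by (simp add: F_def)
      qed
    qed (use t in simp)
    then have dF: "cmod (deriv F 0) \<le> 2 * R / t" by (simp add: mult.commute)
    have "(F has_field_derivative deriv F 0) (at 0)"
      using holomorphic_derivI[OF holF] t by simp
    then have "((\<lambda>\<zeta>. F \<zeta> + \<phi> p $ i) has_field_derivative deriv F 0 + 0) (at 0)"
      by (intro DERIV_add DERIV_const)
    then have "deriv (\<lambda>\<zeta>. \<phi> (f \<zeta>) $ i) 0 = deriv F 0"
      using DERIV_imp_deriv by (auto simp: F_def)
    then have "v (U, \<phi>) $ i = complex_of_real r * deriv F 0"
      using vf U f(2) by (simp add: tangent_scale_def disc_velocity_def)
    then have "cmod (v (U, \<phi>) $ i) = r * cmod (deriv F 0)" using r(1) by (simp add: norm_mult)
    also have "\<dots> \<le> r * (2 * R / t)" using dF r(1) by (intro mult_left_mono) auto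
    also have "\<dots> < \<epsilon> * (2 * R / t)" using r(2) R t by (intro mult_strict_right_mono) auto
    also have "\<dots> = cmod (v (U, \<phi>) $ i)" using R t by (simp add: \<epsilon>_def)
    finally show False by simp
  qed
  then show thesis using that f by blast
qed

text \<open>The exit points of faster and faster discs accumulate at a point \<open>l\<close> of the
  coordinate sphere. The exit parameters tend to 0, and the last short way to \<open>l\<close> is
  covered by an affine disc of fixed radius, so both terms of the two-disc bound tend to 0.\<close>

lemma degenerate_vector_not_hyperbolic:
  assumes v: "degenerate_vector M p v" and M: "openin X M" "p \<in> M"
  shows "\<not> kobayashi_hyperbolic X A M"
proof -
  obtain c where "v c \<noteq> 0" using v by (auto simp: degenerate_vector_def fun_eq_iff)
  moreover have "\<forall>c. \<not> (c \<in> A \<and> p \<in> fst c) \<longrightarrow> v c = 0"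
    using v unfolding degenerate_vector_def tangent_space_def mem_Collect_eq by (elim conjE)
  ultimately have "c \<in> A" "p \<in> fst c" by blast+
  then obtain U \<phi> where U: "(U, \<phi>) \<in> A" "p \<in> U" and "v (U, \<phi>) \<noteq> 0"
    using \<open>v c \<noteq> 0\<close> by (cases c) auto
  then obtain i where i: "v (U, \<phi>) $ i \<noteq> 0" by (auto simp: vec_eq_iff)
  define a where "a = \<phi> p"
  have "open (\<phi> ` (U \<inter> M))" by (rule open_chart_image[OF U(1) M(1)])
  moreover have "a \<in> \<phi> ` (U \<inter> M)" using U(2) M(2) by (auto simp: a_def)
  ultimately obtain e where e: "e > 0" "cball a e \<subseteq> \<phi> ` (U \<inter> M)"
    unfolding open_contains_cball by blast
  \<comment> \<open>Half the radius, so that the ball of radius \<open>R\<close> about a point of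
    the sphere still lies in the image of \<open>U \<inter> M\<close>.\<close>
  define R where "R = e / 2"
  have R: "R > 0" "cball a (2 * R) \<subseteq> \<phi> ` (U \<inter> M)" using e by (simp_all add: R_def)
  have "cball a R \<subseteq> cball a (2 * R)" using R(1) by (intro subset_cball) simp
  then have RU: "cball a R \<subseteq> \<phi> ` U" using R(2) by blast
  \<comment> \<open>The summand 2 keeps the parameter radius below 1 also for
    \<open>n = 0\<close>.\<close>
  have "\<exists>f \<zeta>. holomorphic_disc X A M f \<and> f 0 = p \<and> cmod \<zeta> < 1 / real (n + 2) \<and> f \<zeta> \<in> U \<and>
      \<phi> (f \<zeta>) \<in> sphere a R" for n
    using degenerate_vector_escape[OF v U i R(1), of "1 / real (n + 2)"] RU
    unfolding a_def by (metis divide_less_eq_1_pos less_add_same_cancel2 of_nat_0_less_iff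
        of_nat_1 of_nat_less_iff one_add_one one_less_numeral_iff semiring_norm(76)
        trans_less_add2 zero_less_divide_1_iff)
  then obtain f \<zeta> where f: "\<And>n. holomorphic_disc X A M (f n)" "\<And>n. f n 0 = p"
    and \<zeta>: "\<And>n. cmod (\<zeta> n) < 1 / real (n + 2)" and fU: "\<And>n. f n (\<zeta> n) \<in> U"
    and fs: "\<And>n. \<phi> (f n (\<zeta> n)) \<in> sphere a R"
    by metis
  define y where "y = (\<lambda>n. \<phi> (f n (\<zeta> n)))"
  have "seq_compact (sphere a R)" by (simp add: compact_imp_seq_compact)
  then obtain l \<sigma> where l: "l \<in> sphere a R" and \<sigma>: "strict_mono \<sigma>" and lim: "(y \<circ> \<sigma>) \<longlonglongrightarrow> l"
    using fs unfolding seq_compact_def y_def by meson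
  have inUM: "z \<in> \<phi> ` (U \<inter> M)" if "dist l z < R" for z
  proof -
    have "dist a z \<le> 2 * R" using that l dist_triangle[of a z l] by simp
    then show ?thesis using R(2) by auto
  qed
  define q where "q = inv_into U \<phi> l"
  obtain x where x: "x \<in> U" "x \<in> M" "l = \<phi> x" using inUM[of l] R(1) by auto
  then have q: "q \<in> M" "\<phi> q = l" by (auto simp: q_def chart_inv[OF U(1)])
  have "p \<noteq> q" using l R(1) q(2) by (auto simp: a_def)
  \<comment> \<open>The parameter at which the affine disc of radius \<open>R\<close> centred at
    \<open>l\<close> passes through \<open>y (\<sigma> n)\<close>.\<close>
  define b where "b = (\<lambda>n. dist (y (\<sigma> n)) l / R)"
  have blim: "b \<longlonglongrightarrow> 0"
    using tendsto_divide[OF tendsto_dist[OF lim tendsto_const[of l]] tendsto_const[of R]] R(1)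
    by (simp add: b_def comp_def)
  have \<zeta>lim: "(\<lambda>n. cmod (\<zeta> (\<sigma> n))) \<longlonglongrightarrow> 0"
  proof (rule tendsto_sandwich[OF _ _ tendsto_const LIMSEQ_inverse_real_of_nat])
    have "cmod (\<zeta> (\<sigma> n)) \<le> inverse (real (Suc n))" for n
    proof -
      have "cmod (\<zeta> (\<sigma> n)) \<le> 1 / real (\<sigma> n + 2)" using \<zeta>[of "\<sigma> n"] by simp
      also have "\<dots> \<le> 1 / real (Suc n)" using seq_suble[OF \<sigma>, of n] by (intro divide_left_mono) auto
      finally show ?thesis by (simp add: inverse_eq_divide)
    qed
    then show "\<forall>\<^sub>F n in sequentially. cmod (\<zeta> (\<sigma> n)) \<le> inverse (real (Suc n))" by simp
  qed simp
  have "(\<lambda>n. artanh (cmod (\<zeta> (\<sigma> n))) + artanh (b n)) \<longlonglongrightarrow> artanh 0 + artanh 0"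
    by (intro tendsto_intros blim \<zeta>lim) auto
  then have alim: "(\<lambda>n. artanh (cmod (\<zeta> (\<sigma> n))) + artanh (b n)) \<longlonglongrightarrow> 0" by simp
  have dist: "kobayashi_dist X A M p q \<le> ereal (artanh (cmod (\<zeta> (\<sigma> n))) + artanh (b n))" if b1: "b n < 1" for n
  proof -
    have b0: "b n \<ge> 0" using R(1) by (simp add: b_def)
    obtain w where w: "norm w = R" "y (\<sigma> n) = l + complex_of_real (b n) *s w"
    proof (cases "y (\<sigma> n) = l")
      case True
      then show ?thesis
        using that[of "complex_of_real R *s axis undefined 1"] R(1) by (simp add: norm_vector_smult b_def)
    next
      case False
      then have b: "b n > 0" using R(1) by (simp add: b_def)
      show ?thesis
      proof (rule that)
        show "norm (complex_of_real (1 / b n) *s (y (\<sigma> n) - l)) = R"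
          unfolding norm_vector_smult norm_of_real using b R(1) False by (simp add: b_def dist_norm)
        show "y (\<sigma> n) = l + complex_of_real (b n) *s (complex_of_real (1 / b n) *s (y (\<sigma> n) - l))"
          unfolding vector_smult_assoc of_real_mult[symmetric] using b by simp
      qed
    qed
    define F where "F = (\<lambda>\<xi>. inv_into U \<phi> (l + \<xi> *s w))"
    have disc: "holomorphic_disc X A M F"
      unfolding F_def
    proof (rule holomorphic_disc_chart[OF U(1)], rule inUM)
      show "dist l (l + \<xi> *s w) < R" if "cmod \<xi> < 1" for \<xi>
        using that R(1) w(1) by (simp add: dist_norm norm_vector_smult)
    qed
    have "F 0 = q" by (simp add: F_def q_def)
    moreover have "f (\<sigma> n) (\<zeta> (\<sigma> n)) = F (complex_of_real (b n))"
      using chart_inv[OF U(1) fU[of "\<sigma> n"]] w(2) by (simp add: F_def y_def)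
    moreover have "cmod (\<zeta> (\<sigma> n)) < 1"
      by (rule less_le_trans[OF \<zeta>]) simp
    ultimately show ?thesis
      using kobayashi_dist_two_discs[OF f(1) disc, of "\<zeta> (\<sigma> n)" "of_real (b n)" "\<sigma> n" p q] b0 b1 f(2)
      by simp
  qed
  have "\<not> 0 < kobayashi_dist X A M p q"
  proof
    assume "0 < kobayashi_dist X A M p q"
    then obtain \<delta> where \<delta>: "0 < ereal \<delta>" "ereal \<delta> < kobayashi_dist X A M p q"
      using ereal_dense2 by blast
    have "\<forall>\<^sub>F n in sequentially. artanh (cmod (\<zeta> (\<sigma> n))) + artanh (b n) < \<delta> \<and> b n < 1"
      using order_tendstoD(2)[OF alim, of \<delta>] order_tendstoD(2)[OF blim, of 1] \<delta>(1)
      by (auto intro: eventually_conj)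
    then obtain n where n: "artanh (cmod (\<zeta> (\<sigma> n))) + artanh (b n) < \<delta>" "b n < 1"
      using eventually_happens'[OF sequentially_bot] by blast
    have "ereal \<delta> < ereal (artanh (cmod (\<zeta> (\<sigma> n))) + artanh (b n))"
      using \<delta>(2) dist[OF n(2)] by (rule less_le_trans)
    then show False using n(1) by simp
  qed
  then show ?thesis
    using M(2) q(1) \<open>p \<noteq> q\<close> unfolding kobayashi_hyperbolic_def by blast
qed

end

theorem theorem1p8:
  fixes X :: "'a topology"
    and A :: "('a, 'n::finite) chart set"
    and Mj :: "nat \<Rightarrow> 'a set"
    and M P :: "'a set"
  assumes "stein_manifold X A"
    and "\<And>j. openin X (Mj j)"
    and "\<And>j. biholomorphic_to_ball X A (Mj j)"
    and "incseq Mj"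
    and "M = (\<Union>j. Mj j)"
    and "closedin X P"
    and "complete_pluripolar X A P"
    and "P \<noteq> {}"
    and "M = topspace X - P"
  shows "(\<forall>p\<in>M. 1 \<le> kobayashi_corank X A M p) \<and> \<not> kobayashi_hyperbolic X A M"
proof -
  interpret complex_mfd X A
    using assms(1) by unfold_locales (simp add: stein_manifold_def)
  have deg: "\<exists>v. degenerate_vector M p v" if "p \<in> M" for p
    by (rule exists_degenerate_vector[OF assms(2-9) that])
  \<comment> \<open>Non-hyperbolicity needs a point of \<open>M\<close>: the image of the centre of
    the ball.\<close>
  obtain g h where "\<forall>z\<in>ball 0 1. h z \<in> Mj 0 \<and> (g (h z) :: (complex, 'n) vec) = z"
    using assms(3)[of 0] unfolding biholomorphic_to_ball_def by blast
  then have "h 0 \<in> M" using assms(5) by auto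
  moreover have "openin X M" using assms(2,5) by blast
  ultimately have "\<not> kobayashi_hyperbolic X A M"
    using deg degenerate_vector_not_hyperbolic by blast
  moreover have "1 \<le> kobayashi_corank X A M p" if "p \<in> M" for p
    using deg[OF that] degenerate_vector_corank that assms(9) by blast
  ultimately show ?thesis by blast
qed

end
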